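(* (In $\mathsf{ZF}$.) For every infinite set $A$, if there is a finitary partition of $A$ without singleton blocks, then for every $n\in\omega$ there is no finite-to-one function from $\mathscr{B}(A)$ to $A^n$.
   Context: Work in $\mathsf{ZF}$. A partition is finitary if all its blocks are finite; $\mathscr{B}(A)$ is the set of finitary partitions of $A$. $A^n$ is the set of functions from $n$ to $A$. A function $f$ is finite-to-one if $f^{-1}[\{z\}]$ is finite for every $z\in\mathrm{ran}(f)$. *)

theory Defs
  imports Main
begin

text \<open>
  HOL has a choice operator, so a statement about HOL sets could not express a theorem of
  choiceless set theory.  Theorems of ZF are therefore stated for an arbitrary structure
  \<open>('v, \<epsilon>)\<close> satisfying the first-order axioms of ZF.  All set-theoretic notions are interpreted
  inside the structure: the definitions in the locale \<open>mem_structure\<close> use only \<open>\<epsilon>\<close>, equality,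
  propositional connectives and quantifiers over \<open>'v\<close>, so each of them is a first-order
  property.  Separation and replacement are schemes over formulas with parameters; stating them
  for all HOL predicates would make the axiom of choice true in the structure.
\<close>

text \<open>Formulas of the language of set theory, with de Bruijn indices.\<close>

datatype fm = Mem nat nat | Equal nat nat | Neg fm | Conj fm fm | All fm

locale mem_structure =
  fixes mem :: "'v \<Rightarrow> 'v \<Rightarrow> bool"  (infix "\<epsilon>" 50)
begin

primrec sat :: "(nat \<Rightarrow> 'v) \<Rightarrow> fm \<Rightarrow> bool" where
  "sat e (Mem i j) \<longleftrightarrow> e i \<epsilon> e j"
| "sat e (Equal i j) \<longleftrightarrow> e i = e j"
| "sat e (Neg p) \<longleftrightarrow> \<not> sat e p"
| "sat e (Conj p q) \<longleftrightarrow> sat e p \<and> sat e q"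
| "sat e (All p) \<longleftrightarrow> (\<forall>x. sat (case_nat x e) p)"

definition is_subset :: "'v \<Rightarrow> 'v \<Rightarrow> bool" where
  "is_subset x y \<longleftrightarrow> (\<forall>z. z \<epsilon> x \<longrightarrow> z \<epsilon> y)"

definition is_empty :: "'v \<Rightarrow> bool" where
  "is_empty x \<longleftrightarrow> (\<forall>z. \<not> z \<epsilon> x)"

definition is_upair :: "'v \<Rightarrow> 'v \<Rightarrow> 'v \<Rightarrow> bool" where
  "is_upair p x y \<longleftrightarrow> (\<forall>z. z \<epsilon> p \<longleftrightarrow> z = x \<or> z = y)"

definition is_singleton :: "'v \<Rightarrow> bool" where
  "is_singleton s \<longleftrightarrow> (\<exists>x. is_upair s x x)"

text \<open>Kuratowski pairs.\<close>

definition is_pair :: "'v \<Rightarrow> 'v \<Rightarrow> 'v \<Rightarrow> bool" where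
  "is_pair p x y \<longleftrightarrow> (\<exists>a b. is_upair a x x \<and> is_upair b x y \<and> is_upair p a b)"

definition is_union :: "'v \<Rightarrow> 'v \<Rightarrow> bool" where
  "is_union u x \<longleftrightarrow> (\<forall>z. z \<epsilon> u \<longleftrightarrow> (\<exists>y. y \<epsilon> x \<and> z \<epsilon> y))"

definition is_powerset :: "'v \<Rightarrow> 'v \<Rightarrow> bool" where
  "is_powerset p x \<longleftrightarrow> (\<forall>z. z \<epsilon> p \<longleftrightarrow> is_subset z x)"

definition is_successor :: "'v \<Rightarrow> 'v \<Rightarrow> bool" where
  "is_successor s x \<longleftrightarrow> (\<forall>z. z \<epsilon> s \<longleftrightarrow> z \<epsilon> x \<or> z = x)"

definition is_inductive :: "'v \<Rightarrow> bool" where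
  "is_inductive w \<longleftrightarrow>
     (\<exists>z. is_empty z \<and> z \<epsilon> w) \<and> (\<forall>x. x \<epsilon> w \<longrightarrow> (\<exists>s. is_successor s x \<and> s \<epsilon> w))"

text \<open>
  Membership in \<open>\<omega>\<close>, the least inductive set.  This may include elements that are not standard
  natural numbers from the point of view of HOL.
\<close>

definition in_omega :: "'v \<Rightarrow> bool" where
  "in_omega n \<longleftrightarrow> (\<forall>w. is_inductive w \<longrightarrow> n \<epsilon> w)"

definition maps_to :: "'v \<Rightarrow> 'v \<Rightarrow> 'v \<Rightarrow> bool" where
  "maps_to f x y \<longleftrightarrow> (\<exists>p. is_pair p x y \<and> p \<epsilon> f)"

definition is_function :: "'v \<Rightarrow> 'v \<Rightarrow> 'v \<Rightarrow> bool" where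
  "is_function f X Y \<longleftrightarrow>
     (\<forall>p. p \<epsilon> f \<longrightarrow> (\<exists>x y. x \<epsilon> X \<and> y \<epsilon> Y \<and> is_pair p x y)) \<and>
     (\<forall>x. x \<epsilon> X \<longrightarrow> (\<exists>!y. maps_to f x y))"

definition is_bijection :: "'v \<Rightarrow> 'v \<Rightarrow> 'v \<Rightarrow> bool" where
  "is_bijection f X Y \<longleftrightarrow> is_function f X Y \<and> (\<forall>y. y \<epsilon> Y \<longrightarrow> (\<exists>!x. maps_to f x y))"

definition is_finite :: "'v \<Rightarrow> bool" where
  "is_finite X \<longleftrightarrow> (\<exists>n f. in_omega n \<and> is_bijection f n X)"

definition is_infinite :: "'v \<Rightarrow> bool" where
  "is_infinite X \<longleftrightarrow> \<not> is_finite X"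

definition is_preimage_of_point :: "'v \<Rightarrow> 'v \<Rightarrow> 'v \<Rightarrow> bool" where
  "is_preimage_of_point S f z \<longleftrightarrow> (\<forall>x. x \<epsilon> S \<longleftrightarrow> maps_to f x z)"

definition is_finite_to_one :: "'v \<Rightarrow> bool" where
  "is_finite_to_one f \<longleftrightarrow>
     (\<forall>z. (\<exists>x. maps_to f x z) \<longrightarrow> (\<exists>S. is_preimage_of_point S f z \<and> is_finite S))"

definition is_partition :: "'v \<Rightarrow> 'v \<Rightarrow> bool" where
  "is_partition P A \<longleftrightarrow>
     is_union A P \<and>
     (\<forall>b. b \<epsilon> P \<longrightarrow> \<not> is_empty b) \<and>
     (\<forall>b c. b \<epsilon> P \<and> c \<epsilon> P \<and> b \<noteq> c \<longrightarrow> \<not> (\<exists>x. x \<epsilon> b \<and> x \<epsilon> c))"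

definition is_finitary_partition :: "'v \<Rightarrow> 'v \<Rightarrow> bool" where
  "is_finitary_partition P A \<longleftrightarrow> is_partition P A \<and> (\<forall>b. b \<epsilon> P \<longrightarrow> is_finite b)"

text \<open>\<open>B = \<B>(A)\<close>\<close>

definition is_finitary_partitions :: "'v \<Rightarrow> 'v \<Rightarrow> bool" where
  "is_finitary_partitions B A \<longleftrightarrow> (\<forall>P. P \<epsilon> B \<longleftrightarrow> is_finitary_partition P A)"

text \<open>\<open>Y = A\<^sup>n\<close>\<close>

definition is_function_space :: "'v \<Rightarrow> 'v \<Rightarrow> 'v \<Rightarrow> bool" where
  "is_function_space Y n A \<longleftrightarrow> (\<forall>f. f \<epsilon> Y \<longleftrightarrow> is_function f n A)"

end

text \<open>
  In the two schemes the environment \<open>e\<close> supplies the parameters; in \<open>replacement\<close>, index 0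
  stands for the value \<open>y\<close> and index 1 for the argument \<open>x\<close>.
\<close>

locale ZF = mem_structure +
  assumes extensionality: "(\<forall>z. z \<epsilon> x \<longleftrightarrow> z \<epsilon> y) \<Longrightarrow> x = y"
    and foundation: "\<not> is_empty x \<Longrightarrow> \<exists>y. y \<epsilon> x \<and> \<not> (\<exists>z. z \<epsilon> x \<and> z \<epsilon> y)"
    and pairing: "\<exists>p. is_upair p x y"
    and union: "\<exists>u. is_union u x"
    and powerset: "\<exists>p. is_powerset p x"
    and infinity: "\<exists>w. is_inductive w"
    and separation: "\<exists>b. \<forall>x. x \<epsilon> b \<longleftrightarrow> x \<epsilon> a \<and> sat (case_nat x e) \<phi>"
    and replacement:
      "(\<And>x y y'. x \<epsilon> a \<Longrightarrow> sat (case_nat y (case_nat x e)) \<phi> \<Longrightarrow>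
                 sat (case_nat y' (case_nat x e)) \<phi> \<Longrightarrow> y = y') \<Longrightarrow>
       \<exists>b. \<forall>y. y \<epsilon> b \<longleftrightarrow> (\<exists>x. x \<epsilon> a \<and> sat (case_nat y (case_nat x e)) \<phi>)"

end

theory Submission
  imports Defs
begin

text \<open>
  Let \<open>P\<close> be a finitary partition of \<open>A\<close> without singleton blocks. Splitting the blocks in
  \<open>Z \<subseteq> P\<close> into points embeds the power set of \<open>P\<close> into \<open>\<B>(A)\<close>, and \<open>a \<mapsto> [a]\<close> is finite-to-one, so a
  finite-to-one map \<open>\<B>(A) \<rightarrow> A\<^sup>n\<close> yields a finite-to-one map \<open>g\<close> from the power set of \<open>X = P\<close> to
  \<open>X\<^sup>n\<close>, where \<open>X\<close> is infinite.

  Call a set weakly Dedekind finite if it has no map to \<open>\<omega>\<close> with unbounded range. This property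
  passes to finite powers and back along maps with weakly Dedekind finite fibres, and fails for the
  power set of an infinite set because of the cardinalities of its finite subsets. Hence it fails
  for \<open>X\<close>, which gives a decreasing sequence of nonempty subsets of \<open>X\<close> with empty intersection.

  Now every well-ordered \<open>C \<subseteq> X\<close> determines an element of \<open>X\<close> outside \<open>C\<close>, namely a coordinate of
  \<open>g Z\<close> for a suitable \<open>Z\<close>; by Zermelo's argument this is absurd. If \<open>C\<close> is weakly Dedekind finite,
  some set \<open>Z\<close> of the sequence has \<open>g Z \<notin> C\<^sup>n\<close>. Otherwise there is an injection of \<open>C\<^sup>n \<times> C\<close>
  into \<open>C\<close> that is defined uniformly from the well-order: comparing the order type of \<open>C\<close> with the
  powers \<open>\<omega>\<^sup>c\<close>, realized as the finite subsets of \<open>c \<times> \<omega>\<close>, reduces it to merging finite sets. It splits off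
  from \<open>C\<close> an infinite block for each \<open>u \<in> C\<^sup>n\<close>, and \<open>Z\<close> can be chosen to meet the block of \<open>u\<close>
  differently from each of the finitely many sets with value \<open>u\<close>, so that \<open>g Z \<notin> C\<^sup>n\<close>.

  Everything takes place inside the structure, so that separation requires each class to be
  definable by a formula with parameters.
\<close>

section \<open>Definability\<close>

text \<open>A Cantor diagonal against \<open>g\<close> needs room in \<open>X\<close> reserved for
  every \<open>u\<close> in \<open>X^n\<close>, but a general \<open>X\<close> has no injection of
  \<open>X^n \<times> X\<close> into \<open>X\<close>. An infinite well-ordered \<open>C\<close> has
  one, so the diagonal set is formed inside \<open>C\<close>; it defeats only the values in
  \<open>C^n\<close>, and this is why the argument has to move outside \<open>C\<close> step by
  step.

  The step must be a function of the pair \<open>(C, r)\<close>: choosing an injection for each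
  well-order along the recursion would be an appeal to choice. Hence a single formula yields the
  injection for all well-orders, and every other selection is a least element or a least index.

  For a well-ordered \<open>C\<close>, being weakly Dedekind finite amounts to being finite, so the
  split on \<open>wdf C\<close> separates finite from infinite \<open>C\<close>.

  Powers of \<omega> enter through \<open>\<omega>^c = 2^(\<omega>*c)\<close>: they need only finite
  sets and no ordinal arithmetic. If \<open>\<gamma>\<close> is the order type of \<open>C\<close>,
  then \<open>\<gamma> \<le> \<omega>^\<gamma>\<close>. When they are equal, finite subsets of
  \<open>C \<times> \<omega>\<close> are coded by elements of \<open>C\<close>, and a tuple is such
  a subset. Otherwise elements of \<open>C\<close> are finite subsets of
  \<open>(c + 1) \<times> \<omega>\<close> for some \<open>c\<close> in \<open>C\<close>, and
  finitely many of them fit into one finite subset of \<open>c \<times> \<omega>\<close>.\<close>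

primrec rename_fm :: "(nat \<Rightarrow> nat) \<Rightarrow> fm \<Rightarrow> fm" where
  "rename_fm f (Mem i j) = Mem (f i) (f j)"
| "rename_fm f (Equal i j) = Equal (f i) (f j)"
| "rename_fm f (Neg p) = Neg (rename_fm f p)"
| "rename_fm f (Conj p q) = Conj (rename_fm f p) (rename_fm f q)"
| "rename_fm f (All p) = All (rename_fm (case_nat 0 (\<lambda>i. Suc (f i))) p)"

text \<open>Both streams are infinite, so a formula can take on further variables or parameters
  without any count of those in use.\<close>

definition interleave :: "(nat \<Rightarrow> 'a) \<Rightarrow> (nat \<Rightarrow> 'a) \<Rightarrow> nat \<Rightarrow> 'a" where
  "interleave e p i = (if even i then e (i div 2) else p (i div 2))"

lemma interleave_simps [simp]:
  "interleave e p (2 * i) = e i" "interleave e p (Suc (2 * i)) = p i"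
  by (auto simp: interleave_def)

context mem_structure
begin

lemma sat_rename: "sat e (rename_fm f \<phi>) \<longleftrightarrow> sat (\<lambda>i. e (f i)) \<phi>"
proof (induction \<phi> arbitrary: e f)
  case (All \<phi>)
  have "(\<lambda>i. case_nat x e (case_nat 0 (\<lambda>i. Suc (f i)) i)) = case_nat x (\<lambda>i. e (f i))" for x
    by (auto split: nat.split)
  then show ?case by (simp add: All.IH)
qed auto

text \<open>The even indices are the variables, the odd ones the parameters.\<close>

definition definable :: "((nat \<Rightarrow> 'v) \<Rightarrow> bool) \<Rightarrow> bool" where
  "definable Q \<longleftrightarrow> (\<exists>\<phi> p. \<forall>e. sat (interleave e p) \<phi> \<longleftrightarrow> Q e)"

text \<open>A term is represented by its graph, with the value at index 0, since the language has no
  function symbols.\<close>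

definition definable_term :: "((nat \<Rightarrow> 'v) \<Rightarrow> 'v) \<Rightarrow> bool" where
  "definable_term t \<longleftrightarrow> definable (\<lambda>e. e 0 = t (\<lambda>i. e (Suc i)))"

lemma definable_rename:
  assumes "definable Q"
  shows "definable (\<lambda>e. Q (\<lambda>i. e (f i)))"
proof -
  obtain \<phi> p where *: "\<And>e. sat (interleave e p) \<phi> \<longleftrightarrow> Q e"
    using assms by (auto simp: definable_def)
  let ?f = "\<lambda>i. if even i then 2 * f (i div 2) else i"
  have "(\<lambda>i. interleave e p (?f i)) = interleave (\<lambda>i. e (f i)) p" for e
    by (auto simp: interleave_def)
  then show ?thesis
    unfolding definable_def
    by (intro exI[of _ "rename_fm ?f \<phi>"] exI[of _ p]) (simp add: sat_rename *)
qed

lemma definable_mem_var: "definable (\<lambda>e. e i \<epsilon> e j)"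
  unfolding definable_def by (intro exI[of _ "Mem (2 * i) (2 * j)"] exI) simp

lemma definable_eq_var: "definable (\<lambda>e. e i = e j)"
  unfolding definable_def by (intro exI[of _ "Equal (2 * i) (2 * j)"] exI) simp

lemma definable_not:
  assumes "definable P" shows "definable (\<lambda>e. \<not> P e)"
proof -
  obtain \<phi> p where "\<And>e. sat (interleave e p) \<phi> \<longleftrightarrow> P e"
    using assms by (auto simp: definable_def)
  then show ?thesis
    unfolding definable_def by (intro exI[of _ "Neg \<phi>"] exI[of _ p]) simp
qed

lemma definable_conj:
  assumes "definable P" "definable Q"
  shows "definable (\<lambda>e. P e \<and> Q e)"
proof -
  obtain \<phi> p where P: "\<And>e. sat (interleave e p) \<phi> \<longleftrightarrow> P e"
    using assms by (auto simp: definable_def)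
  obtain \<psi> q where Q: "\<And>e. sat (interleave e q) \<psi> \<longleftrightarrow> Q e"
    using assms by (auto simp: definable_def)
  \<comment> \<open>The two parameter lists are merged: the parameters of \<open>\<phi>\<close> go
    to the even places of the new list, those of \<open>\<psi>\<close> to the odd ones, and the
    variables stay where they are.\<close>
  let ?f = "\<lambda>i. if even i then i else Suc (2 * (2 * (i div 2)))"
  let ?g = "\<lambda>i. if even i then i else Suc (2 * Suc (2 * (i div 2)))"
  let ?r = "interleave p q"
  have f: "(\<lambda>i. interleave e ?r (?f i)) = interleave e p" for e
    by (rule ext) (auto simp: interleave_def elim!: oddE)
  have g: "(\<lambda>i. interleave e ?r (?g i)) = interleave e q" for e
    by (rule ext) (auto simp: interleave_def elim!: oddE)
  show ?thesis
    unfolding definable_def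
    by (intro exI[of _ "Conj (rename_fm ?f \<phi>) (rename_fm ?g \<psi>)"] exI[of _ ?r])
      (simp add: sat_rename f g P Q)
qed

lemma definable_all:
  assumes "definable (\<lambda>e. P (e 0) (\<lambda>i. e (Suc i)))"
  shows "definable (\<lambda>e. \<forall>x. P x e)"
proof -
  obtain \<phi> p where P: "\<And>e. sat (interleave e p) \<phi> \<longleftrightarrow> P (e 0) (\<lambda>i. e (Suc i))"
    using assms by (auto simp: definable_def)
  \<comment> \<open>Pushing \<open>x\<close> in front of an environment moves every index by one,
    whereas in \<open>interleave (case_nat x e) p\<close> the variables move by two places and the
    parameters by none. The renaming makes up the difference.\<close>
  let ?f = "\<lambda>i. if i = 0 then 0 else if even i then i - 1 else Suc i"
  have f: "(\<lambda>i. case_nat x (interleave e p) (?f i)) = interleave (case_nat x e) p" for x e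
  proof
    fix i
    show "case_nat x (interleave e p) (?f i) = interleave (case_nat x e) p i"
    proof (cases "even i")
      case True
      then obtain j where "i = 2 * j" by blast
      then show ?thesis by (cases j) (auto simp: interleave_def)
    next
      case False
      then obtain j where "i = Suc (2 * j)" by (metis oddE Suc_eq_plus1)
      then show ?thesis by (auto simp: interleave_def)
    qed
  qed
  show ?thesis
    unfolding definable_def
    by (intro exI[of _ "All (rename_fm ?f \<phi>)"] exI[of _ p]) (simp add: sat_rename f P)
qed

lemma definable_disj:
  assumes "definable P" "definable Q"
  shows "definable (\<lambda>e. P e \<or> Q e)"
  using definable_not[OF definable_conj[OF definable_not[OF assms(1)] definable_not[OF assms(2)]]]
  by simp

lemma definable_imp:
  assumes "definable P" "definable Q"
  shows "definable (\<lambda>e. P e \<longrightarrow> Q e)"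
  using definable_disj[OF definable_not[OF assms(1)] assms(2)] by simp

lemma definable_iff:
  assumes "definable P" "definable Q"
  shows "definable (\<lambda>e. P e \<longleftrightarrow> Q e)"
  using definable_conj[OF definable_imp[OF assms] definable_imp[OF assms(2,1)]]
  by (simp add: iff_conv_conj_imp)

lemma definable_ex:
  assumes "definable (\<lambda>e. P (e 0) (\<lambda>i. e (Suc i)))"
  shows "definable (\<lambda>e. \<exists>x. P x e)"
  using definable_not[OF definable_all[where P = "\<lambda>x e. \<not> P x e", OF definable_not[OF assms]]]
  by simp

lemma definable_eq_const: "definable (\<lambda>e. e i = c)"
  unfolding definable_def by (intro exI[of _ "Equal (2 * i) 1"] exI[of _ "\<lambda>_. c"])
    (simp add: interleave_def)

lemma definable_bool: "definable (\<lambda>e. b)"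
proof (cases b)
  case True
  have "definable (\<lambda>e. e 0 = e 0)" by (rule definable_eq_var)
  then show ?thesis using True by simp
next
  case False
  have "definable (\<lambda>e. \<not> e 0 = e 0)" by (intro definable_not definable_eq_var)
  then show ?thesis using False by simp
qed

lemma definable_term_var: "definable_term (\<lambda>e. e i)"
  unfolding definable_term_def by (rule definable_eq_var)

lemma definable_term_const: "definable_term (\<lambda>e. c)"
  unfolding definable_term_def by (rule definable_eq_const)

lemma definable_term_shift:
  assumes "definable_term t"
  shows "definable_term (\<lambda>e. t (\<lambda>i. e (Suc i)))"
  using definable_rename[OF assms[unfolded definable_term_def], of "case_nat 0 (\<lambda>i. Suc (Suc i))"]
  by (simp add: definable_term_def)

lemma definable_subst:
  assumes "definable (\<lambda>e. P (e 0) (\<lambda>i. e (Suc i)))" "definable_term t"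
  shows "definable (\<lambda>e. P (t e) e)"
proof -
  have "definable (\<lambda>e. \<exists>x. x = t e \<and> P x e)"
    by (rule definable_ex, rule definable_conj)
      (use assms in \<open>simp_all add: definable_term_def\<close>)
  then show ?thesis by simp
qed

lemma definable_subst_first:
  assumes "definable Q" "definable_term t"
  shows "definable (\<lambda>e. Q (case_nat (t e) e))"
proof -
  have "case_nat (e 0) (\<lambda>i. e (Suc i)) = e" for e :: "nat \<Rightarrow> 'v"
    by (auto split: nat.split)
  then show ?thesis
    using definable_subst[where P = "\<lambda>x e. Q (case_nat x e)" and t = t] assms by simp
qed

lemma definable_subst1:
  assumes "definable (\<lambda>e. R (e 0))" "definable_term s"
  shows "definable (\<lambda>e. R (s e))"
  using definable_subst_first[OF assms] by simp

text \<open>The arguments are filled in one after the other at index 0, so a term that is inserted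
  while later places are still open has to be shifted past them. With these rules a new notion needs
  to be proved definable only once, at variables.\<close>

lemma definable_subst2:
  assumes "definable (\<lambda>e. R (e 0) (e (Suc 0)))" "definable_term s" "definable_term t"
  shows "definable (\<lambda>e. R (s e) (t e))"
  using definable_subst_first[OF definable_subst_first[OF assms(1)
      definable_term_shift[OF assms(2)]] assms(3)] by simp

lemma definable_subst3:
  assumes "definable (\<lambda>e. R (e 0) (e (Suc 0)) (e (Suc (Suc 0))))"
    "definable_term s" "definable_term t" "definable_term u"
  shows "definable (\<lambda>e. R (s e) (t e) (u e))"
  using definable_subst_first[OF definable_subst_first[OF definable_subst_first[OF assms(1)
      definable_term_shift[OF definable_term_shift[OF assms(2)]]]
      definable_term_shift[OF assms(3)]] assms(4)] by simp

lemma definable_subst4: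
  assumes "definable (\<lambda>e. R (e 0) (e (Suc 0)) (e (Suc (Suc 0))) (e (Suc (Suc (Suc 0)))))"
    "definable_term s" "definable_term t" "definable_term u" "definable_term v"
  shows "definable (\<lambda>e. R (s e) (t e) (u e) (v e))"
  using definable_subst_first[OF definable_subst_first[OF definable_subst_first[OF
      definable_subst_first[OF assms(1)
      definable_term_shift[OF definable_term_shift[OF definable_term_shift[OF assms(2)]]]]
      definable_term_shift[OF definable_term_shift[OF assms(3)]]]
      definable_term_shift[OF assms(4)]] assms(5)] by simp

lemma definable_subst5:
  assumes "definable (\<lambda>e. R (e 0) (e (Suc 0)) (e (Suc (Suc 0))) (e (Suc (Suc (Suc 0))))
      (e (Suc (Suc (Suc (Suc 0))))))"
    "definable_term s" "definable_term t" "definable_term u" "definable_term v" "definable_term w"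
  shows "definable (\<lambda>e. R (s e) (t e) (u e) (v e) (w e))"
  using definable_subst_first[OF definable_subst_first[OF definable_subst_first[OF
      definable_subst_first[OF definable_subst_first[OF assms(1)
      definable_term_shift[OF definable_term_shift[OF definable_term_shift[OF
        definable_term_shift[OF assms(2)]]]]]
      definable_term_shift[OF definable_term_shift[OF definable_term_shift[OF assms(3)]]]]
      definable_term_shift[OF definable_term_shift[OF assms(4)]]]
      definable_term_shift[OF assms(5)]] assms(6)] by simp

lemma definable_term_subst1:
  assumes "definable_term (\<lambda>e. F (e 0))" "definable_term s"
  shows "definable_term (\<lambda>e. F (s e))"
  unfolding definable_term_def
  using definable_subst2[where R = "\<lambda>x y. x = F y", OF _ definable_term_var
      definable_term_shift[OF assms(2)]] assms(1)
  by (simp add: definable_term_def)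

lemma definable_term_subst2:
  assumes "definable_term (\<lambda>e. F (e 0) (e (Suc 0)))" "definable_term s" "definable_term t"
  shows "definable_term (\<lambda>e. F (s e) (t e))"
  unfolding definable_term_def
  using definable_subst3[where R = "\<lambda>x y z. x = F y z", OF _ definable_term_var
      definable_term_shift[OF assms(2)] definable_term_shift[OF assms(3)]] assms(1)
  by (simp add: definable_term_def)

lemma definable_term_subst3:
  assumes "definable_term (\<lambda>e. F (e 0) (e (Suc 0)) (e (Suc (Suc 0))))"
    "definable_term s" "definable_term t" "definable_term u"
  shows "definable_term (\<lambda>e. F (s e) (t e) (u e))"
  unfolding definable_term_def
  using definable_subst4[where R = "\<lambda>x y z w. x = F y z w", OF _ definable_term_var
      definable_term_shift[OF assms(2)] definable_term_shift[OF assms(3)]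
      definable_term_shift[OF assms(4)]] assms(1)
  by (simp add: definable_term_def)

lemma definable_term_subst4:
  assumes "definable_term (\<lambda>e. F (e 0) (e (Suc 0)) (e (Suc (Suc 0))) (e (Suc (Suc (Suc 0)))))"
    "definable_term s" "definable_term t" "definable_term u" "definable_term v"
  shows "definable_term (\<lambda>e. F (s e) (t e) (u e) (v e))"
  unfolding definable_term_def
  using definable_subst5[where R = "\<lambda>x y z w z'. x = F y z w z'", OF _ definable_term_var
      definable_term_shift[OF assms(2)] definable_term_shift[OF assms(3)]
      definable_term_shift[OF assms(4)] definable_term_shift[OF assms(5)]] assms(1)
  by (simp add: definable_term_def)

lemma definable_mem: "definable_term s \<Longrightarrow> definable_term t \<Longrightarrow> definable (\<lambda>e. s e \<epsilon> t e)"
  by (rule definable_subst2[where R = mem, OF definable_mem_var])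

lemma definable_eq: "definable_term s \<Longrightarrow> definable_term t \<Longrightarrow> definable (\<lambda>e. s e = t e)"
  by (rule definable_subst2[where R = "(=)", OF definable_eq_var])

named_theorems definability

lemmas [definability] = definable_all definable_ex definable_imp definable_iff definable_conj
  definable_disj definable_not definable_mem definable_eq definable_term_var definable_term_const
  definable_bool

lemma definable_is_subset [definability]:
  "definable_term s \<Longrightarrow> definable_term t \<Longrightarrow> definable (\<lambda>e. is_subset (s e) (t e))"
  by (rule definable_subst2[where R = is_subset], unfold is_subset_def, intro definability)

end

section \<open>Sets, natural numbers and finite sets\<close>

context ZF
begin

lemma ext_eq: "(\<And>z. z \<epsilon> x \<longleftrightarrow> z \<epsilon> y) \<Longrightarrow> x = y"
  using extensionality by blast

lemma sub_antisym: "is_subset x y \<Longrightarrow> is_subset y x \<Longrightarrow> x = y"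
  by (rule ext_eq) (auto simp: is_subset_def)

lemma separation_definable:
  assumes "definable (\<lambda>e. P (e 0))"
  shows "\<exists>b. \<forall>x. x \<epsilon> b \<longleftrightarrow> x \<epsilon> a \<and> P x"
proof -
  obtain \<phi> p where P: "\<And>e. sat (interleave e p) \<phi> \<longleftrightarrow> P (e 0)"
    using assms by (auto simp: definable_def)
  \<comment> \<open>\<open>P\<close> looks at index 0 only, so the other variables receive the
    filler \<open>p 0\<close>. Dropping the first entry makes room for the element that separation
    pushes.\<close>
  define e' where "e' = interleave (\<lambda>i. p 0) p"
  have "case_nat x (\<lambda>i. e' (Suc i)) = interleave (case_nat x (\<lambda>i. p 0)) p" for x
    by (rule ext) (auto simp: e'_def interleave_def split: nat.split elim!: evenE oddE)
  then show ?thesis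
    using separation[of a "\<lambda>i. e' (Suc i)" \<phi>] by (simp add: P)
qed

definition emp :: 'a where
  "emp = (THE x. is_empty x)"

lemma not_mem_emp [simp]: "\<not> x \<epsilon> emp"
proof -
  obtain b where "\<forall>x. x \<epsilon> b \<longleftrightarrow> x \<epsilon> undefined \<and> False"
    using separation_definable[OF definable_bool[of False]] by blast
  then have b: "is_empty b" by (simp add: is_empty_def)
  have "is_empty emp"
    unfolding emp_def
    by (rule theI[of _ b]) (use b in \<open>auto simp: is_empty_def intro: ext_eq\<close>)
  then show ?thesis by (simp add: is_empty_def)
qed

lemma is_empty_iff: "is_empty x \<longleftrightarrow> x = emp"
  by (auto simp: is_empty_def intro: ext_eq)

lemma ex_mem: "x \<noteq> emp \<Longrightarrow> \<exists>y. y \<epsilon> x"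
  using is_empty_iff[of x] by (auto simp: is_empty_def)

text \<open>The junk value for proper classes is \<open>emp\<close>.\<close>

definition coll :: "('a \<Rightarrow> bool) \<Rightarrow> 'a" where
  "coll P = (if \<exists>s. \<forall>x. x \<epsilon> s \<longleftrightarrow> P x then THE s. \<forall>x. x \<epsilon> s \<longleftrightarrow> P x else emp)"

lemma mem_coll:
  assumes "\<exists>s. \<forall>x. x \<epsilon> s \<longleftrightarrow> P x"
  shows "x \<epsilon> coll P \<longleftrightarrow> P x"
proof -
  obtain s where s: "\<forall>x. x \<epsilon> s \<longleftrightarrow> P x" using assms by blast
  have "\<forall>x. x \<epsilon> (THE s. \<forall>x. x \<epsilon> s \<longleftrightarrow> P x) \<longleftrightarrow> P x"
    by (rule theI[of _ s]) (use s in \<open>auto intro: ext_eq\<close>)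
  then show ?thesis using assms by (simp add: coll_def)
qed

lemma mem_coll_bounded:
  assumes "definable (\<lambda>e. P (e 0))" "\<And>x. P x \<Longrightarrow> x \<epsilon> a"
  shows "x \<epsilon> coll P \<longleftrightarrow> P x"
proof -
  have "\<exists>b. \<forall>x. x \<epsilon> b \<longleftrightarrow> P x"
    using separation_definable[OF assms(1), of a] assms(2) by metis
  then show ?thesis by (rule mem_coll)
qed

lemma mem_coll_sep:
  assumes "definable (\<lambda>e. P (e 0))"
  shows "x \<epsilon> coll (\<lambda>x. x \<epsilon> a \<and> P x) \<longleftrightarrow> x \<epsilon> a \<and> P x"
  by (rule mem_coll_bounded) (intro definability assms, blast)

text \<open>The junk value is described by a formula as well, so a comprehension term is definable
  whether or not its class is a set.\<close>

lemma definable_coll [definability]: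
  assumes "definable (\<lambda>e. P (e 0) (\<lambda>i. e (Suc i)))"
  shows "definable_term (\<lambda>e. coll (\<lambda>x. P x e))"
proof -
  have coll: "s = coll Q \<longleftrightarrow>
      (\<forall>x. x \<epsilon> s \<longleftrightarrow> Q x) \<or> \<not> (\<exists>t. \<forall>x. x \<epsilon> t \<longleftrightarrow> Q x) \<and> s = emp" for s Q
  proof (cases "\<exists>t. \<forall>x. x \<epsilon> t \<longleftrightarrow> Q x")
    case True
    then show ?thesis using mem_coll[OF True] by (auto intro: ext_eq)
  next
    case False
    then show ?thesis by (auto simp: coll_def)
  qed
  have 1: "definable (\<lambda>e. P (e 0) (\<lambda>i. e (Suc (Suc i))))"
    using definable_rename[OF assms, of "case_nat 0 (\<lambda>i. Suc (Suc i))"] by simp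
  have 2: "definable (\<lambda>e. P (e 0) (\<lambda>i. e (Suc (Suc (Suc i)))))"
    using definable_rename[OF assms, of "case_nat 0 (\<lambda>i. Suc (Suc (Suc i)))"] by simp
  show ?thesis
    unfolding definable_term_def coll by (intro definability 1 2)
qed

section \<open>Pairs, unions, power sets and products\<close>

definition upair :: "'a \<Rightarrow> 'a \<Rightarrow> 'a" where
  "upair x y = coll (\<lambda>z. z = x \<or> z = y)"

definition big_union :: "'a \<Rightarrow> 'a" where
  "big_union a = coll (\<lambda>z. \<exists>y. y \<epsilon> a \<and> z \<epsilon> y)"

definition pow :: "'a \<Rightarrow> 'a" where
  "pow a = coll (\<lambda>z. is_subset z a)"

definition pr :: "'a \<Rightarrow> 'a \<Rightarrow> 'a" where
  "pr x y = upair (upair x x) (upair x y)"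

definition ins :: "'a \<Rightarrow> 'a \<Rightarrow> 'a" where
  "ins x a = coll (\<lambda>z. z = x \<or> z \<epsilon> a)"

definition cart :: "'a \<Rightarrow> 'a \<Rightarrow> 'a" where
  "cart a b = coll (\<lambda>p. \<exists>x y. x \<epsilon> a \<and> y \<epsilon> b \<and> p = pr x y)"

lemma mem_upair [simp]: "z \<epsilon> upair x y \<longleftrightarrow> z = x \<or> z = y"
  unfolding upair_def using pairing[of x y] by (intro mem_coll) (simp add: is_upair_def)

lemma mem_big_union [simp]: "z \<epsilon> big_union a \<longleftrightarrow> (\<exists>y. y \<epsilon> a \<and> z \<epsilon> y)"
  unfolding big_union_def using union[of a] by (intro mem_coll) (simp add: is_union_def)

lemma mem_pow [simp]: "z \<epsilon> pow a \<longleftrightarrow> is_subset z a"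
  unfolding pow_def using powerset[of a] by (intro mem_coll) (simp add: is_powerset_def)

lemma mem_ins [simp]: "z \<epsilon> ins x a \<longleftrightarrow> z = x \<or> z \<epsilon> a"
proof -
  have "z \<epsilon> big_union (upair (upair x x) a) \<longleftrightarrow> z = x \<or> z \<epsilon> a" for z
    by auto
  then show ?thesis
    unfolding ins_def by (intro mem_coll) blast
qed

lemma upair_eq: "upair x y = upair x' y' \<longleftrightarrow> x = x' \<and> y = y' \<or> x = y' \<and> y = x'"
proof
  assume "upair x y = upair x' y'"
  then have "z = x \<or> z = y \<longleftrightarrow> z = x' \<or> z = y'" for z
    by (metis mem_upair)
  then show "x = x' \<and> y = y' \<or> x = y' \<and> y = x'" by metis
qed (auto intro: ext_eq)

lemma pr_eq [simp]: "pr x y = pr x' y' \<longleftrightarrow> x = x' \<and> y = y'"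
  unfolding pr_def by (auto simp: upair_eq)

lemma definable_upair [definability]:
  "definable_term s \<Longrightarrow> definable_term t \<Longrightarrow> definable_term (\<lambda>e. upair (s e) (t e))"
  by (rule definable_term_subst2[where F = upair], unfold upair_def, intro definability)

lemma definable_pr [definability]:
  "definable_term s \<Longrightarrow> definable_term t \<Longrightarrow> definable_term (\<lambda>e. pr (s e) (t e))"
  unfolding pr_def by (intro definability)

lemma definable_ins [definability]:
  "definable_term s \<Longrightarrow> definable_term t \<Longrightarrow> definable_term (\<lambda>e. ins (s e) (t e))"
  by (rule definable_term_subst2[where F = ins], unfold ins_def, intro definability)

lemma definable_big_union [definability]:
  "definable_term s \<Longrightarrow> definable_term (\<lambda>e. big_union (s e))"
  by (rule definable_term_subst1[where F = big_union], unfold big_union_def, intro definability)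

lemma definable_pow [definability]:
  "definable_term s \<Longrightarrow> definable_term (\<lambda>e. pow (s e))"
  by (rule definable_term_subst1[where F = pow], unfold pow_def, intro definability)

lemma definable_cart [definability]:
  "definable_term s \<Longrightarrow> definable_term t \<Longrightarrow> definable_term (\<lambda>e. cart (s e) (t e))"
  by (rule definable_term_subst2[where F = cart], unfold cart_def, intro definability)

lemma mem_cart: "p \<epsilon> cart a b \<longleftrightarrow> (\<exists>x y. x \<epsilon> a \<and> y \<epsilon> b \<and> p = pr x y)"
  unfolding cart_def
proof (rule mem_coll_bounded)
  show "definable (\<lambda>e. \<exists>x y. x \<epsilon> a \<and> y \<epsilon> b \<and> e 0 = pr x y)"
    by (intro definability)
  fix p assume "\<exists>x y. x \<epsilon> a \<and> y \<epsilon> b \<and> p = pr x y"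
  then show "p \<epsilon> pow (pow (big_union (upair a b)))"
    unfolding mem_pow is_subset_def pr_def by (fastforce simp: is_subset_def)
qed

lemma pr_mem_cart [simp]: "pr x y \<epsilon> cart a b \<longleftrightarrow> x \<epsilon> a \<and> y \<epsilon> b"
  by (auto simp: mem_cart)

lemma is_upair_iff: "is_upair p x y \<longleftrightarrow> p = upair x y"
  by (auto simp: is_upair_def intro: ext_eq)

lemma is_pair_iff: "is_pair p x y \<longleftrightarrow> p = pr x y"
  by (simp add: is_pair_def is_upair_iff pr_def)

lemma maps_to_iff: "maps_to f x y \<longleftrightarrow> pr x y \<epsilon> f"
  by (simp add: maps_to_def is_pair_iff)

lemma is_successor_iff: "is_successor s x \<longleftrightarrow> s = ins x x"
  by (auto simp: is_successor_def intro: ext_eq)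

lemma is_inductive_iff: "is_inductive w \<longleftrightarrow> emp \<epsilon> w \<and> (\<forall>x. x \<epsilon> w \<longrightarrow> ins x x \<epsilon> w)"
  by (simp add: is_inductive_def is_empty_iff is_successor_iff)

lemma is_function_iff:
  "is_function f X Y \<longleftrightarrow>
    (\<forall>p. p \<epsilon> f \<longrightarrow> (\<exists>x y. x \<epsilon> X \<and> y \<epsilon> Y \<and> p = pr x y)) \<and>
    (\<forall>x. x \<epsilon> X \<longrightarrow> (\<exists>y. pr x y \<epsilon> f)) \<and>
    (\<forall>x y y'. pr x y \<epsilon> f \<and> pr x y' \<epsilon> f \<longrightarrow> y = y')"
  unfolding is_function_def maps_to_iff is_pair_iff
proof (rule conj_cong[OF refl])
  assume *: "\<forall>p. p \<epsilon> f \<longrightarrow> (\<exists>x y. x \<epsilon> X \<and> y \<epsilon> Y \<and> p = pr x y)"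
  have X: "x \<epsilon> X" if "pr x y \<epsilon> f" for x y
    using *[rule_format, OF that] by auto
  show "(\<forall>x. x \<epsilon> X \<longrightarrow> (\<exists>!y. pr x y \<epsilon> f)) \<longleftrightarrow>
      (\<forall>x. x \<epsilon> X \<longrightarrow> (\<exists>y. pr x y \<epsilon> f)) \<and> (\<forall>x y y'. pr x y \<epsilon> f \<and> pr x y' \<epsilon> f \<longrightarrow> y = y')"
    unfolding Ex1_def using X by blast
qed

lemma functionD:
  assumes "is_function f X Y"
  shows "pr x y \<epsilon> f \<Longrightarrow> x \<epsilon> X" "pr x y \<epsilon> f \<Longrightarrow> y \<epsilon> Y" "x \<epsilon> X \<Longrightarrow> \<exists>y. pr x y \<epsilon> f"
    "pr x y \<epsilon> f \<Longrightarrow> pr x y' \<epsilon> f \<Longrightarrow> y = y'"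
    "p \<epsilon> f \<Longrightarrow> \<exists>x y. x \<epsilon> X \<and> y \<epsilon> Y \<and> p = pr x y"
  using assms unfolding is_function_iff by (fastforce, fastforce, blast, blast, blast)

lemma definable_is_function [definability]:
  "definable_term s \<Longrightarrow> definable_term t \<Longrightarrow> definable_term u \<Longrightarrow>
    definable (\<lambda>e. is_function (s e) (t e) (u e))"
  by (rule definable_subst3[where R = is_function], unfold is_function_iff, intro definability)

section \<open>The natural numbers of the structure\<close>

definition om :: 'a where
  "om = coll in_omega"

lemma definable_in_omega [definability]:
  "definable_term s \<Longrightarrow> definable (\<lambda>e. in_omega (s e))"
  by (rule definable_subst1[where R = in_omega], unfold in_omega_def is_inductive_iff,
      intro definability)

lemma mem_om: "n \<epsilon> om \<longleftrightarrow> in_omega n"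
proof -
  obtain w where "is_inductive w" using infinity by blast
  then show ?thesis
    unfolding om_def by (intro mem_coll_bounded[of _ w] definability) (simp add: in_omega_def)
qed

lemma emp_om [simp]: "emp \<epsilon> om"
  by (simp add: mem_om in_omega_def is_inductive_iff)

lemma suc_om [simp]: "n \<epsilon> om \<Longrightarrow> ins n n \<epsilon> om"
  by (simp add: mem_om in_omega_def is_inductive_iff)

text \<open>Minimality of \<open>om\<close> speaks about sets, so the property must be definable; if
  \<open>om\<close> is nonstandard, induction fails for some HOL predicates.\<close>

lemma om_induct [consumes 1, case_names definable emp suc]:
  assumes n: "n \<epsilon> om" and Q: "definable (\<lambda>e. Q (e 0))"
    and emp: "Q emp" and suc: "\<And>n. n \<epsilon> om \<Longrightarrow> Q n \<Longrightarrow> Q (ins n n)"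
  shows "Q n"
proof -
  let ?w = "coll (\<lambda>n. n \<epsilon> om \<and> Q n)"
  have w: "x \<epsilon> ?w \<longleftrightarrow> x \<epsilon> om \<and> Q x" for x
    by (rule mem_coll_sep[OF Q])
  have "is_inductive ?w"
    unfolding is_inductive_iff w using emp suc by simp
  then have "n \<epsilon> ?w"
    using n by (simp add: mem_om in_omega_def)
  then show ?thesis by (simp add: w)
qed

lemma mem_irrefl [simp]: "\<not> x \<epsilon> x"
  using foundation[of "upair x x"] by (auto simp: is_empty_def)

lemma om_trans:
  assumes "n \<epsilon> om" "x \<epsilon> n" "y \<epsilon> x"
  shows "y \<epsilon> n"
proof -
  have "\<forall>x y. x \<epsilon> n \<longrightarrow> y \<epsilon> x \<longrightarrow> y \<epsilon> n"
    using assms(1)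
  proof (induction rule: om_induct)
    case definable
    show ?case by (intro definability)
  qed auto
  then show ?thesis using assms by blast
qed

lemma om_mem:
  assumes "n \<epsilon> om" "x \<epsilon> n"
  shows "x \<epsilon> om"
proof -
  have "\<forall>x. x \<epsilon> n \<longrightarrow> x \<epsilon> om"
    using assms(1)
  proof (induction rule: om_induct)
    case definable
    show ?case by (intro definability)
  qed auto
  then show ?thesis using assms by blast
qed

lemma om_cases:
  assumes "n \<epsilon> om"
  obtains "n = emp" | k where "k \<epsilon> om" "n = ins k k"
proof -
  have "n = emp \<or> (\<exists>k. k \<epsilon> om \<and> n = ins k k)"
    using assms
  proof (induction rule: om_induct)
    case definable
    show ?case by (intro definability)
  qed auto
  then show ?thesis using that by blast
qed

lemma suc_mem_suc:
  assumes "n \<epsilon> om" "m \<epsilon> n"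
  shows "ins m m = n \<or> ins m m \<epsilon> n"
proof -
  have "\<forall>m. m \<epsilon> n \<longrightarrow> ins m m = n \<or> ins m m \<epsilon> n"
    using assms(1)
  proof (induction rule: om_induct)
    case definable
    show ?case by (intro definability)
  qed auto
  then show ?thesis using assms by blast
qed

lemma om_linear:
  assumes "m \<epsilon> om" "n \<epsilon> om"
  shows "m \<epsilon> n \<or> m = n \<or> n \<epsilon> m"
proof -
  have emp: "n = emp \<or> emp \<epsilon> n" if "n \<epsilon> om" for n
    using that
  proof (induction rule: om_induct)
    case definable
    show ?case by (intro definability)
  qed auto
  have "\<forall>n. n \<epsilon> om \<longrightarrow> m \<epsilon> n \<or> m = n \<or> n \<epsilon> m"
    using assms(1)
  proof (induction rule: om_induct)
    case definable
    show ?case by (intro definability)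
  next
    case emp
    then show ?case using \<open>\<And>n. n \<epsilon> om \<Longrightarrow> n = emp \<or> emp \<epsilon> n\<close> by auto
  next
    case (suc m)
    then show ?case using suc_mem_suc by (metis mem_ins)
  qed
  then show ?thesis using assms by blast
qed

text \<open>An \<open>\<epsilon>\<close>-minimal witness is already the least one, so foundation
  takes the place of an induction.\<close>

lemma om_least:
  assumes Q: "definable (\<lambda>e. Q (e 0))" and "n \<epsilon> om" "Q n"
  obtains m where "m \<epsilon> om" "Q m" "\<And>k. k \<epsilon> m \<Longrightarrow> \<not> Q k"
proof -
  let ?s = "coll (\<lambda>n. n \<epsilon> om \<and> Q n)"
  have s: "x \<epsilon> ?s \<longleftrightarrow> x \<epsilon> om \<and> Q x" for x
    by (rule mem_coll_sep[OF Q])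
  have "\<not> is_empty ?s" using assms s by (auto simp: is_empty_def)
  then obtain m where "m \<epsilon> ?s" "\<not> (\<exists>z. z \<epsilon> ?s \<and> z \<epsilon> m)"
    using foundation by blast
  then show ?thesis using that s om_mem by blast
qed

section \<open>Finite sets\<close>

lemma is_bijection_iff:
  "is_bijection f X Y \<longleftrightarrow> is_function f X Y \<and> (\<forall>y. y \<epsilon> Y \<longrightarrow> (\<exists>x. pr x y \<epsilon> f)) \<and>
    (\<forall>x x' y. pr x y \<epsilon> f \<and> pr x' y \<epsilon> f \<longrightarrow> x = x')"
  unfolding is_bijection_def maps_to_iff
proof (rule conj_cong[OF refl])
  assume f: "is_function f X Y"
  show "(\<forall>y. y \<epsilon> Y \<longrightarrow> (\<exists>!x. pr x y \<epsilon> f)) \<longleftrightarrow>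
      (\<forall>y. y \<epsilon> Y \<longrightarrow> (\<exists>x. pr x y \<epsilon> f)) \<and> (\<forall>x x' y. pr x y \<epsilon> f \<and> pr x' y \<epsilon> f \<longrightarrow> x = x')"
    unfolding Ex1_def using functionD(2)[OF f] by blast
qed

lemma definable_is_bijection [definability]:
  "definable_term s \<Longrightarrow> definable_term t \<Longrightarrow> definable_term u \<Longrightarrow>
    definable (\<lambda>e. is_bijection (s e) (t e) (u e))"
  by (rule definable_subst3[where R = is_bijection], unfold is_bijection_iff, intro definability)

lemma definable_is_finite [definability]:
  "definable_term s \<Longrightarrow> definable (\<lambda>e. is_finite (s e))"
  by (rule definable_subst1[where R = is_finite], unfold is_finite_def, intro definability)

lemma finite_emp [simp]: "is_finite emp"
  unfolding is_finite_def
  by (intro exI[of _ emp] conjI)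
    (auto simp: mem_om[symmetric] is_bijection_iff is_function_iff)

lemma finite_ins:
  assumes "is_finite X"
  shows "is_finite (ins a X)"
proof (cases "a \<epsilon> X")
  case True
  then have "ins a X = X" by (intro ext_eq) auto
  then show ?thesis using assms by simp
next
  case False
  obtain n f where n: "n \<epsilon> om" and f: "is_bijection f n X"
    using assms by (auto simp: is_finite_def mem_om)
  have fn: "is_function f n X" and sur: "\<And>y. y \<epsilon> X \<Longrightarrow> \<exists>x. pr x y \<epsilon> f"
    and inj: "\<And>x x' y. pr x y \<epsilon> f \<Longrightarrow> pr x' y \<epsilon> f \<Longrightarrow> x = x'"
    using f unfolding is_bijection_iff by blast+
  note fs = functionD[OF fn]
  have new: "\<not> pr n y \<epsilon> f" "\<not> pr x a \<epsilon> f" for x y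
    using False by (auto dest: fs(1,2))
  have "is_bijection (ins (pr n a) f) (ins n n) (ins a X)"
    unfolding is_bijection_iff is_function_iff mem_ins pr_eq
  proof (intro conjI allI impI)
    fix p assume "p = pr n a \<or> p \<epsilon> f"
    then show "\<exists>x y. (x = n \<or> x \<epsilon> n) \<and> (y = a \<or> y \<epsilon> X) \<and> p = pr x y"
      using fs(5) by blast
  next
    fix x assume "x = n \<or> x \<epsilon> n"
    then show "\<exists>y. x = n \<and> y = a \<or> pr x y \<epsilon> f"
      using fs(3) by blast
  next
    fix y assume "y = a \<or> y \<epsilon> X"
    then show "\<exists>x. x = n \<and> y = a \<or> pr x y \<epsilon> f"
      using sur by blast
  qed (use new fs(4) inj in auto)
  then show ?thesis
    unfolding is_finite_def using suc_om[OF n] by (auto simp: mem_om)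
qed

text \<open>Induction on the number of elements, for all sets of that size at once: deleting the
  image of the last index \<open>n\<close> from a bijection with \<open>ins n n\<close> leaves a
  bijection with \<open>n\<close>.\<close>

lemma finite_induct [consumes 1, case_names definable emp ins]:
  assumes "is_finite X" and Q: "definable (\<lambda>e. Q (e 0))"
    and emp: "Q emp" and ins: "\<And>a X. is_finite X \<Longrightarrow> \<not> a \<epsilon> X \<Longrightarrow> Q X \<Longrightarrow> Q (ins a X)"
  shows "Q X"
proof -
  obtain n f where n: "n \<epsilon> om" and f: "is_bijection f n X"
    using assms(1) by (auto simp: is_finite_def mem_om)
  have "\<forall>X. (\<exists>f. is_bijection f n X) \<longrightarrow> Q X"
    using n
  proof (induction rule: om_induct)
    case definable
    show ?case by (intro definability definable_subst1[OF Q])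
  next
    case emp
    show ?case
    proof (intro allI impI)
      fix X assume "\<exists>f. is_bijection f emp X"
      then have "\<not> y \<epsilon> X" for y
        unfolding is_bijection_iff using functionD(1) not_mem_emp by blast
      then have "X = emp" by (intro ext_eq) auto
      then show "Q X" using \<open>Q emp\<close> by simp
    qed
  next
    case (suc n)
    show ?case
    proof (intro allI impI)
      fix X assume "\<exists>f. is_bijection f (ins n n) X"
      then obtain f where f: "is_bijection f (ins n n) X" by blast
      then have fn: "is_function f (ins n n) X"
        and sur: "\<And>y. y \<epsilon> X \<Longrightarrow> \<exists>x. pr x y \<epsilon> f"
        and inj: "\<And>x x' y. pr x y \<epsilon> f \<Longrightarrow> pr x' y \<epsilon> f \<Longrightarrow> x = x'"
        unfolding is_bijection_iff by blast+
      note fs = functionD[OF fn]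
      obtain a where a: "pr n a \<epsilon> f"
        using fs(3)[of n] by auto
      obtain X' where X: "\<And>x. x \<epsilon> X' \<longleftrightarrow> x \<epsilon> X \<and> x \<noteq> a"
        by (atomize_elim, rule separation_definable) (intro definability)
      obtain f' where f': "\<And>x. x \<epsilon> f' \<longleftrightarrow> x \<epsilon> f \<and> x \<noteq> pr n a"
        by (atomize_elim, rule separation_definable) (intro definability)
      have "is_bijection f' n X'"
        unfolding is_bijection_iff is_function_iff f' X pr_eq
      proof (intro conjI allI impI)
        show "\<exists>x y. x \<epsilon> n \<and> (y \<epsilon> X \<and> y \<noteq> a) \<and> p = pr x y"
          if p: "p \<epsilon> f \<and> p \<noteq> pr n a" for p
        proof -
          obtain x y where "p = pr x y" "x = n \<or> x \<epsilon> n" "y \<epsilon> X"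
            using p fs(5)[of p] unfolding mem_ins by blast
          moreover have "x \<noteq> n" "y \<noteq> a"
            using p a fs(4) inj \<open>p = pr x y\<close> by blast+
          ultimately show ?thesis by blast
        qed
        show "\<exists>y. pr x y \<epsilon> f \<and> \<not> (x = n \<and> y = a)" if "x \<epsilon> n" for x
          using that fs(3)[of x] by auto
        show "\<exists>x. pr x y \<epsilon> f \<and> \<not> (x = n \<and> y = a)" if "y \<epsilon> X \<and> y \<noteq> a" for y
          using that sur[of y] by auto
      qed (use fs(4) inj in blast)+
      then have "is_finite X'" "Q X'"
        using suc by (auto simp: is_finite_def mem_om)
      moreover have "ins a X' = X"
        by (rule ext_eq) (use fs(2)[OF a] X in auto)
      ultimately show "Q X" using ins[of X' a] X by auto
    qed
  qed
  then show ?thesis using f by blast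
qed

lemma finite_nat:
  assumes "n \<epsilon> om"
  shows "is_finite n"
  using assms
proof (induction rule: om_induct)
  case definable
  show ?case by (intro definability)
qed (auto intro: finite_ins)

lemma finite_union:
  assumes "is_finite X" "is_finite Y"
  shows "is_finite (big_union (upair X Y))"
  using assms(1)
proof (induction rule: finite_induct)
  case definable
  show ?case by (intro definability)
next
  case emp
  have "big_union (upair emp Y) = Y" by (rule ext_eq) auto
  then show ?case using assms by simp
next
  case (ins a X)
  have "big_union (upair (ins a X) Y) = ins a (big_union (upair X Y))" by (rule ext_eq) auto
  then show ?case using finite_ins[OF ins.IH] by simp
qed

text \<open>A finite union of finite sets is finite. The fibres are only required to lie inside
  finite sets, so that subsets, images and products become instances; closure under subsets, which
  the last step needs, is therefore proved inside.\<close>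

lemma finite_fibres:
  assumes T: "is_finite T" and R: "definable (\<lambda>e. R (e 0) (e (Suc 0)))"
    and fin: "\<And>t. t \<epsilon> T \<Longrightarrow> \<exists>F. is_finite F \<and> (\<forall>y. y \<epsilon> Y \<and> R t y \<longrightarrow> y \<epsilon> F)"
    and Y: "\<And>y. y \<epsilon> Y \<Longrightarrow> \<exists>t. t \<epsilon> T \<and> R t y"
  shows "is_finite Y"
proof -
  note [definability] = definable_subst2[OF R]
  have sub: "is_finite Z" if "is_finite F" "is_subset Z F" for F Z
  proof -
    have "\<forall>Z. is_subset Z F \<longrightarrow> is_finite Z"
      using that(1)
    proof (induction rule: finite_induct)
      case definable
      show ?case by (intro definability)
    next
      case emp
      have "Z = emp" if "is_subset Z emp" for Z
        using that by (intro ext_eq) (auto simp: is_subset_def)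
      then show ?case using finite_emp by metis
    next
      case (ins a F)
      show ?case
      proof (intro allI impI)
        fix Z assume Z: "is_subset Z (ins a F)"
        obtain Z' where mem: "\<And>x. x \<epsilon> Z' \<longleftrightarrow> x \<epsilon> Z \<and> x \<noteq> a"
          by (atomize_elim, rule separation_definable) (intro definability)
        have "is_subset Z' F" using Z by (auto simp: is_subset_def mem)
        then have fin: "is_finite Z'" using ins by blast
        show "is_finite Z"
        proof (cases "a \<epsilon> Z")
          case True
          then have "Z = ins a Z'" by (intro ext_eq) (auto simp: mem)
          then show ?thesis using finite_ins[OF fin, of a] by simp
        next
          case False
          then have "Z = Z'" by (intro ext_eq) (auto simp: mem)
          then show ?thesis using fin by simp
        qed
      qed
    qed
    then show ?thesis using that by blast
  qed
  have "(\<forall>t. t \<epsilon> T \<longrightarrow> (\<exists>F. is_finite F \<and> (\<forall>y. y \<epsilon> Y \<and> R t y \<longrightarrow> y \<epsilon> F))) \<longrightarrow>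
      (\<exists>F. is_finite F \<and> (\<forall>t y. t \<epsilon> T \<longrightarrow> y \<epsilon> Y \<and> R t y \<longrightarrow> y \<epsilon> F))"
    using T
  proof (induction rule: finite_induct)
    case definable
    show ?case by (intro definability)
  next
    case emp
    show ?case by (auto intro: exI[of _ emp])
  next
    case (ins a T)
    show ?case
    proof
      assume *: "\<forall>t. t \<epsilon> ins a T \<longrightarrow>
        (\<exists>F. is_finite F \<and> (\<forall>y. y \<epsilon> Y \<and> R t y \<longrightarrow> y \<epsilon> F))"
      then obtain F where F: "is_finite F" "\<forall>t y. t \<epsilon> T \<longrightarrow> y \<epsilon> Y \<and> R t y \<longrightarrow> y \<epsilon> F"
        using ins.IH by auto
      obtain F' where F': "is_finite F'" "\<forall>y. y \<epsilon> Y \<and> R a y \<longrightarrow> y \<epsilon> F'"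
        using * by auto
      show "\<exists>F. is_finite F \<and> (\<forall>t y. t \<epsilon> ins a T \<longrightarrow> y \<epsilon> Y \<and> R t y \<longrightarrow> y \<epsilon> F)"
        using finite_union[OF F(1) F'(1)] F(2) F'(2)
        by (intro exI[of _ "big_union (upair F F')"]) auto
    qed
  qed
  then obtain F where "is_finite F" "\<forall>t y. t \<epsilon> T \<longrightarrow> y \<epsilon> Y \<and> R t y \<longrightarrow> y \<epsilon> F"
    using fin by blast
  then show ?thesis using sub[of F Y] Y unfolding is_subset_def by blast
qed

lemma finite_subset: "is_finite T \<Longrightarrow> is_subset Y T \<Longrightarrow> is_finite Y"
proof (erule finite_fibres[where R = "(=)"])
  show "definable (\<lambda>e. e 0 = e (Suc 0))" by (intro definability)
  show "\<exists>F. is_finite F \<and> (\<forall>y. y \<epsilon> Y \<and> t = y \<longrightarrow> y \<epsilon> F)" for t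
    using finite_ins[OF finite_emp, of t] by (intro exI[of _ "ins t emp"]) auto
qed (auto simp: is_subset_def)

lemma finite_image:
  assumes "is_finite T" and R: "definable (\<lambda>e. R (e 0) (e (Suc 0)))"
    and fin: "\<And>t y y'. t \<epsilon> T \<Longrightarrow> y \<epsilon> Y \<Longrightarrow> y' \<epsilon> Y \<Longrightarrow> R t y \<Longrightarrow> R t y' \<Longrightarrow> y = y'"
    and Y: "\<And>y. y \<epsilon> Y \<Longrightarrow> \<exists>t. t \<epsilon> T \<and> R t y"
  shows "is_finite Y"
proof (rule finite_fibres[OF assms(1) R _ Y])
  fix t assume t: "t \<epsilon> T"
  show "\<exists>F. is_finite F \<and> (\<forall>y. y \<epsilon> Y \<and> R t y \<longrightarrow> y \<epsilon> F)"
  proof (cases "\<exists>y. y \<epsilon> Y \<and> R t y")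
    case True
    then obtain y where "y \<epsilon> Y" "R t y" by blast
    then show ?thesis
      using finite_ins[OF finite_emp, of y] fin[OF t] by (intro exI[of _ "ins y emp"]) auto
  next
    case False
    then show ?thesis using finite_emp by blast
  qed
qed

section \<open>Weakly Dedekind finite sets\<close>

lemma finite_sing [simp]: "is_finite (ins x emp)"
  by (simp add: finite_ins)

definition funs :: "'a \<Rightarrow> 'a \<Rightarrow> 'a" where
  "funs m C = coll (\<lambda>u. is_function u m C)"

lemma mem_funs [simp]: "u \<epsilon> funs m C \<longleftrightarrow> is_function u m C"
  unfolding funs_def
proof (rule mem_coll_bounded)
  show "definable (\<lambda>e. is_function (e 0) m C)" by (intro definability)
  show "u \<epsilon> pow (cart m C)" if "is_function u m C" for u
    using functionD(5)[OF that] by (auto simp: is_subset_def mem_cart)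
qed

lemma definable_funs [definability]:
  "definable_term s \<Longrightarrow> definable_term t \<Longrightarrow> definable_term (\<lambda>e. funs (s e) (t e))"
  by (rule definable_term_subst2[where F = funs], unfold funs_def, intro definability)

lemma function_ext:
  assumes "is_function u m C" "is_function v m D" "\<And>i x. pr i x \<epsilon> u \<Longrightarrow> pr i x \<epsilon> v"
  shows "u = v"
proof (rule ext_eq)
  fix p
  show "p \<epsilon> u \<longleftrightarrow> p \<epsilon> v"
  proof
    assume "p \<epsilon> u"
    then show "p \<epsilon> v" using functionD(5)[OF assms(1)] assms(3) by blast
  next
    assume p: "p \<epsilon> v"
    then obtain i x where "i \<epsilon> m" "p = pr i x" using functionD(5)[OF assms(2)] by blast
    moreover obtain y where "pr i y \<epsilon> u" using functionD(3)[OF assms(1) \<open>i \<epsilon> m\<close>] by blast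
    ultimately show "p \<epsilon> u" using functionD(4)[OF assms(2)] assms(3) p by blast
  qed
qed

lemma function_suc:
  assumes "is_function u m A" "a \<epsilon> A"
  shows "is_function (ins (pr m a) u) (ins m m) A"
proof -
  note u = functionD[OF assms(1)]
  have "\<not> pr m y \<epsilon> u" for y using u(1)[of m] by auto
  then show ?thesis
    unfolding is_function_iff mem_ins pr_eq
  proof (intro conjI allI impI)
    fix p assume "p = pr m a \<or> p \<epsilon> u"
    then show "\<exists>x y. (x = m \<or> x \<epsilon> m) \<and> y \<epsilon> A \<and> p = pr x y"
      using u(5) assms(2) by blast
  next
    fix x assume "x = m \<or> x \<epsilon> m"
    then show "\<exists>y. x = m \<and> y = a \<or> pr x y \<epsilon> u"
      using u(3) by blast
  qed (use u(4) in auto)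
qed

text \<open>Together with \<open>function_suc\<close> and \<open>function_suc_inj\<close> this
  identifies \<open>A^(m+1)\<close> with \<open>A^m \<times> A\<close>.\<close>

lemma function_suc_cases:
  assumes w: "is_function w (ins m m) A"
  obtains u a where "is_function u m A" "a \<epsilon> A" "w = ins (pr m a) u"
proof -
  note fw = functionD[OF w]
  obtain a where a: "pr m a \<epsilon> w" using fw(3)[of m] by auto
  obtain u' where mem: "\<And>p. p \<epsilon> u' \<longleftrightarrow> p \<epsilon> w \<and> p \<noteq> pr m a"
    by (atomize_elim, rule separation_definable) (intro definability)
  have "is_function u' m A"
    unfolding is_function_iff mem pr_eq
  proof (intro conjI allI impI)
    fix p assume p: "p \<epsilon> w \<and> p \<noteq> pr m a"
    then obtain x y where xy: "x = m \<or> x \<epsilon> m" "y \<epsilon> A" "p = pr x y"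
      using fw(5)[of p] unfolding mem_ins by blast
    then have "x \<noteq> m" using p a fw(4) by blast
    then show "\<exists>x y. x \<epsilon> m \<and> y \<epsilon> A \<and> p = pr x y" using xy by blast
  next
    fix x assume "x \<epsilon> m"
    then show "\<exists>y. pr x y \<epsilon> w \<and> \<not> (x = m \<and> y = a)"
      using fw(3)[of x] by auto
  qed (use fw(4) in blast)
  moreover have "w = ins (pr m a) u'"
    by (rule ext_eq) (auto simp: mem a)
  ultimately show ?thesis using that fw(2)[OF a] by blast
qed

lemma function_suc_inj:
  assumes "is_function u m A" "is_function u' m A" "ins (pr m a) u = ins (pr m a') u'"
  shows "u = u'" "a = a'"
proof -
  have mem: "p = pr m a \<or> p \<epsilon> u \<longleftrightarrow> p = pr m a' \<or> p \<epsilon> u'" for p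
    using assms(3) by (metis mem_ins)
  have u: "\<not> pr m y \<epsilon> u" "\<not> pr m y \<epsilon> u'" for y
    using functionD(1)[OF assms(1), of m] functionD(1)[OF assms(2), of m] by auto
  show "a = a'" using mem[of "pr m a"] u by auto
  then have "p \<epsilon> u \<longleftrightarrow> p \<epsilon> u'" for p
    using mem[of p] u by (cases "p = pr m a") auto
  then show "u = u'" by (rule ext_eq)
qed

text \<open>
  \<open>wdf Y\<close> says that there is no map from \<open>Y\<close> to \<open>\<omega>\<close> with unbounded range; such a map is
  represented by the increasing sequence of its sublevel sets.
\<close>

definition wdf :: "'a \<Rightarrow> bool" where
  "wdf Y \<longleftrightarrow> (\<forall>R. (\<forall>x. x \<epsilon> Y \<longrightarrow> (\<exists>m. m \<epsilon> om \<and> pr m x \<epsilon> R)) \<and>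
      (\<forall>m m' x. m \<epsilon> m' \<and> m' \<epsilon> om \<and> x \<epsilon> Y \<and> pr m x \<epsilon> R \<longrightarrow> pr m' x \<epsilon> R) \<longrightarrow>
      (\<exists>m. m \<epsilon> om \<and> (\<forall>x. x \<epsilon> Y \<longrightarrow> pr m x \<epsilon> R)))"

lemma definable_wdf [definability]:
  "definable_term s \<Longrightarrow> definable (\<lambda>e. wdf (s e))"
  by (rule definable_subst1[where R = wdf], unfold wdf_def, intro definability)

text \<open>A sequence of sublevel sets given by a formula becomes a set once it is cut down to
  \<open>om\<close> and \<open>Y\<close>.\<close>

lemma wdfD:
  assumes Y: "wdf Y" and R: "definable (\<lambda>e. R (e 0) (e (Suc 0)))"
    and cover: "\<And>x. x \<epsilon> Y \<Longrightarrow> \<exists>m. m \<epsilon> om \<and> R m x"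
    and mono: "\<And>m m' x. m \<epsilon> m' \<Longrightarrow> m' \<epsilon> om \<Longrightarrow> x \<epsilon> Y \<Longrightarrow> R m x \<Longrightarrow> R m' x"
  shows "\<exists>m. m \<epsilon> om \<and> (\<forall>x. x \<epsilon> Y \<longrightarrow> R m x)"
proof -
  note [definability] = definable_subst2[OF R]
  let ?R = "coll (\<lambda>p. p \<epsilon> cart om Y \<and> (\<exists>m x. p = pr m x \<and> R m x))"
  have "p \<epsilon> ?R \<longleftrightarrow> p \<epsilon> cart om Y \<and> (\<exists>m x. p = pr m x \<and> R m x)" for p
    by (rule mem_coll_sep) (intro definability)
  then have mem: "pr m x \<epsilon> ?R \<longleftrightarrow> m \<epsilon> om \<and> x \<epsilon> Y \<and> R m x" for m x by auto
  have "\<exists>m. m \<epsilon> om \<and> (\<forall>x. x \<epsilon> Y \<longrightarrow> pr m x \<epsilon> ?R)"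
    by (rule Y[unfolded wdf_def, rule_format]) (use cover mono om_mem in \<open>auto simp: mem\<close>)
  then show ?thesis unfolding mem by blast
qed

text \<open>An element \<open>t\<close> enters stage \<open>m\<close> when its whole fibre has
  entered. It does enter at some stage because its fibre is weakly Dedekind finite, and then weak
  Dedekind finiteness of \<open>T\<close> provides a common stage.\<close>

lemma wdf_fibres:
  assumes T: "wdf T" and R: "definable (\<lambda>e. R (e 0) (e (Suc 0)))"
    and fibre: "\<And>t. t \<epsilon> T \<Longrightarrow> \<exists>F. wdf F \<and> (\<forall>y. y \<epsilon> Y \<and> R t y \<longrightarrow> y \<epsilon> F)"
    and Y: "\<And>y. y \<epsilon> Y \<Longrightarrow> \<exists>t. t \<epsilon> T \<and> R t y"
  shows "wdf Y"
  unfolding wdf_def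
proof (intro allI impI, elim conjE)
  fix S
  assume cover: "\<forall>x. x \<epsilon> Y \<longrightarrow> (\<exists>m. m \<epsilon> om \<and> pr m x \<epsilon> S)"
    and mono: "\<forall>m m' x. m \<epsilon> m' \<and> m' \<epsilon> om \<and> x \<epsilon> Y \<and> pr m x \<epsilon> S \<longrightarrow> pr m' x \<epsilon> S"
  note [definability] = definable_subst2[OF R]
  have "\<exists>m. m \<epsilon> om \<and> (\<forall>t. t \<epsilon> T \<longrightarrow> (\<forall>y. y \<epsilon> Y \<and> R t y \<longrightarrow> pr m y \<epsilon> S))"
  proof (rule wdfD[OF T, where R = "\<lambda>m t. \<forall>y. y \<epsilon> Y \<and> R t y \<longrightarrow> pr m y \<epsilon> S"])
    show "definable (\<lambda>e. \<forall>y. y \<epsilon> Y \<and> R (e (Suc 0)) y \<longrightarrow> pr (e 0) y \<epsilon> S)"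
      by (intro definability)
    show "\<forall>y. y \<epsilon> Y \<and> R t y \<longrightarrow> pr m' y \<epsilon> S"
      if "m \<epsilon> m'" "m' \<epsilon> om" "\<forall>y. y \<epsilon> Y \<and> R t y \<longrightarrow> pr m y \<epsilon> S" for m m' t
      using that mono by blast
    show "\<exists>m. m \<epsilon> om \<and> (\<forall>y. y \<epsilon> Y \<and> R t y \<longrightarrow> pr m y \<epsilon> S)" if "t \<epsilon> T" for t
    proof -
      obtain F where F: "wdf F" "\<forall>y. y \<epsilon> Y \<and> R t y \<longrightarrow> y \<epsilon> F" using fibre[OF \<open>t \<epsilon> T\<close>] by blast
      have "\<exists>m. m \<epsilon> om \<and> (\<forall>y. y \<epsilon> F \<longrightarrow> y \<epsilon> Y \<longrightarrow> pr m y \<epsilon> S)"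
      proof (rule wdfD[OF F(1), where R = "\<lambda>m y. y \<epsilon> Y \<longrightarrow> pr m y \<epsilon> S"])
        show "definable (\<lambda>e. e (Suc 0) \<epsilon> Y \<longrightarrow> pr (e 0) (e (Suc 0)) \<epsilon> S)"
          by (intro definability)
        show "\<exists>m. m \<epsilon> om \<and> (y \<epsilon> Y \<longrightarrow> pr m y \<epsilon> S)" for y
          using cover emp_om by blast
      qed (use mono in blast)+
      then show ?thesis using F(2) by blast
    qed
  qed
  then show "\<exists>m. m \<epsilon> om \<and> (\<forall>x. x \<epsilon> Y \<longrightarrow> pr m x \<epsilon> S)"
    using Y by blast
qed

lemma finite_wdf:
  assumes "is_finite Y" shows "wdf Y"
  using assms
proof (induction rule: finite_induct)
  case definable
  show ?case by (intro definability)
next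
  case emp
  show ?case unfolding wdf_def using emp_om not_mem_emp by blast
next
  case (ins a Y)
  show ?case
    unfolding wdf_def
  proof (intro allI impI, elim conjE)
    fix R
    assume cover: "\<forall>x. x \<epsilon> ins a Y \<longrightarrow> (\<exists>m. m \<epsilon> om \<and> pr m x \<epsilon> R)"
      and mono: "\<forall>m m' x. m \<epsilon> m' \<and> m' \<epsilon> om \<and> x \<epsilon> ins a Y \<and> pr m x \<epsilon> R \<longrightarrow> pr m' x \<epsilon> R"
    obtain m where m: "m \<epsilon> om" "\<forall>x. x \<epsilon> Y \<longrightarrow> pr m x \<epsilon> R"
      using ins.IH[unfolded wdf_def, rule_format, of R] cover mono unfolding mem_ins by blast
    obtain m' where m': "m' \<epsilon> om" "pr m' a \<epsilon> R" using cover by auto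
    from om_linear[OF m(1) m'(1)]
    show "\<exists>m. m \<epsilon> om \<and> (\<forall>x. x \<epsilon> ins a Y \<longrightarrow> pr m x \<epsilon> R)"
    proof (elim disjE)
      assume "m \<epsilon> m'"
      then have "pr m' x \<epsilon> R" if "x \<epsilon> ins a Y" for x
        using that m m' mono unfolding mem_ins by blast
      then show ?thesis using m' by blast
    next
      assume "m' \<epsilon> m"
      then have "pr m x \<epsilon> R" if "x \<epsilon> ins a Y" for x
        using that m m' mono unfolding mem_ins by blast
      then show ?thesis using m by blast
    qed (use m m' in auto)
  qed
qed

lemma wdf_image:
  assumes "wdf T" and R: "definable (\<lambda>e. R (e 0) (e (Suc 0)))"
    and fin: "\<And>t y y'. t \<epsilon> T \<Longrightarrow> y \<epsilon> Y \<Longrightarrow> y' \<epsilon> Y \<Longrightarrow> R t y \<Longrightarrow> R t y' \<Longrightarrow> y = y'"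
    and Y: "\<And>y. y \<epsilon> Y \<Longrightarrow> \<exists>t. t \<epsilon> T \<and> R t y"
  shows "wdf Y"
proof (rule wdf_fibres[OF assms(1) R _ Y])
  fix t assume t: "t \<epsilon> T"
  show "\<exists>F. wdf F \<and> (\<forall>y. y \<epsilon> Y \<and> R t y \<longrightarrow> y \<epsilon> F)"
  proof (cases "\<exists>y. y \<epsilon> Y \<and> R t y")
    case True
    then obtain y where "y \<epsilon> Y" "R t y" by blast
    then show ?thesis
      using finite_wdf[OF finite_sing, of y] fin[OF t] by (intro exI[of _ "ins y emp"]) auto
  next
    case False
    then show ?thesis using finite_wdf[OF finite_emp] by blast
  qed
qed

lemma wdf_subset:
  assumes "wdf T" "is_subset Y T" shows "wdf Y"
  by (rule wdf_image[OF assms(1), where R = "(=)"])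
    (use assms(2) in \<open>auto simp: is_subset_def intro: definability\<close>)

lemma not_wdf_om: "\<not> wdf om"
proof
  assume "wdf om"
  then have "\<exists>m. m \<epsilon> om \<and> (\<forall>x. x \<epsilon> om \<longrightarrow> x \<epsilon> m)"
  proof (rule wdfD[where R = "\<lambda>m x. x \<epsilon> m"])
    show "definable (\<lambda>e. e (Suc 0) \<epsilon> e 0)" by (intro definability)
    show "\<exists>m. m \<epsilon> om \<and> x \<epsilon> m" if "x \<epsilon> om" for x
      using that by (intro exI[of _ "ins x x"]) auto
  qed (use om_trans in blast)
  then show False using mem_irrefl by blast
qed

text \<open>Removing \<open>a\<close> maps the power set of \<open>ins a F\<close> to that of
  \<open>F\<close>, with fibres of at most two elements.\<close>

lemma wdf_pow_finite:
  assumes "is_finite F" shows "wdf (pow F)"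
  using assms
proof (induction rule: finite_induct)
  case definable
  show ?case by (intro definability)
next
  case emp
  have "pow emp = ins emp emp"
    by (rule ext_eq) (auto simp: is_subset_def intro: ext_eq)
  then show ?case using finite_wdf[OF finite_sing, of emp] by simp
next
  case (ins a F)
  show ?case
  proof (rule wdf_fibres[OF ins.IH, where R = "\<lambda>s t. t = s \<or> t = ins a s"])
    show "definable (\<lambda>e. e (Suc 0) = e 0 \<or> e (Suc 0) = ins a (e 0))"
      by (intro definability)
    show "\<exists>G. wdf G \<and> (\<forall>y. y \<epsilon> pow (ins a F) \<and> (y = t \<or> y = ins a t) \<longrightarrow> y \<epsilon> G)" for t
      using finite_wdf[OF finite_ins[OF finite_sing], of t "ins a t"]
      by (intro exI[of _ "ins t (ins (ins a t) emp)"]) auto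
    show "\<exists>s. s \<epsilon> pow F \<and> (t = s \<or> t = ins a s)" if "t \<epsilon> pow (ins a F)" for t
    proof -
      obtain s' where mem: "\<And>x. x \<epsilon> s' \<longleftrightarrow> x \<epsilon> t \<and> x \<noteq> a"
        by (atomize_elim, rule separation_definable) (intro definability)
      have "t = s' \<or> t = ins a s'"
        by (cases "a \<epsilon> t") (auto intro!: ext_eq simp: mem)
      moreover have "s' \<epsilon> pow F"
        using that by (auto simp: is_subset_def mem)
      ultimately show ?thesis by blast
    qed
  qed
qed

text \<open>Induction on the length: deleting the last entry leads into the shorter product, and
  each fibre is a copy of part of one factor. The condition \<open>V\<close> lets the factors vary
  with the index, so the lemma covers powers of a set as well as the tuples running through
  prescribed blocks.\<close>

lemma wdf_prod:
  assumes m: "m \<epsilon> om" and V: "definable (\<lambda>e. V (e 0) (e (Suc 0)))"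
    and F: "\<And>i. i \<epsilon> m \<Longrightarrow> \<exists>F. wdf F \<and> (\<forall>a. a \<epsilon> A \<and> V i a \<longrightarrow> a \<epsilon> F)"
  shows "wdf (coll (\<lambda>u. u \<epsilon> funs m A \<and> (\<forall>i a. pr i a \<epsilon> u \<longrightarrow> V i a)))"
proof -
  note [definability] = definable_subst2[OF V]
  define P where "P m = coll (\<lambda>u. u \<epsilon> funs m A \<and> (\<forall>i a. pr i a \<epsilon> u \<longrightarrow> V i a))" for m
  have P: "u \<epsilon> P m \<longleftrightarrow> is_function u m A \<and> (\<forall>i a. pr i a \<epsilon> u \<longrightarrow> V i a)" for u m
    unfolding P_def by (subst mem_coll_sep) (intro definability, simp)
  have [definability]: "definable_term t \<Longrightarrow> definable_term (\<lambda>e. P (t e))" for t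
    by (rule definable_term_subst1[where F = P], unfold P_def, intro definability)
  have "(\<forall>i. i \<epsilon> m \<longrightarrow> (\<exists>F. wdf F \<and> (\<forall>a. a \<epsilon> A \<and> V i a \<longrightarrow> a \<epsilon> F))) \<longrightarrow> wdf (P m)"
    using m
  proof (induction rule: om_induct)
    case definable
    show ?case by (intro definability)
  next
    case emp
    have "is_subset (P emp) (ins emp emp)"
      unfolding is_subset_def P
      by (auto simp: is_function_iff intro!: ext_eq)
    then show ?case using wdf_subset[OF finite_wdf[OF finite_sing]] by blast
  next
    case (suc m)
    show ?case
    proof
      assume *: "\<forall>i. i \<epsilon> ins m m \<longrightarrow> (\<exists>F. wdf F \<and> (\<forall>a. a \<epsilon> A \<and> V i a \<longrightarrow> a \<epsilon> F))"
      then have Pm: "wdf (P m)" using suc.IH by auto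
      show "wdf (P (ins m m))"
      proof (rule wdf_fibres[OF Pm, where R = "\<lambda>u w. \<exists>a. w = ins (pr m a) u"])
        show "definable (\<lambda>e. \<exists>a. e (Suc 0) = ins (pr m a) (e 0))"
          by (intro definability)
        show "\<exists>u. u \<epsilon> P m \<and> (\<exists>a. w = ins (pr m a) u)" if w: "w \<epsilon> P (ins m m)" for w
        proof -
          obtain u a where "is_function u m A" "a \<epsilon> A" "w = ins (pr m a) u"
            using w function_suc_cases unfolding P by metis
          then show ?thesis using w by (auto simp: P)
        qed
        fix u assume u: "u \<epsilon> P m"
        obtain F where F: "wdf F" "\<forall>a. a \<epsilon> A \<and> V m a \<longrightarrow> a \<epsilon> F" using * by auto
        obtain G where G: "\<And>w. w \<epsilon> G \<longleftrightarrow> w \<epsilon> P (ins m m) \<and> (\<exists>a. w = ins (pr m a) u)"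
          by (atomize_elim, rule separation_definable) (intro definability)
        have "wdf G"
        proof (rule wdf_image[OF F(1), where R = "\<lambda>a w. w = ins (pr m a) u"])
          show "definable (\<lambda>e. e (Suc 0) = ins (pr m (e 0)) u)" by (intro definability)
          fix w assume "w \<epsilon> G"
          then obtain a where a: "w \<epsilon> P (ins m m)" "w = ins (pr m a) u" unfolding G by blast
          then have "pr m a \<epsilon> w" by simp
          then have "a \<epsilon> A \<and> V m a" using a(1) functionD(2) unfolding P by blast
          then show "\<exists>a. a \<epsilon> F \<and> w = ins (pr m a) u" using F(2) a(2) by blast
        qed auto
        then show "\<exists>G. wdf G \<and> (\<forall>y. y \<epsilon> P (ins m m) \<and> (\<exists>a. y = ins (pr m a) u) \<longrightarrow> y \<epsilon> G)"
          using G by blast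
      qed
    qed
  qed
  then show ?thesis using F unfolding P_def by blast
qed

lemma wdf_funs:
  assumes "m \<epsilon> om" "wdf C" shows "wdf (funs m C)"
proof -
  have "wdf (coll (\<lambda>u. u \<epsilon> funs m C \<and> (\<forall>i a. pr i a \<epsilon> u \<longrightarrow> True)))"
    by (rule wdf_prod) (use assms in \<open>auto intro: definability\<close>)
  moreover have "coll (\<lambda>u. u \<epsilon> funs m C \<and> (\<forall>i a. pr i a \<epsilon> u \<longrightarrow> True)) = funs m C"
    by (rule ext_eq, subst mem_coll_sep) (intro definability, simp)
  ultimately show ?thesis by simp
qed

text \<open>
  The unbounded map: \<open>E m\<close> holds for the finite subsets that inject into \<open>m\<close>, and no \<open>m\<close> suffices
  for all of them.
\<close>

lemma not_wdf_pow_infinite: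
  assumes X: "\<not> is_finite X" shows "\<not> wdf (pow X)"
proof
  define E where "E m Z \<longleftrightarrow> (\<exists>h. (\<forall>z. z \<epsilon> Z \<longrightarrow> (\<exists>i. i \<epsilon> m \<and> pr i z \<epsilon> h)) \<and>
    (\<forall>i z z'. pr i z \<epsilon> h \<and> pr i z' \<epsilon> h \<longrightarrow> z = z'))" for m Z
  have [definability]: "definable_term s \<Longrightarrow> definable_term t \<Longrightarrow> definable (\<lambda>e. E (s e) (t e))" for s t
    by (rule definable_subst2[where R = E], unfold E_def, intro definability)
  assume "wdf (pow X)"
  then have "\<exists>m. m \<epsilon> om \<and> (\<forall>Z. Z \<epsilon> pow X \<longrightarrow> is_finite Z \<longrightarrow> E m Z)"
  proof (rule wdfD[where R = "\<lambda>m Z. is_finite Z \<longrightarrow> E m Z"])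
    show "definable (\<lambda>e. is_finite (e (Suc 0)) \<longrightarrow> E (e 0) (e (Suc 0)))"
      by (intro definability)
    show "\<exists>m. m \<epsilon> om \<and> (is_finite Z \<longrightarrow> E m Z)" for Z
    proof (cases "is_finite Z")
      case True
      then obtain n f where "n \<epsilon> om" and f: "is_bijection f n Z"
        by (auto simp: is_finite_def mem_om)
      moreover have fn: "is_function f n Z" using f by (simp add: is_bijection_iff)
      have "E n Z"
        unfolding E_def
        using f functionD(1,4)[OF fn] unfolding is_bijection_iff by (intro exI[of _ f]) blast
      ultimately show ?thesis by blast
    qed (use emp_om in blast)
    show "is_finite Z \<longrightarrow> E m' Z" if "m \<epsilon> m'" "m' \<epsilon> om" "is_finite Z \<longrightarrow> E m Z" for m m' Z
      using that om_trans[OF that(2,1)] unfolding E_def by blast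
  qed
  then obtain m0 where m0: "m0 \<epsilon> om" "\<forall>Z. Z \<epsilon> pow X \<longrightarrow> is_finite Z \<longrightarrow> E m0 Z" by blast
  \<comment> \<open>By minimality some finite set does not inject into the predecessor of
    \<open>m\<close>; adding a point to it will give a finite set that does not inject into
    \<open>m\<close>.\<close>
  obtain m where m: "m \<epsilon> om" "\<forall>Z. Z \<epsilon> pow X \<longrightarrow> is_finite Z \<longrightarrow> E m Z"
    and least: "\<And>k. k \<epsilon> m \<Longrightarrow> \<not> (\<forall>Z. Z \<epsilon> pow X \<longrightarrow> is_finite Z \<longrightarrow> E k Z)"
  proof (rule om_least[where Q = "\<lambda>m. \<forall>Z. Z \<epsilon> pow X \<longrightarrow> is_finite Z \<longrightarrow> E m Z"])
    show "definable (\<lambda>e. \<forall>Z. Z \<epsilon> pow X \<longrightarrow> is_finite Z \<longrightarrow> E (e 0) Z)"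
      by (intro definability)
  qed (use m0 in blast)+
  have new: "\<exists>x. x \<epsilon> X \<and> \<not> x \<epsilon> Z" if "Z \<epsilon> pow X" "is_finite Z" for Z
  proof (rule ccontr)
    assume "\<not> ?thesis"
    then have "Z = X" using that(1) by (intro ext_eq) (auto simp: is_subset_def)
    then show False using X that(2) by simp
  qed
  have insX: "ins x Z \<epsilon> pow X" if "x \<epsilon> X" "Z \<epsilon> pow X" for x Z
    using that by (auto simp: is_subset_def)
  from m(1) show False
  proof (cases rule: om_cases)
    case 1
    have e: "emp \<epsilon> pow X" by (simp add: is_subset_def)
    then obtain x where "x \<epsilon> X" using new[OF _ finite_emp] by blast
    then have "E m (ins x emp)" using m(2) insX[OF _ e] finite_sing by blast
    then show False using 1 by (auto simp: E_def)
  next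
    case (2 k)
    then obtain Z where Z: "Z \<epsilon> pow X" "is_finite Z" "\<not> E k Z" using least[of k] by auto
    obtain x where x: "x \<epsilon> X" "\<not> x \<epsilon> Z" using new[OF Z(1,2)] by blast
    have "E m (ins x Z)" using m(2) insX[OF x(1) Z(1)] finite_ins[OF Z(2)] by blast
    then obtain h where h: "\<And>z. z \<epsilon> ins x Z \<Longrightarrow> \<exists>i. i \<epsilon> m \<and> pr i z \<epsilon> h"
      "\<And>i z z'. pr i z \<epsilon> h \<Longrightarrow> pr i z' \<epsilon> h \<Longrightarrow> z = z'"
      unfolding E_def by blast
    obtain j where j: "j \<epsilon> m" "pr j x \<epsilon> h" using h(1)[of x] by auto
    \<comment> \<open>Since \<open>m\<close> is \<open>ins k k\<close>, its last index is
      \<open>k\<close>. What is stored there moves to the index \<open>j\<close>, which becomes free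
      when \<open>x\<close> is deleted.\<close>
    let ?P = "\<lambda>i z. z \<epsilon> Z \<and> (i \<epsilon> k \<and> pr i z \<epsilon> h \<or> i = j \<and> pr k z \<epsilon> h)"
    let ?h = "coll (\<lambda>p. p \<epsilon> cart m Z \<and> (\<exists>i z. p = pr i z \<and> ?P i z))"
    have "p \<epsilon> ?h \<longleftrightarrow> p \<epsilon> cart m Z \<and> (\<exists>i z. p = pr i z \<and> ?P i z)" for p
      by (rule mem_coll_sep) (intro definability)
    then have mem: "pr i z \<epsilon> ?h \<longleftrightarrow> ?P i z" for i z
      using j 2 by auto
    have "E k Z"
      unfolding E_def
    proof (rule exI[of _ ?h], intro conjI allI impI)
      fix z assume z: "z \<epsilon> Z"
      then obtain i where i: "i = k \<or> i \<epsilon> k" "pr i z \<epsilon> h" using h(1)[of z] 2(2) by auto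
      have "j \<noteq> k" if "i = k" using that i j h(2) x(2) z by blast
      then have "j \<epsilon> k" if "i = k" using that j(1) 2(2) by auto
      then show "\<exists>i. i \<epsilon> k \<and> pr i z \<epsilon> ?h" unfolding mem using i z by blast
    next
      fix i z z' assume "pr i z \<epsilon> ?h \<and> pr i z' \<epsilon> ?h"
      then show "z = z'" unfolding mem using h(2) j(2) x(2) by blast
    qed
    then show False using Z(3) by blast
  qed
qed

section \<open>Well-orders\<close>

text \<open>Only the restriction of \<open>r\<close> to \<open>C\<close> matters, so a subset of
  \<open>C\<close> keeps the same \<open>r\<close>. Linearity is contained in the last clause,
  applied to two-element subsets.\<close>

definition wo :: "'a \<Rightarrow> 'a \<Rightarrow> bool" where
  "wo C r \<longleftrightarrow> (\<forall>x. x \<epsilon> C \<longrightarrow> \<not> pr x x \<epsilon> r) \<and>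
    (\<forall>x y z. x \<epsilon> C \<and> y \<epsilon> C \<and> z \<epsilon> C \<and> pr x y \<epsilon> r \<and> pr y z \<epsilon> r \<longrightarrow> pr x z \<epsilon> r) \<and>
    (\<forall>s. is_subset s C \<and> s \<noteq> emp \<longrightarrow>
      (\<exists>m. m \<epsilon> s \<and> (\<forall>y. y \<epsilon> s \<and> y \<noteq> m \<longrightarrow> pr m y \<epsilon> r)))"

lemma definable_wo [definability]:
  "definable_term s \<Longrightarrow> definable_term t \<Longrightarrow> definable (\<lambda>e. wo (s e) (t e))"
  by (rule definable_subst2[where R = wo], unfold wo_def, intro definability)

lemma wo_irrefl: "wo C r \<Longrightarrow> x \<epsilon> C \<Longrightarrow> \<not> pr x x \<epsilon> r"
  unfolding wo_def by blast

lemma wo_trans: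
  "wo C r \<Longrightarrow> x \<epsilon> C \<Longrightarrow> y \<epsilon> C \<Longrightarrow> z \<epsilon> C \<Longrightarrow> pr x y \<epsilon> r \<Longrightarrow> pr y z \<epsilon> r \<Longrightarrow> pr x z \<epsilon> r"
  unfolding wo_def by blast

lemma wo_asym: "wo C r \<Longrightarrow> x \<epsilon> C \<Longrightarrow> y \<epsilon> C \<Longrightarrow> pr x y \<epsilon> r \<Longrightarrow> \<not> pr y x \<epsilon> r"
  using wo_irrefl wo_trans by blast

lemma wo_least_set:
  assumes "wo C r" "is_subset s C" "x \<epsilon> s"
  shows "\<exists>m. m \<epsilon> s \<and> (\<forall>y. y \<epsilon> s \<and> y \<noteq> m \<longrightarrow> pr m y \<epsilon> r)"
proof -
  have "s \<noteq> emp" using assms(3) by auto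
  then show ?thesis using assms(1,2) unfolding wo_def by blast
qed

lemma wo_least:
  assumes "wo C r" "definable (\<lambda>e. Q (e 0))" "x \<epsilon> C" "Q x"
  shows "\<exists>m. m \<epsilon> C \<and> Q m \<and> (\<forall>y. y \<epsilon> C \<and> Q y \<and> y \<noteq> m \<longrightarrow> pr m y \<epsilon> r)"
proof -
  let ?s = "coll (\<lambda>x. x \<epsilon> C \<and> Q x)"
  have s: "x \<epsilon> ?s \<longleftrightarrow> x \<epsilon> C \<and> Q x" for x by (rule mem_coll_sep[OF assms(2)])
  show ?thesis
    using wo_least_set[OF assms(1), of ?s x] assms(3,4) unfolding s is_subset_def by blast
qed

lemma wo_linear:
  assumes "wo C r" "x \<epsilon> C" "y \<epsilon> C"
  shows "x = y \<or> pr x y \<epsilon> r \<or> pr y x \<epsilon> r"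
  using wo_least_set[OF assms(1), of "upair x y" x] assms(2,3)
  by (auto simp: is_subset_def)

lemma wo_induct [consumes 2, case_names definable less]:
  assumes "wo C r" "x \<epsilon> C" and Q: "definable (\<lambda>e. Q (e 0))"
    and less: "\<And>x. x \<epsilon> C \<Longrightarrow> (\<And>y. y \<epsilon> C \<Longrightarrow> pr y x \<epsilon> r \<Longrightarrow> Q y) \<Longrightarrow> Q x"
  shows "Q x"
proof (rule ccontr)
  assume "\<not> Q x"
  then obtain m where "m \<epsilon> C" "\<not> Q m" "\<And>y. y \<epsilon> C \<Longrightarrow> \<not> Q y \<Longrightarrow> y \<noteq> m \<Longrightarrow> pr m y \<epsilon> r"
    using wo_least[OF assms(1) definable_not[OF Q] assms(2)] by blast
  then show False using less[of m] wo_asym[OF assms(1)] wo_irrefl[OF assms(1)] by blast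
qed

lemma wo_finite_max:
  assumes wo: "wo C r" and "is_finite s" "is_subset s C" "s \<noteq> emp"
  shows "\<exists>m. m \<epsilon> s \<and> (\<forall>x. x \<epsilon> s \<longrightarrow> x = m \<or> pr x m \<epsilon> r)"
proof -
  have "is_subset s C \<and> s \<noteq> emp \<longrightarrow> (\<exists>m. m \<epsilon> s \<and> (\<forall>x. x \<epsilon> s \<longrightarrow> x = m \<or> pr x m \<epsilon> r))"
    using assms(2)
  proof (induction rule: finite_induct)
    case definable
    show ?case by (intro definability)
  next
    case emp
    show ?case by simp
  next
    case (ins a s)
    show ?case
    proof (intro impI, elim conjE)
      assume *: "is_subset (ins a s) C"
      show "\<exists>m. m \<epsilon> ins a s \<and> (\<forall>x. x \<epsilon> ins a s \<longrightarrow> x = m \<or> pr x m \<epsilon> r)"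
      proof (cases "s = emp")
        case True
        then show ?thesis by auto
      next
        case False
        then obtain m where m: "m \<epsilon> s" "\<forall>x. x \<epsilon> s \<longrightarrow> x = m \<or> pr x m \<epsilon> r"
          using ins.IH * by (auto simp: is_subset_def)
        have C: "a \<epsilon> C" "m \<epsilon> C" "\<And>x. x \<epsilon> s \<Longrightarrow> x \<epsilon> C" using * m(1) by (auto simp: is_subset_def)
        show ?thesis
        proof (cases "pr m a \<epsilon> r")
          case True
          then have "\<forall>x. x \<epsilon> ins a s \<longrightarrow> x = a \<or> pr x a \<epsilon> r"
            using m C wo_trans[OF wo _ C(2,1)] unfolding mem_ins by blast
          then show ?thesis by auto
        next
          case False
          then have "\<forall>x. x \<epsilon> ins a s \<longrightarrow> x = m \<or> pr x m \<epsilon> r"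
            using m wo_linear[OF wo C(1,2)] unfolding mem_ins by blast
          then show ?thesis using m(1) by auto
        qed
      qed
    qed
  qed
  then show ?thesis using assms by blast
qed

section \<open>Products and powers of well-orders\<close>

definition omr :: 'a where
  "omr = coll (\<lambda>p. p \<epsilon> cart om om \<and> (\<exists>m n. p = pr m n \<and> m \<epsilon> n))"

lemma mem_omr [simp]: "pr m n \<epsilon> omr \<longleftrightarrow> n \<epsilon> om \<and> m \<epsilon> n"
  unfolding omr_def by (subst mem_coll_sep) (intro definability, use om_mem in auto)

lemma wo_om: "wo om omr"
  unfolding wo_def
proof (intro conjI allI impI)
  fix s assume "is_subset s om \<and> s \<noteq> emp"
  then have s: "is_subset s om" "s \<noteq> emp" by auto
  from s(2) obtain n where n: "n \<epsilon> s" using ex_mem by blast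
  then have "n \<epsilon> om" using s by (auto simp: is_subset_def)
  moreover have "definable (\<lambda>e. e 0 \<epsilon> s)" by (intro definability)
  ultimately obtain m where m: "m \<epsilon> om" "m \<epsilon> s" "\<And>k. k \<epsilon> m \<Longrightarrow> \<not> k \<epsilon> s"
    using om_least[of "\<lambda>n. n \<epsilon> s" n] n by blast
  then show "\<exists>m. m \<epsilon> s \<and> (\<forall>y. y \<epsilon> s \<and> y \<noteq> m \<longrightarrow> pr m y \<epsilon> omr)"
    using s(1) om_linear[OF m(1)] unfolding mem_omr is_subset_def by blast
next
  fix x y z assume "x \<epsilon> om \<and> y \<epsilon> om \<and> z \<epsilon> om \<and> pr x y \<epsilon> omr \<and> pr y z \<epsilon> omr"
  then show "pr x z \<epsilon> omr" unfolding mem_omr using om_trans by blast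
qed simp

lemma wo_subset:
  assumes "wo C r" "is_subset D C"
  shows "wo D r"
proof -
  have "x \<epsilon> C" if "x \<epsilon> D" for x using assms(2) that by (auto simp: is_subset_def)
  moreover have "is_subset s C" if "is_subset s D" for s
    using assms(2) that by (auto simp: is_subset_def)
  ultimately show ?thesis
    unfolding wo_def using wo_irrefl[OF assms(1)] wo_trans[OF assms(1)]
      assms(1)[unfolded wo_def] by metis
qed

definition lexr :: "'a \<Rightarrow> 'a \<Rightarrow> 'a \<Rightarrow> 'a \<Rightarrow> 'a" where
  "lexr C r E s = coll (\<lambda>p. p \<epsilon> cart (cart C E) (cart C E) \<and>
    (\<exists>c k c' k'. p = pr (pr c k) (pr c' k') \<and> (pr c c' \<epsilon> r \<or> c = c' \<and> pr k k' \<epsilon> s)))"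

lemma definable_lexr [definability]:
  "definable_term s \<Longrightarrow> definable_term t \<Longrightarrow> definable_term u \<Longrightarrow> definable_term v \<Longrightarrow>
    definable_term (\<lambda>e. lexr (s e) (t e) (u e) (v e))"
  by (rule definable_term_subst4[where F = lexr], unfold lexr_def,
      intro definability)

lemma mem_lexr: "pr (pr c k) (pr c' k') \<epsilon> lexr C r E s \<longleftrightarrow>
    c \<epsilon> C \<and> k \<epsilon> E \<and> c' \<epsilon> C \<and> k' \<epsilon> E \<and> (pr c c' \<epsilon> r \<or> c = c' \<and> pr k k' \<epsilon> s)"
  unfolding lexr_def by (subst mem_coll_sep) (intro definability, auto)

text \<open>The first coordinate decides first, so the order type is the ordinal product
  \<open>E*C\<close>, a copy of \<open>E\<close> for each element of \<open>C\<close>. A least pair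
  is found in the least column that occurs.\<close>

lemma wo_lexr:
  assumes C: "wo C r" and E: "wo E s"
  shows "wo (cart C E) (lexr C r E s)"
  unfolding wo_def
proof (intro conjI allI impI)
  fix x assume "x \<epsilon> cart C E"
  then show "\<not> pr x x \<epsilon> lexr C r E s"
    using wo_irrefl[OF C] wo_irrefl[OF E] by (auto simp: mem_cart mem_lexr)
next
  fix x y z
  assume *: "x \<epsilon> cart C E \<and> y \<epsilon> cart C E \<and> z \<epsilon> cart C E \<and>
    pr x y \<epsilon> lexr C r E s \<and> pr y z \<epsilon> lexr C r E s"
  then obtain a b c i j k where xyz: "x = pr a i" "y = pr b j" "z = pr c k" by (metis mem_cart)
  show "pr x z \<epsilon> lexr C r E s"
    using * wo_trans[OF C, of a b c] wo_trans[OF E, of i j k] unfolding xyz mem_lexr by blast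
next
  fix t assume "is_subset t (cart C E) \<and> t \<noteq> emp"
  then have t: "is_subset t (cart C E)" "t \<noteq> emp" by auto
  then obtain x k where "pr x k \<epsilon> t" "x \<epsilon> C"
    using ex_mem[OF t(2)] unfolding is_subset_def mem_cart by blast
  moreover have "definable (\<lambda>e. \<exists>k. pr (e 0) k \<epsilon> t)" by (intro definability)
  ultimately obtain c where c: "c \<epsilon> C" "\<exists>k. pr c k \<epsilon> t"
    "\<And>y. y \<epsilon> C \<Longrightarrow> \<exists>k. pr y k \<epsilon> t \<Longrightarrow> y \<noteq> c \<Longrightarrow> pr c y \<epsilon> r"
    using wo_least[OF C, of "\<lambda>c. \<exists>k. pr c k \<epsilon> t" x] by blast
  have tE: "y \<epsilon> C \<and> k \<epsilon> E" if "pr y k \<epsilon> t" for y k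
    using that t(1) unfolding is_subset_def by (metis pr_mem_cart)
  have "definable (\<lambda>e. pr c (e 0) \<epsilon> t)" by (intro definability)
  then obtain k where k: "k \<epsilon> E" "pr c k \<epsilon> t"
    "\<And>j. j \<epsilon> E \<Longrightarrow> pr c j \<epsilon> t \<Longrightarrow> j \<noteq> k \<Longrightarrow> pr k j \<epsilon> s"
    using wo_least[OF E, of "\<lambda>k. pr c k \<epsilon> t"] c(2) tE by blast
  have "pr (pr c k) p \<epsilon> lexr C r E s" if p: "p \<epsilon> t" "p \<noteq> pr c k" for p
  proof -
    obtain y j where y: "p = pr y j" using p t(1) unfolding is_subset_def mem_cart by blast
    then show ?thesis
      using p tE c k unfolding y mem_lexr by (cases "y = c") (simp, blast)+
  qed
  then show "\<exists>m. m \<epsilon> t \<and> (\<forall>y. y \<epsilon> t \<and> y \<noteq> m \<longrightarrow> pr m y \<epsilon> lexr C r E s)"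
    using k(2) by blast
qed

definition fins :: "'a \<Rightarrow> 'a" where
  "fins W = coll (\<lambda>s. s \<epsilon> pow W \<and> is_finite s)"

lemma mem_fins [simp]: "s \<epsilon> fins W \<longleftrightarrow> is_subset s W \<and> is_finite s"
  unfolding fins_def by (subst mem_coll_sep) (intro definability, simp)

lemma definable_fins [definability]:
  "definable_term s \<Longrightarrow> definable_term (\<lambda>e. fins (s e))"
  by (rule definable_term_subst1[where F = fins], unfold fins_def,
      intro definability)

text \<open>Finite sets are compared at the largest element of their symmetric difference.\<close>

definition antilex :: "'a \<Rightarrow> 'a \<Rightarrow> 'a" where
  "antilex W w = coll (\<lambda>p. p \<epsilon> cart (fins W) (fins W) \<and> (\<exists>s t. p = pr s t \<and>
    (\<exists>m. m \<epsilon> t \<and> \<not> m \<epsilon> s \<and> (\<forall>x. x \<epsilon> W \<and> pr m x \<epsilon> w \<longrightarrow> (x \<epsilon> s \<longleftrightarrow> x \<epsilon> t)))))"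

lemma definable_antilex [definability]:
  "definable_term s \<Longrightarrow> definable_term t \<Longrightarrow> definable_term (\<lambda>e. antilex (s e) (t e))"
  by (rule definable_term_subst2[where F = antilex], unfold antilex_def,
      intro definability)

lemma mem_antilex: "pr s t \<epsilon> antilex W w \<longleftrightarrow> s \<epsilon> fins W \<and> t \<epsilon> fins W \<and>
    (\<exists>m. m \<epsilon> t \<and> \<not> m \<epsilon> s \<and> (\<forall>x. x \<epsilon> W \<and> pr m x \<epsilon> w \<longrightarrow> (x \<epsilon> s \<longleftrightarrow> x \<epsilon> t)))"
  unfolding antilex_def by (subst mem_coll_sep) (intro definability, auto)

text \<open>The common core of the induction step and the final step of \<open>wo_antilex\<close>.
  If \<open>emp\<close> is not in \<open>T\<close>, take the least \<open>v\<close> that is the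
  maximum of a member; among the members with maximum \<open>v\<close>, the smallest is found by
  removing \<open>v\<close> and minimizing over sets bounded by \<open>v\<close>. The assumption
  \<open>IH\<close> is limited to bounds that occur in members of \<open>T\<close>, so inside an
  induction they lie below the current bound.\<close>

lemma antilex_least:
  assumes W: "wo W w" and T: "is_subset T (fins W)" and t0: "t0 \<epsilon> T"
    and IH: "\<And>v S. v \<epsilon> W \<Longrightarrow> \<exists>t. t \<epsilon> T \<and> v \<epsilon> t \<Longrightarrow> is_subset S (fins W) \<Longrightarrow> S \<noteq> emp \<Longrightarrow>
      (\<forall>s x. s \<epsilon> S \<and> x \<epsilon> s \<longrightarrow> pr x v \<epsilon> w) \<Longrightarrow>
      \<exists>m. m \<epsilon> S \<and> (\<forall>y. y \<epsilon> S \<and> y \<noteq> m \<longrightarrow> pr m y \<epsilon> antilex W w)"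
  shows "\<exists>m. m \<epsilon> T \<and> (\<forall>y. y \<epsilon> T \<and> y \<noteq> m \<longrightarrow> pr m y \<epsilon> antilex W w)"
proof -
  have TD: "is_subset t W" "is_finite t" "\<And>x. x \<epsilon> t \<Longrightarrow> x \<epsilon> W" if "t \<epsilon> T" for t
    using T that by (auto simp: is_subset_def)
  have max: "\<exists>m. m \<epsilon> t \<and> m \<epsilon> W \<and> (\<forall>x. x \<epsilon> t \<longrightarrow> x = m \<or> pr x m \<epsilon> w)" if "t \<epsilon> T" "t \<noteq> emp" for t
    using wo_finite_max[OF W TD(2,1)[OF that(1)] that(2)] TD(3)[OF that(1)] by blast
  show ?thesis
  proof (cases "emp \<epsilon> T")
    case True
    have "pr emp y \<epsilon> antilex W w" if y: "y \<epsilon> T" "y \<noteq> emp" for y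
    proof -
      obtain m where m: "m \<epsilon> y" "m \<epsilon> W" "\<And>x. x \<epsilon> y \<Longrightarrow> x = m \<or> pr x m \<epsilon> w" using max[OF y] by blast
      have "x \<epsilon> emp \<longleftrightarrow> x \<epsilon> y" if "x \<epsilon> W" "pr m x \<epsilon> w" for x
        using that m wo_asym[OF W m(2) that(1)] wo_irrefl[OF W] not_mem_emp by blast
      then show ?thesis
        unfolding mem_antilex using m(1) TD[OF y(1)] TD[OF True] by auto
    qed
    then show ?thesis using True by blast
  next
    case False
    \<comment> \<open>\<open>Q v\<close> says that \<open>v\<close> is the maximum of some member of
      \<open>T\<close>.\<close>
    define Q where "Q v \<longleftrightarrow> (\<exists>t. t \<epsilon> T \<and> v \<epsilon> t \<and> (\<forall>x. x \<epsilon> t \<longrightarrow> x = v \<or> pr x v \<epsilon> w))" for v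
    have "definable (\<lambda>e. Q (e 0))" unfolding Q_def by (intro definability)
    moreover obtain v0 where "v0 \<epsilon> W" "Q v0"
      using max[OF t0] t0 False unfolding Q_def by blast
    ultimately obtain v where v: "v \<epsilon> W" "Q v"
      and least: "\<And>y. y \<epsilon> W \<Longrightarrow> Q y \<Longrightarrow> y \<noteq> v \<Longrightarrow> pr v y \<epsilon> w"
      using wo_least[OF W, of Q v0] by blast
    obtain t1 where t1: "t1 \<epsilon> T" "v \<epsilon> t1" "\<forall>x. x \<epsilon> t1 \<longrightarrow> x = v \<or> pr x v \<epsilon> w"
      using v(2) unfolding Q_def by blast
    \<comment> \<open>The members of \<open>T\<close> with maximum \<open>v\<close>, with
      \<open>v\<close> taken out.\<close>
    obtain S where S: "\<And>s. s \<epsilon> S \<longleftrightarrow> s \<epsilon> fins W \<and> (ins v s \<epsilon> T \<and> (\<forall>x. x \<epsilon> s \<longrightarrow> pr x v \<epsilon> w))"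
      by (atomize_elim, rule separation_definable) (intro definability)
    have remove: "\<exists>s. s \<epsilon> S \<and> t = ins v s"
      if t: "t \<epsilon> T" "v \<epsilon> t" "\<forall>x. x \<epsilon> t \<longrightarrow> x = v \<or> pr x v \<epsilon> w" for t
    proof -
      let ?s = "coll (\<lambda>x. x \<epsilon> t \<and> x \<noteq> v)"
      have s: "x \<epsilon> ?s \<longleftrightarrow> x \<epsilon> t \<and> x \<noteq> v" for x by (rule mem_coll_sep) (intro definability)
      have "t = ins v ?s" by (rule ext_eq) (use t(2) in \<open>auto simp: s\<close>)
      moreover have "is_finite ?s"
        by (rule finite_subset[OF TD(2)[OF t(1)]]) (auto simp: is_subset_def s)
      moreover have "is_subset ?s W" using TD(3)[OF t(1)] by (auto simp: is_subset_def s)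
      ultimately show ?thesis using t by (intro exI[of _ ?s]) (auto simp: S s)
    qed
    then have ne: "S \<noteq> emp" using t1 not_mem_emp by metis
    have "\<exists>m. m \<epsilon> S \<and> (\<forall>y. y \<epsilon> S \<and> y \<noteq> m \<longrightarrow> pr m y \<epsilon> antilex W w)"
      by (rule IH[OF v(1) _ _ ne]) (use t1 in \<open>auto simp: S is_subset_def\<close>)
    then obtain m where m: "m \<epsilon> S" "\<And>y. y \<epsilon> S \<Longrightarrow> y \<noteq> m \<Longrightarrow> pr m y \<epsilon> antilex W w" by blast
    have mT: "ins v m \<epsilon> T" "\<And>x. x \<epsilon> m \<Longrightarrow> pr x v \<epsilon> w" using m(1) unfolding S by blast+
    have vm: "\<not> v \<epsilon> m" using mT(2) wo_irrefl[OF W v(1)] by blast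
    have "pr (ins v m) t \<epsilon> antilex W w" if t: "t \<epsilon> T" "t \<noteq> ins v m" for t
    proof (cases "v \<epsilon> t \<and> (\<forall>x. x \<epsilon> t \<longrightarrow> x = v \<or> pr x v \<epsilon> w)")
      case True
      then obtain s where s: "s \<epsilon> S" "t = ins v s" using remove[OF t(1)] by blast
      then have "pr m s \<epsilon> antilex W w" using m(2) t(2) by blast
      then obtain y where y: "y \<epsilon> s" "\<not> y \<epsilon> m"
        "\<forall>x. x \<epsilon> W \<and> pr y x \<epsilon> w \<longrightarrow> (x \<epsilon> m \<longleftrightarrow> x \<epsilon> s)"
        unfolding mem_antilex by blast
      have "y \<noteq> v" using s(1) y(1) wo_irrefl[OF W v(1)] unfolding S by blast
      then show ?thesis
        unfolding mem_antilex mem_fins s(2) using TD[OF mT(1)] TD[OF t(1)] y s(2)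
        by (auto intro!: exI[of _ y])
    next
      case False
      \<comment> \<open>A member whose maximum is not \<open>v\<close> has a larger maximum
        \<open>u\<close>, and \<open>u\<close> decides the comparison.\<close>
      obtain u where u: "u \<epsilon> t" "u \<epsilon> W" "\<And>x. x \<epsilon> t \<Longrightarrow> x = u \<or> pr x u \<epsilon> w"
        using max[OF t(1)] t(1) \<open>\<not> emp \<epsilon> T\<close> by metis
      have "Q u" unfolding Q_def using t(1) u by blast
      have "u \<noteq> v" using False u by blast
      then have vu: "pr v u \<epsilon> w" using least[OF u(2) \<open>Q u\<close>] by blast
      have mW: "x \<epsilon> W" if "x \<epsilon> ins v m" for x using TD(3)[OF mT(1) that] .
      have below: "pr x u \<epsilon> w" if "x \<epsilon> ins v m" for x
        using that vu mT(2) mW[OF that] wo_trans[OF W _ v(1) u(2)] unfolding mem_ins by blast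
      have "\<not> u \<epsilon> ins v m" using below wo_irrefl[OF W u(2)] by blast
      moreover have "x \<epsilon> ins v m \<longleftrightarrow> x \<epsilon> t" if "x \<epsilon> W" "pr u x \<epsilon> w" for x
        using that below u wo_asym[OF W u(2) that(1)] wo_irrefl[OF W u(2)] by blast
      ultimately show ?thesis
        unfolding mem_antilex mem_fins using TD[OF mT(1)] TD[OF t(1)] u(1) by blast
    qed
    then show ?thesis using mT(1) by blast
  qed
qed

text \<open>The order type is the ordinal power \<open>2^W\<close>. Least elements are obtained by
  induction on a strict upper bound \<open>v\<close> for all elements of all members of the family;
  a last use of \<open>antilex_least\<close> removes the bound.\<close>

lemma wo_antilex:
  assumes W: "wo W w"
  shows "wo (fins W) (antilex W w)"
  unfolding wo_def
proof (intro conjI allI impI)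
  fix s show "\<not> pr s s \<epsilon> antilex W w" by (auto simp: mem_antilex)
next
  fix s t u
  assume *: "s \<epsilon> fins W \<and> t \<epsilon> fins W \<and> u \<epsilon> fins W \<and> pr s t \<epsilon> antilex W w \<and> pr t u \<epsilon> antilex W w"
  then obtain m where m: "m \<epsilon> t" "\<not> m \<epsilon> s" "\<And>x. x \<epsilon> W \<Longrightarrow> pr m x \<epsilon> w \<Longrightarrow> (x \<epsilon> s \<longleftrightarrow> x \<epsilon> t)"
    unfolding mem_antilex by blast
  from * obtain m' where m': "m' \<epsilon> u" "\<not> m' \<epsilon> t" "\<And>x. x \<epsilon> W \<Longrightarrow> pr m' x \<epsilon> w \<Longrightarrow> (x \<epsilon> t \<longleftrightarrow> x \<epsilon> u)"
    unfolding mem_antilex by blast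
  have mW: "m \<epsilon> W" "m' \<epsilon> W" using * m(1) m'(1) by (auto simp: is_subset_def)
  have "m \<noteq> m'" using m m' by blast
  \<comment> \<open>The larger of the two deciding points decides between \<open>s\<close> and
    \<open>u\<close>.\<close>
  then consider "pr m m' \<epsilon> w" | "pr m' m \<epsilon> w" using wo_linear[OF W mW] by blast
  then show "pr s u \<epsilon> antilex W w"
  proof cases
    case 1
    have "x \<epsilon> s \<longleftrightarrow> x \<epsilon> u" if "x \<epsilon> W" "pr m' x \<epsilon> w" for x
      using that m(3)[OF that(1)] m'(3) wo_trans[OF W mW that(1) 1] by blast
    then show ?thesis unfolding mem_antilex using * m m' mW 1 by blast
  next
    case 2
    have "x \<epsilon> s \<longleftrightarrow> x \<epsilon> u" if "x \<epsilon> W" "pr m x \<epsilon> w" for x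
      using that m(3)[OF that(1)] m'(3) wo_trans[OF W mW(2,1) that(1) 2] by blast
    then show ?thesis unfolding mem_antilex using * m m' mW 2 by blast
  qed
next
  fix T assume "is_subset T (fins W) \<and> T \<noteq> emp"
  then have T: "is_subset T (fins W)" "T \<noteq> emp" by auto
  then obtain t0 where t0: "t0 \<epsilon> T" using ex_mem by blast
  have IH: "\<forall>S. is_subset S (fins W) \<and> S \<noteq> emp \<and> (\<forall>s x. s \<epsilon> S \<and> x \<epsilon> s \<longrightarrow> pr x v \<epsilon> w) \<longrightarrow>
      (\<exists>m. m \<epsilon> S \<and> (\<forall>y. y \<epsilon> S \<and> y \<noteq> m \<longrightarrow> pr m y \<epsilon> antilex W w))" if "v \<epsilon> W" for v
    using W that
  proof (induction rule: wo_induct)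
    case definable
    show ?case by (intro definability)
  next
    case (less v)
    show ?case
    proof (intro allI impI, elim conjE)
      fix S assume S: "is_subset S (fins W)" "S \<noteq> emp" "\<forall>s x. s \<epsilon> S \<and> x \<epsilon> s \<longrightarrow> pr x v \<epsilon> w"
      obtain s0 where "s0 \<epsilon> S" using ex_mem[OF S(2)] by blast
      then show "\<exists>m. m \<epsilon> S \<and> (\<forall>y. y \<epsilon> S \<and> y \<noteq> m \<longrightarrow> pr m y \<epsilon> antilex W w)"
        by (rule antilex_least[OF W S(1)]) (use less.IH S(3) in blast)
    qed
  qed
  show "\<exists>m. m \<epsilon> T \<and> (\<forall>y. y \<epsilon> T \<and> y \<noteq> m \<longrightarrow> pr m y \<epsilon> antilex W w)"
    by (rule antilex_least[OF W T(1) t0]) (use IH in blast)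
qed

text \<open>The isomorphisms of an initial segment of \<open>C\<close> onto an initial segment of
  \<open>E\<close>.\<close>

definition piso :: "'a \<Rightarrow> 'a \<Rightarrow> 'a \<Rightarrow> 'a \<Rightarrow> 'a \<Rightarrow> bool" where
  "piso C r E s h \<longleftrightarrow> is_subset h (cart C E) \<and>
    (\<forall>x y x'. pr x y \<epsilon> h \<and> x' \<epsilon> C \<and> pr x' x \<epsilon> r \<longrightarrow> (\<exists>y'. pr x' y' \<epsilon> h)) \<and>
    (\<forall>x y y'. pr x y \<epsilon> h \<and> y' \<epsilon> E \<and> pr y' y \<epsilon> s \<longrightarrow> (\<exists>x'. pr x' y' \<epsilon> h)) \<and>
    (\<forall>x y x' y'. pr x y \<epsilon> h \<and> pr x' y' \<epsilon> h \<longrightarrow>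
      (x = x' \<longleftrightarrow> y = y') \<and> (pr x x' \<epsilon> r \<longleftrightarrow> pr y y' \<epsilon> s))"

lemma definable_piso [definability]:
  "definable_term s \<Longrightarrow> definable_term t \<Longrightarrow> definable_term u \<Longrightarrow> definable_term v \<Longrightarrow>
    definable_term w \<Longrightarrow> definable (\<lambda>e. piso (s e) (t e) (u e) (v e) (w e))"
  by (rule definable_subst5[where R = piso], unfold piso_def, intro definability)

lemma pisoD:
  assumes "piso C r E s h"
  shows "pr x y \<epsilon> h \<Longrightarrow> x \<epsilon> C" "pr x y \<epsilon> h \<Longrightarrow> y \<epsilon> E"
    "pr x y \<epsilon> h \<Longrightarrow> x' \<epsilon> C \<Longrightarrow> pr x' x \<epsilon> r \<Longrightarrow> \<exists>y'. pr x' y' \<epsilon> h"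
    "pr x y \<epsilon> h \<Longrightarrow> y' \<epsilon> E \<Longrightarrow> pr y' y \<epsilon> s \<Longrightarrow> \<exists>x'. pr x' y' \<epsilon> h"
    "pr x y \<epsilon> h \<Longrightarrow> pr x' y' \<epsilon> h \<Longrightarrow> x = x' \<longleftrightarrow> y = y'"
    "pr x y \<epsilon> h \<Longrightarrow> pr x' y' \<epsilon> h \<Longrightarrow> pr x x' \<epsilon> r \<longleftrightarrow> pr y y' \<epsilon> s"
proof -
  have 1: "is_subset h (cart C E)"
    and 2: "\<forall>x y x'. pr x y \<epsilon> h \<and> x' \<epsilon> C \<and> pr x' x \<epsilon> r \<longrightarrow> (\<exists>y'. pr x' y' \<epsilon> h)"
    and 3: "\<forall>x y y'. pr x y \<epsilon> h \<and> y' \<epsilon> E \<and> pr y' y \<epsilon> s \<longrightarrow> (\<exists>x'. pr x' y' \<epsilon> h)"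
    and 4: "\<forall>x y x' y'. pr x y \<epsilon> h \<and> pr x' y' \<epsilon> h \<longrightarrow>
      (x = x' \<longleftrightarrow> y = y') \<and> (pr x x' \<epsilon> r \<longleftrightarrow> pr y y' \<epsilon> s)"
    using assms unfolding piso_def by - (elim conjE, assumption)+
  show "pr x y \<epsilon> h \<Longrightarrow> x \<epsilon> C" "pr x y \<epsilon> h \<Longrightarrow> y \<epsilon> E"
    using 1 unfolding is_subset_def by (metis pr_mem_cart)+
  show "pr x y \<epsilon> h \<Longrightarrow> x' \<epsilon> C \<Longrightarrow> pr x' x \<epsilon> r \<Longrightarrow> \<exists>y'. pr x' y' \<epsilon> h" using 2 by blast
  show "pr x y \<epsilon> h \<Longrightarrow> y' \<epsilon> E \<Longrightarrow> pr y' y \<epsilon> s \<Longrightarrow> \<exists>x'. pr x' y' \<epsilon> h" using 3 by blast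
  show "pr x y \<epsilon> h \<Longrightarrow> pr x' y' \<epsilon> h \<Longrightarrow> x = x' \<longleftrightarrow> y = y'" using 4 by blast
  show "pr x y \<epsilon> h \<Longrightarrow> pr x' y' \<epsilon> h \<Longrightarrow> pr x x' \<epsilon> r \<longleftrightarrow> pr y y' \<epsilon> s" using 4 by blast
qed

lemma piso_functional:
  assumes C: "wo C r" and E: "wo E s" and h: "piso C r E s h" and k: "piso C r E s k"
    and "pr x y \<epsilon> h" "pr x y' \<epsilon> k"
  shows "y = y'"
proof -
  \<comment> \<open>If \<open>y\<close> came before \<open>y'\<close>, then \<open>k\<close> would
    take the value \<open>y\<close> at some \<open>x0\<close> before \<open>x\<close>, where
    \<open>h\<close> and \<open>k\<close> agree, whereas \<open>h\<close> takes the value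
    \<open>y\<close> at \<open>x\<close>.\<close>
  have le: "\<not> pr y y' \<epsilon> s"
    if h: "piso C r E s h" and k: "piso C r E s k"
      and IH: "\<And>x' y y'. x' \<epsilon> C \<Longrightarrow> pr x' x \<epsilon> r \<Longrightarrow> pr x' y \<epsilon> h \<Longrightarrow> pr x' y' \<epsilon> k \<Longrightarrow> y = y'"
      and xy: "pr x y \<epsilon> h" "pr x y' \<epsilon> k" for h k x y y'
  proof
    assume "pr y y' \<epsilon> s"
    then obtain x0 where x0: "pr x0 y \<epsilon> k" using pisoD(4)[OF k xy(2) pisoD(2)[OF h xy(1)]] by blast
    then have "pr x0 x \<epsilon> r" using pisoD(6)[OF k x0 xy(2)] \<open>pr y y' \<epsilon> s\<close> by blast
    moreover have "x0 \<epsilon> C" using pisoD(1)[OF k x0] .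
    moreover obtain y0 where y0: "pr x0 y0 \<epsilon> h" using pisoD(3)[OF h xy(1)] calculation by blast
    ultimately have "y0 = y" using IH x0 by blast
    then have "x0 = x" using pisoD(5)[OF h y0 xy(1)] by blast
    then show False using \<open>pr x0 x \<epsilon> r\<close> \<open>x0 \<epsilon> C\<close> wo_irrefl[OF C] by blast
  qed
  have "x \<epsilon> C" using pisoD(1)[OF h assms(5)] .
  with C have "\<forall>y y'. pr x y \<epsilon> h \<and> pr x y' \<epsilon> k \<longrightarrow> y = y'"
  proof (induction rule: wo_induct)
    case definable
    show ?case by (intro definability)
  next
    case (less x)
    show ?case
    proof (intro allI impI, elim conjE)
      fix y y' assume xy: "pr x y \<epsilon> h" "pr x y' \<epsilon> k"
      have "\<not> pr y y' \<epsilon> s" by (rule le[OF h k _ xy]) (use less.IH in blast)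
      moreover have "\<not> pr y' y \<epsilon> s" by (rule le[OF k h _ xy(2,1)]) (use less.IH in blast)
      ultimately show "y = y'"
        using wo_linear[OF E pisoD(2)[OF h xy(1)] pisoD(2)[OF k xy(2)]] by blast
    qed
  qed
  then show ?thesis using assms by blast
qed

lemma piso_injective:
  assumes C: "wo C r" and E: "wo E s" and h: "piso C r E s h" and k: "piso C r E s k"
    and xy: "pr x y \<epsilon> h" "pr x' y \<epsilon> k"
  shows "x = x'"
proof -
  have False if h: "piso C r E s h" and k: "piso C r E s k"
    and xy: "pr x y \<epsilon> h" "pr x' y \<epsilon> k" and less: "pr x x' \<epsilon> r" for h k x x'
  proof -
    obtain y1 where y1: "pr x y1 \<epsilon> k" using pisoD(3)[OF k xy(2) pisoD(1)[OF h xy(1)] less] by blast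
    then have "y1 = y" using piso_functional[OF C E h k xy(1)] by blast
    then have "x = x'" using pisoD(5)[OF k y1 xy(2)] by blast
    then show False using less pisoD(1)[OF h xy(1)] wo_irrefl[OF C] by blast
  qed
  then show ?thesis
    using wo_linear[OF C pisoD(1)[OF h xy(1)] pisoD(1)[OF k xy(2)]] h k xy by blast
qed

text \<open>The union of all partial isomorphisms. The comparison map is thus given by one formula
  in the two orders, and nothing is chosen.\<close>

definition theta :: "'a \<Rightarrow> 'a \<Rightarrow> 'a \<Rightarrow> 'a \<Rightarrow> 'a" where
  "theta C r E s = coll (\<lambda>p. p \<epsilon> cart C E \<and> (\<exists>h. piso C r E s h \<and> p \<epsilon> h))"

lemma definable_theta [definability]:
  "definable_term s \<Longrightarrow> definable_term t \<Longrightarrow> definable_term u \<Longrightarrow> definable_term v \<Longrightarrow>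
    definable_term (\<lambda>e. theta (s e) (t e) (u e) (v e))"
  by (rule definable_term_subst4[where F = theta], unfold theta_def,
      intro definability)

lemma mem_theta: "p \<epsilon> theta C r E s \<longleftrightarrow> (\<exists>h. piso C r E s h \<and> p \<epsilon> h)"
proof -
  have "p \<epsilon> theta C r E s \<longleftrightarrow> p \<epsilon> cart C E \<and> (\<exists>h. piso C r E s h \<and> p \<epsilon> h)"
    unfolding theta_def by (rule mem_coll_sep) (intro definability)
  then show ?thesis unfolding piso_def is_subset_def by blast
qed

lemma theta_piso:
  assumes C: "wo C r" and E: "wo E s"
  shows "piso C r E s (theta C r E s)"
proof -
  \<comment> \<open>Partial isomorphisms are compatible, so pairs taken from two different ones
    still compare alike on both sides.\<close>
  have order: "(x = x' \<longleftrightarrow> y = y') \<and> (pr x x' \<epsilon> r \<longleftrightarrow> pr y y' \<epsilon> s)"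
    if h: "piso C r E s h" and k: "piso C r E s k" and xy: "pr x y \<epsilon> h" "pr x' y' \<epsilon> k"
    for h k x y x' y'
  proof -
    have up: "pr y y' \<epsilon> s" if h: "piso C r E s h" and k: "piso C r E s k"
      and xy: "pr x y \<epsilon> h" "pr x' y' \<epsilon> k" and "pr x x' \<epsilon> r" for h k x y x' y'
    proof -
      obtain y1 where y1: "pr x y1 \<epsilon> k"
        using pisoD(3)[OF k xy(2) pisoD(1)[OF h xy(1)] \<open>pr x x' \<epsilon> r\<close>] by blast
      then have "y1 = y" using piso_functional[OF C E h k xy(1)] by blast
      then show ?thesis using pisoD(6)[OF k y1 xy(2)] \<open>pr x x' \<epsilon> r\<close> by blast
    qed
    have eq: "x = x' \<longleftrightarrow> y = y'"
      using piso_functional[OF C E h k] piso_injective[OF C E h k] xy by blast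
    have "pr x x' \<epsilon> r" if "pr y y' \<epsilon> s"
    proof (rule ccontr)
      assume "\<not> pr x x' \<epsilon> r"
      moreover have "x \<noteq> x'" using that eq wo_irrefl[OF E pisoD(2)[OF h xy(1)]] by blast
      ultimately have "pr x' x \<epsilon> r"
        using wo_linear[OF C pisoD(1)[OF h xy(1)] pisoD(1)[OF k xy(2)]] by blast
      then have "pr y' y \<epsilon> s" by (rule up[OF k h xy(2,1)])
      then show False using that wo_asym[OF E pisoD(2)[OF h xy(1)] pisoD(2)[OF k xy(2)]] by blast
    qed
    then show ?thesis using eq up[OF h k xy] by blast
  qed
  show ?thesis
    unfolding piso_def
  proof (intro conjI)
    show "is_subset (theta C r E s) (cart C E)"
      unfolding is_subset_def mem_theta piso_def by blast
    show "\<forall>x y x'. pr x y \<epsilon> theta C r E s \<and> x' \<epsilon> C \<and> pr x' x \<epsilon> r \<longrightarrow> (\<exists>y'. pr x' y' \<epsilon> theta C r E s)"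
      unfolding mem_theta using pisoD(3) by blast
    show "\<forall>x y y'. pr x y \<epsilon> theta C r E s \<and> y' \<epsilon> E \<and> pr y' y \<epsilon> s \<longrightarrow> (\<exists>x'. pr x' y' \<epsilon> theta C r E s)"
      unfolding mem_theta using pisoD(4) by blast
    show "\<forall>x y x' y'. pr x y \<epsilon> theta C r E s \<and> pr x' y' \<epsilon> theta C r E s \<longrightarrow>
      (x = x' \<longleftrightarrow> y = y') \<and> (pr x x' \<epsilon> r \<longleftrightarrow> pr y y' \<epsilon> s)"
      unfolding mem_theta using order by blast
  qed
qed

text \<open>Otherwise the least element missing from the domain and the least one missing from the
  range could be added to \<open>theta\<close> as a new pair.\<close>

lemma comparability:
  assumes C: "wo C r" and E: "wo E s"
  shows "(\<forall>x. x \<epsilon> C \<longrightarrow> (\<exists>y. pr x y \<epsilon> theta C r E s)) \<or>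
    (\<forall>y. y \<epsilon> E \<longrightarrow> (\<exists>x. pr x y \<epsilon> theta C r E s))"
proof (rule ccontr)
  let ?t = "theta C r E s"
  note th = pisoD[OF theta_piso[OF C E]]
  assume "\<not> ?thesis"
  then obtain x0 y0 where "x0 \<epsilon> C" "\<not> (\<exists>y. pr x0 y \<epsilon> ?t)" "y0 \<epsilon> E" "\<not> (\<exists>x. pr x y0 \<epsilon> ?t)"
    by blast
  note xy0 = this
  have "definable (\<lambda>e. \<not> (\<exists>y. pr (e 0) y \<epsilon> ?t))" by (intro definability)
  from wo_least[OF C this xy0(1,2)] obtain a where a: "a \<epsilon> C" "\<not> (\<exists>y. pr a y \<epsilon> ?t)"
      "\<And>x. x \<epsilon> C \<Longrightarrow> \<not> (\<exists>y. pr x y \<epsilon> ?t) \<Longrightarrow> x \<noteq> a \<Longrightarrow> pr a x \<epsilon> r"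
    by blast
  have "definable (\<lambda>e. \<not> (\<exists>x. pr x (e 0) \<epsilon> ?t))" by (intro definability)
  from wo_least[OF E this xy0(3,4)] obtain b where b: "b \<epsilon> E" "\<not> (\<exists>x. pr x b \<epsilon> ?t)"
      "\<And>y. y \<epsilon> E \<Longrightarrow> \<not> (\<exists>x. pr x y \<epsilon> ?t) \<Longrightarrow> y \<noteq> b \<Longrightarrow> pr b y \<epsilon> s"
    by blast
  have xa: "pr x a \<epsilon> r" if xy: "pr x y \<epsilon> ?t" for x y
  proof (rule ccontr)
    assume "\<not> pr x a \<epsilon> r"
    moreover have "x \<noteq> a" using a(2) xy by blast
    ultimately have "pr a x \<epsilon> r" using wo_linear[OF C th(1)[OF xy] a(1)] by blast
    then show False using th(3)[OF xy a(1)] a(2) by blast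
  qed
  have yb: "pr y b \<epsilon> s" if xy: "pr x y \<epsilon> ?t" for x y
  proof (rule ccontr)
    assume "\<not> pr y b \<epsilon> s"
    moreover have "y \<noteq> b" using b(2) xy by blast
    ultimately have "pr b y \<epsilon> s" using wo_linear[OF E th(2)[OF xy] b(1)] by blast
    then show False using th(4)[OF xy b(1)] b(2) by blast
  qed
  have "piso C r E s (ins (pr a b) ?t)"
    unfolding piso_def mem_ins pr_eq
  proof (intro conjI allI impI)
    show "is_subset (ins (pr a b) ?t) (cart C E)"
      using a b theta_piso[OF C E] by (auto simp: piso_def is_subset_def)
  next
    fix x y x' assume "(x = a \<and> y = b \<or> pr x y \<epsilon> ?t) \<and> x' \<epsilon> C \<and> pr x' x \<epsilon> r"
    then show "\<exists>y'. x' = a \<and> y' = b \<or> pr x' y' \<epsilon> ?t"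
      using th(3) a wo_asym[OF C] by metis
  next
    fix x y y' assume "(x = a \<and> y = b \<or> pr x y \<epsilon> ?t) \<and> y' \<epsilon> E \<and> pr y' y \<epsilon> s"
    then show "\<exists>x'. x' = a \<and> y' = b \<or> pr x' y' \<epsilon> ?t"
      using th(4) b wo_asym[OF E] by metis
  next
    fix x y x' y' assume "(x = a \<and> y = b \<or> pr x y \<epsilon> ?t) \<and> (x' = a \<and> y' = b \<or> pr x' y' \<epsilon> ?t)"
    then show "x = x' \<longleftrightarrow> y = y'"
      using th(5) a(2) b(2) by metis
  next
    fix x y x' y' assume *: "(x = a \<and> y = b \<or> pr x y \<epsilon> ?t) \<and> (x' = a \<and> y' = b \<or> pr x' y' \<epsilon> ?t)"
    then show "pr x x' \<epsilon> r \<longleftrightarrow> pr y y' \<epsilon> s"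
      using th(6) xa yb wo_irrefl[OF C a(1)] wo_irrefl[OF E b(1)] th(1,2)
        wo_asym[OF C _ a(1)] wo_asym[OF E _ b(1)] by metis
  qed
  then have "pr a b \<epsilon> ?t" unfolding mem_theta by (meson mem_ins)
  then show False using a(2) by blast
qed

section \<open>Coding tuples in a well-ordered set\<close>

lemma finite_cart:
  assumes F: "is_finite F" and G: "is_finite G"
  shows "is_finite (cart F G)"
proof (rule finite_fibres[OF F, where R = "\<lambda>c p. \<exists>k. p = pr c k"])
  show "definable (\<lambda>e. \<exists>k. e (Suc 0) = pr (e 0) k)" by (intro definability)
  show "\<exists>c. c \<epsilon> F \<and> (\<exists>k. p = pr c k)" if "p \<epsilon> cart F G" for p
    using that unfolding mem_cart by blast
  fix c assume "c \<epsilon> F"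
  obtain H where H: "\<And>p. p \<epsilon> H \<longleftrightarrow> p \<epsilon> cart F G \<and> (\<exists>k. p = pr c k)"
    by (atomize_elim, rule separation_definable) (intro definability)
  have "is_finite H"
  proof (rule finite_image[OF G, where R = "\<lambda>k p. p = pr c k"])
    show "definable (\<lambda>e. e (Suc 0) = pr c (e 0))" by (intro definability)
  qed (auto simp: H)
  then show "\<exists>H. is_finite H \<and> (\<forall>p. p \<epsilon> cart F G \<and> (\<exists>k. p = pr c k) \<longrightarrow> p \<epsilon> H)"
    using H by blast
qed

lemma wo_om_mem: "n \<epsilon> om \<Longrightarrow> wo n omr"
  using wo_subset[OF wo_om] om_mem by (auto simp: is_subset_def)

text \<open>
  The lexicographic order on \<open>\<omega> \<times> M\<close> has finite initial segments, so comparability yields the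
  injection without any arithmetic on \<open>\<omega>\<close>.
\<close>

lemma ex_pairing:
  assumes M: "M \<epsilon> om"
  shows "\<exists>J. (\<forall>k i. k \<epsilon> om \<and> i \<epsilon> M \<longrightarrow> (\<exists>j. j \<epsilon> om \<and> pr (pr k i) j \<epsilon> J)) \<and>
    (\<forall>p q j. pr p j \<epsilon> J \<and> pr q j \<epsilon> J \<longrightarrow> p = q) \<and>
    (\<forall>p j j'. pr p j \<epsilon> J \<and> pr p j' \<epsilon> J \<longrightarrow> j = j')"
proof -
  define L where "L = lexr om omr M omr"
  define J where "J = theta (cart om M) L om omr"
  have L: "wo (cart om M) L" unfolding L_def by (rule wo_lexr[OF wo_om wo_om_mem[OF M]])
  note J = pisoD[OF theta_piso[OF L wo_om], folded J_def]
  have "\<exists>j. pr p j \<epsilon> J" if p: "p \<epsilon> cart om M" for p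
  proof (rule ccontr)
    assume p_out: "\<not> (\<exists>j. pr p j \<epsilon> J)"
    then have ran: "\<exists>q. pr q j \<epsilon> J" if "j \<epsilon> om" for j
      using comparability[OF L wo_om] p that unfolding J_def by blast
    obtain k i where ki: "p = pr k i" "k \<epsilon> om" "i \<epsilon> M" using p unfolding mem_cart by blast
    \<comment> \<open>All of \<open>om\<close> would be matched with elements before
      \<open>p\<close>, whose first coordinates are at most \<open>k\<close>.\<close>
    have "is_finite om"
    proof (rule finite_image[where T = "cart (ins k k) M" and R = "\<lambda>q j. pr q j \<epsilon> J"])
      show "is_finite (cart (ins k k) M)"
        using finite_cart finite_nat suc_om ki(2) M by blast
      show "definable (\<lambda>e. pr (e 0) (e (Suc 0)) \<epsilon> J)" by (intro definability)
      show "j = j'" if "pr q j \<epsilon> J" "pr q j' \<epsilon> J" for q j j' using J(5)[OF that] by blast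
      fix j assume "j \<epsilon> om"
      then obtain q where q: "pr q j \<epsilon> J" using ran by blast
      have "q \<noteq> p" "\<not> pr p q \<epsilon> L" using q p_out J(3)[OF q p] by blast+
      then have "pr q p \<epsilon> L" using wo_linear[OF L J(1)[OF q] p] by blast
      moreover obtain k' i' where q': "q = pr k' i'" using J(1)[OF q] unfolding mem_cart by blast
      ultimately have "q \<epsilon> cart (ins k k) M"
        unfolding ki(1) q' L_def mem_lexr mem_omr by auto
      then show "\<exists>q. q \<epsilon> cart (ins k k) M \<and> pr q j \<epsilon> J" using q by blast
    qed
    then show False using finite_wdf not_wdf_om by blast
  qed
  then show ?thesis
    using J(2,5) by (intro exI[of _ J]) (metis pr_mem_cart)
qed

end

text \<open>\<open>N\<close> is the length of the tuples. The second arguments of \<open>J\<close>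
  below \<open>N\<close> tell the entries of a tuple apart, and the extra value \<open>N\<close>
  marks what has been moved out of the top column; hence \<open>ins N N\<close> in
  \<open>J_ex\<close>.\<close>

locale ZF_coding = ZF +
  fixes N J
  assumes N: "N \<epsilon> om"
    and J_ex: "k \<epsilon> om \<Longrightarrow> i \<epsilon> ins N N \<Longrightarrow> \<exists>j. j \<epsilon> om \<and> pr (pr k i) j \<epsilon> J"
    and J_inj: "pr p j \<epsilon> J \<Longrightarrow> pr q j \<epsilon> J \<Longrightarrow> p = q"
    and J_fun: "pr p j \<epsilon> J \<Longrightarrow> pr p j' \<epsilon> J \<Longrightarrow> j = j'"
begin

text \<open>With \<open>\<gamma>\<close> the order type of \<open>C\<close>, this order has type
  \<open>2^(\<omega>*\<gamma>) = \<omega>^\<gamma>\<close>: the part of a finite set in one column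
  codes, in binary, the coefficient of one power of \<omega>.\<close>

definition power_order :: "'a \<Rightarrow> 'a \<Rightarrow> 'a" where
  "power_order C r = antilex (cart C om) (lexr C r om omr)"

definition embed :: "'a \<Rightarrow> 'a \<Rightarrow> 'a" where
  "embed C r = theta C r (fins (cart C om)) (power_order C r)"

lemma definable_power_order [definability]:
  "definable_term s \<Longrightarrow> definable_term t \<Longrightarrow> definable_term (\<lambda>e. power_order (s e) (t e))"
  unfolding power_order_def by (intro definability)

lemma definable_embed [definability]:
  "definable_term s \<Longrightarrow> definable_term t \<Longrightarrow> definable_term (\<lambda>e. embed (s e) (t e))"
  unfolding embed_def by (intro definability)

text \<open>As \<open>\<gamma> \<le> \<omega>^\<gamma>\<close> for every order type, this singles
  out the fixed points \<open>\<gamma> = \<omega>^\<gamma>\<close>, for which no exponent below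
  \<open>\<gamma>\<close> is available.\<close>

definition embed_onto :: "'a \<Rightarrow> 'a \<Rightarrow> bool" where
  "embed_onto C r \<longleftrightarrow> (\<forall>s. s \<epsilon> fins (cart C om) \<longrightarrow> (\<exists>x. pr x s \<epsilon> embed C r))"

lemma definable_embed_onto [definability]:
  "definable_term s \<Longrightarrow> definable_term t \<Longrightarrow> definable (\<lambda>e. embed_onto (s e) (t e))"
  by (rule definable_subst2[where R = embed_onto], unfold embed_onto_def,
      intro definability)

definition is_least :: "'a \<Rightarrow> 'a \<Rightarrow> 'a \<Rightarrow> bool" where
  "is_least C r b \<longleftrightarrow> b \<epsilon> C \<and> (\<forall>y. y \<epsilon> C \<and> y \<noteq> b \<longrightarrow> pr b y \<epsilon> r)"

lemma definable_is_least [definability]: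
  "definable_term s \<Longrightarrow> definable_term t \<Longrightarrow> definable_term u \<Longrightarrow>
    definable (\<lambda>e. is_least (s e) (t e) (u e))"
  by (rule definable_subst3[where R = is_least], unfold is_least_def,
      intro definability)

text \<open>
  If \<open>s\<close> is the least finite subset of \<open>C \<times> \<omega>\<close> outside the range of \<open>embed C r\<close> and \<open>pr c k\<close> is its
  largest element, then \<open>C\<close> lies between \<open>\<omega>\<^sup>c\<close> and \<open>\<omega>\<^sup>c\<^sup>+\<^sup>1\<close>.
\<close>

definition exponent :: "'a \<Rightarrow> 'a \<Rightarrow> 'a \<Rightarrow> bool" where
  "exponent C r c \<longleftrightarrow> (\<exists>s k. s \<epsilon> fins (cart C om) \<and> \<not> (\<exists>x. pr x s \<epsilon> embed C r) \<and>
    (\<forall>t. t \<epsilon> fins (cart C om) \<and> \<not> (\<exists>x. pr x t \<epsilon> embed C r) \<and> t \<noteq> s \<longrightarrow> pr s t \<epsilon> power_order C r) \<and>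
    pr c k \<epsilon> s \<and> (\<forall>p. p \<epsilon> s \<longrightarrow> p = pr c k \<or> pr p (pr c k) \<epsilon> lexr C r om omr))"

lemma definable_exponent [definability]:
  "definable_term s \<Longrightarrow> definable_term t \<Longrightarrow> definable_term u \<Longrightarrow>
    definable (\<lambda>e. exponent (s e) (t e) (u e))"
  by (rule definable_subst3[where R = exponent], unfold exponent_def,
      intro definability)

text \<open>An injection of \<open>((c + 1) \<times> \<omega>) \<times> N\<close> into \<open>c \<times> \<omega>\<close>, where \<open>b\<close> is the least element.\<close>

definition squeeze :: "'a \<Rightarrow> 'a \<Rightarrow> 'a \<Rightarrow> 'a \<Rightarrow> 'a \<Rightarrow> bool" where
  "squeeze c b p i q \<longleftrightarrow> (\<exists>d k j. p = pr d k \<and> pr (pr k i) j \<epsilon> J \<and>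
    (d \<noteq> c \<and> q = pr d j \<or> d = c \<and> (\<exists>j'. pr (pr j N) j' \<epsilon> J \<and> q = pr b j')))"

lemma definable_squeeze [definability]:
  "definable_term s \<Longrightarrow> definable_term t \<Longrightarrow> definable_term u \<Longrightarrow> definable_term v \<Longrightarrow>
    definable_term w \<Longrightarrow> definable (\<lambda>e. squeeze (s e) (t e) (u e) (v e) (w e))"
  by (rule definable_subst5[where R = squeeze], unfold squeeze_def,
      intro definability)

text \<open>The graph is transposed so that the entries come first, which makes it a finite subset
  of \<open>C \<times> \<omega>\<close>.\<close>

definition graph_code :: "'a \<Rightarrow> 'a \<Rightarrow> 'a" where
  "graph_code C t = coll (\<lambda>p. p \<epsilon> cart C om \<and> (\<exists>i x. pr i x \<epsilon> t \<and> p = pr x i))"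

lemma definable_graph_code [definability]:
  "definable_term s \<Longrightarrow> definable_term t \<Longrightarrow> definable_term (\<lambda>e. graph_code (s e) (t e))"
  by (rule definable_term_subst2[where F = graph_code], unfold graph_code_def,
      intro definability)

lemma mem_graph_code: "p \<epsilon> graph_code C t \<longleftrightarrow> p \<epsilon> cart C om \<and> (\<exists>i x. pr i x \<epsilon> t \<and> p = pr x i)"
  unfolding graph_code_def by (rule mem_coll_sep) (intro definability)

text \<open>Each entry \<open>x\<close> stands for the finite set \<open>s\<close>; the sets of the
  different entries are merged into one, with the index \<open>i\<close> recorded by
  \<open>squeeze\<close>.\<close>

definition squeeze_code :: "'a \<Rightarrow> 'a \<Rightarrow> 'a \<Rightarrow> 'a" where
  "squeeze_code C r t = coll (\<lambda>q. q \<epsilon> cart C om \<and> (\<exists>i x s p c b. pr i x \<epsilon> t \<and> pr x s \<epsilon> embed C r \<and>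
    p \<epsilon> s \<and> exponent C r c \<and> is_least C r b \<and> squeeze c b p i q))"

lemma definable_squeeze_code [definability]:
  "definable_term s \<Longrightarrow> definable_term t \<Longrightarrow> definable_term u \<Longrightarrow>
    definable_term (\<lambda>e. squeeze_code (s e) (t e) (u e))"
  by (rule definable_term_subst3[where F = squeeze_code], unfold squeeze_code_def,
      intro definability)

lemma mem_squeeze_code: "q \<epsilon> squeeze_code C r t \<longleftrightarrow> q \<epsilon> cart C om \<and>
    (\<exists>i x s p c b. pr i x \<epsilon> t \<and> pr x s \<epsilon> embed C r \<and> p \<epsilon> s \<and> exponent C r c \<and> is_least C r b \<and>
      squeeze c b p i q)"
  unfolding squeeze_code_def by (rule mem_coll_sep) (intro definability)

text \<open>The case distinction belongs to the formula, because the coding has to be uniform in all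
  well-orders.\<close>

definition tuple_code :: "'a \<Rightarrow> 'a \<Rightarrow> 'a \<Rightarrow> 'a \<Rightarrow> bool" where
  "tuple_code C r t x \<longleftrightarrow> (embed_onto C r \<and> pr x (graph_code C t) \<epsilon> embed C r) \<or>
    (\<not> embed_onto C r \<and> pr x (squeeze_code C r t) \<epsilon> embed C r)"

lemma definable_tuple_code [definability]:
  "definable_term s \<Longrightarrow> definable_term t \<Longrightarrow> definable_term u \<Longrightarrow> definable_term v \<Longrightarrow>
    definable (\<lambda>e. tuple_code (s e) (t e) (u e) (v e))"
  by (rule definable_subst4[where R = tuple_code], unfold tuple_code_def, intro definability)

lemma wo_power_order: "wo C r \<Longrightarrow> wo (fins (cart C om)) (power_order C r)"
  unfolding power_order_def by (intro wo_antilex wo_lexr wo_om)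

lemma embed_piso: "wo C r \<Longrightarrow> piso C r (fins (cart C om)) (power_order C r) (embed C r)"
  unfolding embed_def by (intro theta_piso wo_power_order)

lemmas embedD = pisoD[OF embed_piso]

lemma graph_code_fins:
  assumes t: "is_function t N C"
  shows "graph_code C t \<epsilon> fins (cart C om)"
proof -
  have "is_finite (graph_code C t)"
  proof (rule finite_image[OF finite_nat[OF N], where R = "\<lambda>i p. \<exists>x. pr i x \<epsilon> t \<and> p = pr x i"])
    show "definable (\<lambda>e. \<exists>x. pr (e 0) x \<epsilon> t \<and> e (Suc 0) = pr x (e 0))" by (intro definability)
    show "p = p'" if "\<exists>x. pr i x \<epsilon> t \<and> p = pr x i" "\<exists>x. pr i x \<epsilon> t \<and> p' = pr x i" for i p p'
      using that functionD(4)[OF t] by blast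
    show "\<exists>i. i \<epsilon> N \<and> (\<exists>x. pr i x \<epsilon> t \<and> p = pr x i)" if "p \<epsilon> graph_code C t" for p
      using that functionD(1)[OF t] unfolding mem_graph_code by blast
  qed
  then show ?thesis by (simp add: is_subset_def mem_graph_code)
qed

lemma graph_code_inj:
  assumes t: "is_function t N C" "is_function t' N C" and eq: "graph_code C t = graph_code C t'"
  shows "t = t'"
proof (rule function_ext[OF t])
  fix i x assume ix: "pr i x \<epsilon> t"
  then have "pr x i \<epsilon> cart C om"
    using functionD(1,2)[OF t(1)] om_mem[OF N] by auto
  then have "pr x i \<epsilon> graph_code C t'" using ix unfolding eq[symmetric] mem_graph_code by blast
  then show "pr i x \<epsilon> t'" unfolding mem_graph_code by auto
qed

context
  fixes C r
  assumes C: "wo C r" and C_inf: "\<not> wdf C" and not_onto: "\<not> embed_onto C r"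
begin

text \<open>One of the two orders is exhausted by the comparison; as a finite set is missed, it is
  \<open>C\<close>.\<close>

lemma embed_total: "x \<epsilon> C \<Longrightarrow> \<exists>s. pr x s \<epsilon> embed C r"
 
    using comparability[OF C wo_power_order[OF C]] not_onto unfolding embed_onto_def embed_def by blast

text \<open>The range of \<open>embed C r\<close> is an initial segment, so it consists exactly of
  the sets before the least missing one, \<open>s0\<close>. The leading element
  \<open>pr c k\<close> of \<open>s0\<close> then bounds the elements of all sets in the
  range.\<close>

lemma exponent_ex:
  obtains s0 c k where
    "s0 \<epsilon> fins (cart C om)" "c \<epsilon> C" "k \<epsilon> om" "pr c k \<epsilon> s0"
    "\<And>p. p \<epsilon> s0 \<Longrightarrow> p = pr c k \<or> pr p (pr c k) \<epsilon> lexr C r om omr"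
    "\<And>x s. pr x s \<epsilon> embed C r \<Longrightarrow> pr s s0 \<epsilon> power_order C r"
    "\<And>s. pr s s0 \<epsilon> power_order C r \<Longrightarrow> \<exists>x. pr x s \<epsilon> embed C r"
    "\<And>d. exponent C r d \<longleftrightarrow> d = c"
proof -
  let ?W = "cart C om" and ?w = "lexr C r om omr"
  note P = wo_power_order[OF C] and W = wo_lexr[OF C wo_om] and th = embedD[OF C]
  define out where "out s \<longleftrightarrow> \<not> (\<exists>x. pr x s \<epsilon> embed C r)" for s
  have "definable (\<lambda>e. out (e 0))" unfolding out_def by (intro definability)
  moreover obtain s where "s \<epsilon> fins ?W" "out s"
    using not_onto unfolding embed_onto_def out_def by blast
  ultimately obtain s0 where s0: "s0 \<epsilon> fins ?W" "out s0"
    and least: "\<And>t. t \<epsilon> fins ?W \<Longrightarrow> out t \<Longrightarrow> t \<noteq> s0 \<Longrightarrow> pr s0 t \<epsilon> power_order C r"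
    using wo_least[OF P] by blast
  have below: "pr s s0 \<epsilon> power_order C r" if "pr x s \<epsilon> embed C r" for x s
  proof (rule ccontr)
    assume "\<not> ?thesis"
    moreover have "s \<noteq> s0" using that s0(2) unfolding out_def by blast
    ultimately have "pr s0 s \<epsilon> power_order C r"
      using wo_linear[OF P th(2)[OF that] s0(1)] by blast
    then show False using th(4)[OF that s0(1)] s0(2) unfolding out_def by blast
  qed
  have above: "\<exists>x. pr x s \<epsilon> embed C r" if s: "pr s s0 \<epsilon> power_order C r" for s
  proof (rule ccontr)
    assume "\<not> ?thesis"
    then have "out s" by (simp add: out_def)
    moreover have sW: "s \<epsilon> fins ?W" using s unfolding power_order_def mem_antilex by blast
    moreover have "s \<noteq> s0" using s wo_irrefl[OF P s0(1)] by blast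
    ultimately have "pr s0 s \<epsilon> power_order C r" using least by blast
    then show False using s wo_asym[OF P sW s0(1)] by blast
  qed
  \<comment> \<open>Some set precedes \<open>s0\<close> because \<open>C\<close> has an element, so
    \<open>s0\<close> is not empty and has a maximum.\<close>
  have "C \<noteq> emp" using C_inf finite_wdf[OF finite_emp] by blast
  then obtain x where "x \<epsilon> C" using ex_mem by blast
  then obtain s where "pr s s0 \<epsilon> power_order C r" using embed_total below by blast
  then have "s0 \<noteq> emp" unfolding power_order_def mem_antilex by auto
  then obtain m where m: "m \<epsilon> s0" "\<And>p. p \<epsilon> s0 \<Longrightarrow> p = m \<or> pr p m \<epsilon> ?w"
    using wo_finite_max[OF W _ _ \<open>s0 \<noteq> emp\<close>] s0(1) unfolding mem_fins by blast
  have sW: "m \<epsilon> ?W" using m(1) s0(1) by (auto simp: is_subset_def)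
  then obtain c k where ck: "m = pr c k" "c \<epsilon> C" "k \<epsilon> om" unfolding mem_cart by blast
  have "exponent C r d \<longleftrightarrow> d = c" for d
  proof
    assume "d = c"
    then show "exponent C r d"
      unfolding exponent_def using s0 least m ck unfolding out_def by blast
  next
    assume "exponent C r d"
    then obtain s l where s: "s \<epsilon> fins ?W" "out s"
      "\<And>t. t \<epsilon> fins ?W \<Longrightarrow> out t \<Longrightarrow> t \<noteq> s \<Longrightarrow> pr s t \<epsilon> power_order C r"
      and dl: "pr d l \<epsilon> s" "\<And>p. p \<epsilon> s \<Longrightarrow> p = pr d l \<or> pr p (pr d l) \<epsilon> ?w"
      unfolding exponent_def out_def by blast
    have "s = s0" using s s0 least wo_asym[OF P s(1) s0(1)] by blast
    then have "m = pr d l \<or> pr m (pr d l) \<epsilon> ?w \<and> pr (pr d l) m \<epsilon> ?w"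
      using dl m by metis
    moreover have "pr d l \<epsilon> ?W" using dl(1) s(1) by (auto simp: is_subset_def)
    ultimately have "m = pr d l" using wo_asym[OF W sW] by blast
    then show "d = c" using ck by simp
  qed
  then show ?thesis using that[OF s0(1) ck(2,3)] m below above unfolding ck(1) by blast
qed

text \<open>Sets in the range use columns up to \<open>c\<close> only, and every finite set using
  columns strictly before \<open>c\<close> is in the range. Emptying column \<open>c\<close>
  therefore brings the merged set back into the range, while the marks in \<open>J\<close> keep it
  decodable.\<close>

lemma squeeze_code_props:
  obtains "\<And>t. is_function t N C \<Longrightarrow> \<exists>x. x \<epsilon> C \<and> pr x (squeeze_code C r t) \<epsilon> embed C r"
    "\<And>t t'. is_function t N C \<Longrightarrow> is_function t' N C \<Longrightarrow>
      squeeze_code C r t = squeeze_code C r t' \<Longrightarrow> t = t'"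
proof -
  let ?W = "cart C om" and ?w = "lexr C r om omr"
  note P = wo_power_order[OF C] and W = wo_lexr[OF C wo_om] and th = embedD[OF C]
  obtain s0 c k where s0: "s0 \<epsilon> fins ?W" and c: "c \<epsilon> C" and k: "k \<epsilon> om" and ck: "pr c k \<epsilon> s0"
    and max: "\<And>p. p \<epsilon> s0 \<Longrightarrow> p = pr c k \<or> pr p (pr c k) \<epsilon> ?w"
    and below: "\<And>x s. pr x s \<epsilon> embed C r \<Longrightarrow> pr s s0 \<epsilon> power_order C r"
    and above: "\<And>s. pr s s0 \<epsilon> power_order C r \<Longrightarrow> \<exists>x. pr x s \<epsilon> embed C r"
    and exp: "\<And>d. exponent C r d \<longleftrightarrow> d = c"
    using exponent_ex by blast
  have ckW: "pr c k \<epsilon> ?W" using c k by simp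
  have s0W: "p \<epsilon> ?W" if "p \<epsilon> s0" for p using s0 that by (auto simp: is_subset_def)
  have not_max: "\<not> pr (pr c k) p \<epsilon> ?w" if "p \<epsilon> s0" for p
    using max[OF that] wo_asym[OF W s0W[OF that] ckW] wo_irrefl[OF W ckW] by blast
  have embedW: "p \<epsilon> ?W" if "pr x s \<epsilon> embed C r" "p \<epsilon> s" for x s p
    using th(2)[OF that(1)] that(2) by (auto simp: is_subset_def)
  \<comment> \<open>Above the point \<open>m\<close> that decides between \<open>s\<close> and
    \<open>s0\<close>, the two sets agree. An element of \<open>s\<close> beyond
    \<open>pr c k\<close> would thus lie in \<open>s0\<close>, beyond its maximum.\<close>
  have embed_le: "\<not> pr (pr c k) p \<epsilon> ?w" if xs: "pr x s \<epsilon> embed C r" and p: "p \<epsilon> s" for x s p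
  proof
    assume less: "pr (pr c k) p \<epsilon> ?w"
    obtain m where m: "m \<epsilon> s0" "\<And>q. q \<epsilon> ?W \<Longrightarrow> pr m q \<epsilon> ?w \<Longrightarrow> (q \<epsilon> s \<longleftrightarrow> q \<epsilon> s0)"
      using below[OF xs] unfolding power_order_def mem_antilex by blast
    have pW: "p \<epsilon> ?W" using embedW[OF xs p] .
    have "pr m p \<epsilon> ?w"
      using max[OF m(1)] less wo_trans[OF W s0W[OF m(1)] ckW pW] by blast
    then have "p \<epsilon> s0" using m(2)[OF pW] p by blast
    then show False using not_max less by blast
  qed
  have embed_mem: "l \<epsilon> om \<and> d \<epsilon> C \<and> (d = c \<or> pr d c \<epsilon> r)"
    if xs: "pr x s \<epsilon> embed C r" and p: "pr d l \<epsilon> s" for x s d l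
  proof -
    have dl: "d \<epsilon> C" "l \<epsilon> om" using embedW[OF xs p] by simp_all
    then have "\<not> pr c d \<epsilon> r" using embed_le[OF xs p] c k unfolding mem_lexr by blast
    then show ?thesis using wo_linear[OF C c dl(1)] dl by blast
  qed
  \<comment> \<open>Here \<open>pr c k\<close> itself decides in favour of
    \<open>s0\<close>.\<close>
  have in_range: "\<exists>x. pr x s \<epsilon> embed C r"
    if s: "s \<epsilon> fins ?W" "\<And>d l. pr d l \<epsilon> s \<Longrightarrow> pr d c \<epsilon> r" for s
  proof (rule above)
    have sW: "p \<epsilon> ?W" if "p \<epsilon> s" for p using s(1) that by (auto simp: is_subset_def)
    have less: "pr p (pr c k) \<epsilon> ?w" if p: "p \<epsilon> s" for p
    proof -
      obtain d l where dl: "p = pr d l" "d \<epsilon> C" "l \<epsilon> om" using sW[OF p] unfolding mem_cart by blast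
      then show ?thesis using s(2)[of d l] p c k unfolding dl(1) mem_lexr by blast
    qed
    then have "\<not> pr c k \<epsilon> s" using wo_irrefl[OF W ckW] by blast
    moreover have "q \<epsilon> s \<longleftrightarrow> q \<epsilon> s0" if "q \<epsilon> ?W" "pr (pr c k) q \<epsilon> ?w" for q
      using less not_max that wo_asym[OF W ckW that(1)] by blast
    ultimately show "pr s s0 \<epsilon> power_order C r"
      unfolding power_order_def mem_antilex using s(1) s0 ck by blast
  qed
  have "definable (\<lambda>e. True)" by (rule definable_bool)
  then obtain b where b: "is_least C r b"
    using wo_least[OF C, of "\<lambda>_. True" c] c unfolding is_least_def by blast
  have b_unique: "b' = b" if "is_least C r b'" for b'
    using that b wo_asym[OF C] unfolding is_least_def by blast
  have bC: "b \<epsilon> C" using b by (simp add: is_least_def)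
  \<comment> \<open>Column \<open>c\<close> can be emptied into column \<open>b\<close> only if they
    differ. If \<open>c\<close> were least, the elements of \<open>C\<close> would be coded by
    subsets of the finite set \<open>{c} \<times> (k + 1)\<close>, and \<open>C\<close> would be
    weakly Dedekind finite.\<close>
  have "b \<noteq> c"
  proof
    assume bc: "b = c"
    let ?F = "cart (ins c emp) (ins k k)"
    have F: "wdf (pow ?F)"
      by (intro wdf_pow_finite finite_cart finite_sing finite_nat suc_om k)
    have "wdf C"
    proof (rule wdf_image[OF F, where R = "\<lambda>s x. pr x s \<epsilon> embed C r"])
      show "definable (\<lambda>e. pr (e (Suc 0)) (e 0) \<epsilon> embed C r)" by (intro definability)
      show "x = x'" if "pr x s \<epsilon> embed C r" "pr x' s \<epsilon> embed C r" for s x x'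
        using th(5)[OF that] by blast
      fix x assume "x \<epsilon> C"
      then obtain s where s: "pr x s \<epsilon> embed C r" using embed_total by blast
      have "p \<epsilon> ?F" if p: "p \<epsilon> s" for p
      proof -
        obtain d l where dl: "p = pr d l" "d \<epsilon> C" "l \<epsilon> om"
          using embedW[OF s p] unfolding mem_cart by blast
        have d: "d = c"
         
            using embed_mem[OF s, of d l] p b wo_asym[OF C c dl(2)] unfolding dl(1) is_least_def bc by blast
        have "\<not> k \<epsilon> l"
          using embed_le[OF s p] c dl unfolding dl(1) d mem_lexr mem_omr using k by blast
        then have "l \<epsilon> ins k k" using om_linear[OF dl(3) k] by auto
        then show ?thesis unfolding dl(1) d by simp
      qed
      then show "\<exists>s. s \<epsilon> pow ?F \<and> pr x s \<epsilon> embed C r" using s by (auto simp: is_subset_def)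
    qed
    then show False using C_inf by blast
  qed
  then have bc: "pr b c \<epsilon> r" using b c unfolding is_least_def by blast
  have code: "q \<epsilon> squeeze_code C r t \<longleftrightarrow> q \<epsilon> ?W \<and>
      (\<exists>i x s p. pr i x \<epsilon> t \<and> pr x s \<epsilon> embed C r \<and> p \<epsilon> s \<and> squeeze c b p i q)" for q t
    unfolding mem_squeeze_code exp using b b_unique by blast
  have squeeze_fun: "q = q'" if "squeeze c b p i q" "squeeze c b p i q'" for p i q q'
    using that unfolding squeeze_def by (metis J_fun pr_eq)
  have J_om: "j \<epsilon> om" if "pr (pr l i) j \<epsilon> J" "l \<epsilon> om" "i \<epsilon> ins N N" for l i j
    using J_ex[OF that(2,3)] J_fun[OF that(1)] by blast
  have squeeze_ex: "\<exists>q. q \<epsilon> ?W \<and> squeeze c b (pr d l) i q" if "d \<epsilon> C" "l \<epsilon> om" "i \<epsilon> N" for d l i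
  proof -
    obtain j where j: "j \<epsilon> om" "pr (pr l i) j \<epsilon> J" using J_ex[of l i] \<open>l \<epsilon> om\<close> \<open>i \<epsilon> N\<close> by auto
    obtain j' where j': "j' \<epsilon> om" "pr (pr j N) j' \<epsilon> J" using J_ex[of j N] j by auto
    show ?thesis
    proof (cases "d = c")
      case True
      then have "squeeze c b (pr d l) i (pr b j')" unfolding squeeze_def using j j' by blast
      then show ?thesis using bC j' by (intro exI[of _ "pr b j'"]) simp
    next
      case False
      then have "squeeze c b (pr d l) i (pr d j)" unfolding squeeze_def using j by blast
      then show ?thesis using \<open>d \<epsilon> C\<close> j by (intro exI[of _ "pr d j"]) simp
    qed
  qed
  have total: "\<exists>x. x \<epsilon> C \<and> pr x (squeeze_code C r t) \<epsilon> embed C r" if t: "is_function t N C" for t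
  proof -
    have "is_finite (squeeze_code C r t)"
    proof (rule finite_fibres[OF finite_nat[OF N], where R = "\<lambda>i q. \<exists>x s p. pr i x \<epsilon> t \<and>
        pr x s \<epsilon> embed C r \<and> p \<epsilon> s \<and> squeeze c b p i q"])
      show "definable (\<lambda>e. \<exists>x s p. pr (e 0) x \<epsilon> t \<and> pr x s \<epsilon> embed C r \<and> p \<epsilon> s \<and>
          squeeze c b p (e 0) (e (Suc 0)))"
        by (intro definability)
      show "\<exists>i. i \<epsilon> N \<and> (\<exists>x s p. pr i x \<epsilon> t \<and> pr x s \<epsilon> embed C r \<and> p \<epsilon> s \<and> squeeze c b p i q)"
        if "q \<epsilon> squeeze_code C r t" for q
        using that functionD(1)[OF t] unfolding code by blast
      fix i assume "i \<epsilon> N"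
      then obtain x where x: "pr i x \<epsilon> t" using functionD(3)[OF t] by blast
      then obtain s where s: "pr x s \<epsilon> embed C r" using embed_total functionD(2)[OF t] by blast
      obtain F where F: "\<And>q. q \<epsilon> F \<longleftrightarrow> q \<epsilon> ?W \<and> (\<exists>p. p \<epsilon> s \<and> squeeze c b p i q)"
        by (atomize_elim, rule separation_definable) (intro definability)
      have "is_finite s" using th(2)[OF s] by simp
      then have "is_finite F"
      proof (rule finite_image[where R = "\<lambda>p q. squeeze c b p i q"])
        show "definable (\<lambda>e. squeeze c b (e 0) i (e (Suc 0)))" by (intro definability)
      qed (use squeeze_fun F in blast)+
      moreover have "q \<epsilon> F" if "q \<epsilon> squeeze_code C r t" "pr i x' \<epsilon> t" "pr x' s' \<epsilon> embed C r"
        "p \<epsilon> s'"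
        "squeeze c b p i q" for q x' s' p
      proof -
        have "x' = x" using functionD(4)[OF t that(2) x] .
        then have "s' = s" using th(5)[OF that(3) s] by blast
        then show ?thesis unfolding F using that code by blast
      qed
      ultimately show "\<exists>F. is_finite F \<and> (\<forall>q. q \<epsilon> squeeze_code C r t \<and> (\<exists>x s p. pr i x \<epsilon> t \<and>
          pr x s \<epsilon> embed C r \<and> p \<epsilon> s \<and> squeeze c b p i q) \<longrightarrow> q \<epsilon> F)"
        by blast
    qed
    then have "squeeze_code C r t \<epsilon> fins ?W" by (simp add: is_subset_def code)
    moreover have "pr d c \<epsilon> r" if dl: "pr d l \<epsilon> squeeze_code C r t" for d l
    proof -
      obtain i x s p where *: "pr i x \<epsilon> t" "pr x s \<epsilon> embed C r" "p \<epsilon> s" "squeeze c b p i (pr d l)"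
        using dl unfolding code by blast
      then show ?thesis using embed_mem[OF *(2)] bc unfolding squeeze_def by auto
    qed
    ultimately obtain x where "pr x (squeeze_code C r t) \<epsilon> embed C r" using in_range by blast
    then show ?thesis using th(1) by blast
  qed
  \<comment> \<open>An element \<open>p\<close> of \<open>s\<close> leaves a trace \<open>q\<close>
    in the common code. Decoding \<open>q\<close> on the side of \<open>t'\<close> returns the same
    \<open>p\<close> and the same index \<open>i\<close>, hence \<open>p\<close> is in the set of
    the entry of \<open>t'\<close> at \<open>i\<close>.\<close>
  have sub: "is_subset s s'"
    if t: "is_function t N C" and t': "is_function t' N C"
      and eq: "squeeze_code C r t = squeeze_code C r t'"
      and i: "pr i x \<epsilon> t" "pr i x' \<epsilon> t'" and s: "pr x s \<epsilon> embed C r" "pr x' s' \<epsilon> embed C r"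
    for t t' i x x' s s'
    unfolding is_subset_def
  proof (intro allI impI)
    fix p assume p: "p \<epsilon> s"
    then obtain d l where dl: "p = pr d l" "d \<epsilon> C" "l \<epsilon> om"
      using embedW[OF s(1) p] unfolding mem_cart by blast
    have iN: "i \<epsilon> N" using functionD(1)[OF t i(1)] .
    obtain q where q: "q \<epsilon> ?W" "squeeze c b p i q" using squeeze_ex[OF dl(2,3) iN] dl(1) by blast
    then have "q \<epsilon> squeeze_code C r t" unfolding code using i s p by blast
    then obtain i2 x2 s2 p2 where *: "pr i2 x2 \<epsilon> t'" "pr x2 s2 \<epsilon> embed C r" "p2 \<epsilon> s2"
      "squeeze c b p2 i2 q"
      unfolding eq code by blast
    have i2N: "i2 \<epsilon> N" using functionD(1)[OF t' *(1)] .
    have N_new: "i \<noteq> N" "i2 \<noteq> N" using iN i2N by auto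
    obtain d1 l1 j1 where 1: "p = pr d1 l1" "pr (pr l1 i) j1 \<epsilon> J"
      "d1 \<noteq> c \<and> q = pr d1 j1 \<or> d1 = c \<and> (\<exists>j'. pr (pr j1 N) j' \<epsilon> J \<and> q = pr b j')"
      using q(2) unfolding squeeze_def by blast
    obtain d2 l2 j2 where 2: "p2 = pr d2 l2" "pr (pr l2 i2) j2 \<epsilon> J"
      "d2 \<noteq> c \<and> q = pr d2 j2 \<or> d2 = c \<and> (\<exists>j'. pr (pr j2 N) j' \<epsilon> J \<and> q = pr b j')"
      using *(4) unfolding squeeze_def by blast
    have J_eq: "l = l' \<and> m = m'" if "pr (pr l m) j \<epsilon> J" "pr (pr l' m') j \<epsilon> J" for l l' m m' j
      using J_inj[OF that] by simp
    \<comment> \<open>Column \<open>b\<close> receives both its own elements and those from column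
      \<open>c\<close>; the latter carry the mark \<open>N\<close>, the former an index that differs
      from \<open>N\<close>.\<close>
    have "d1 = d2 \<and> j1 = j2"
    proof (cases "d1 = c"; cases "d2 = c")
      assume "d1 = c" "d2 = c"
      then show ?thesis using 1(3) 2(3) J_eq by (metis pr_eq)
    next
      assume "d1 = c" "d2 \<noteq> c"
      then obtain j' where "pr (pr j1 N) j' \<epsilon> J" "pr (pr l2 i2) j' \<epsilon> J" using 1(3) 2(2,3) by auto
      then show ?thesis using J_eq N_new by blast
    next
      assume "d1 \<noteq> c" "d2 = c"
      then obtain j' where "pr (pr j2 N) j' \<epsilon> J" "pr (pr l1 i) j' \<epsilon> J" using 2(3) 1(2,3) by auto
      then show ?thesis using J_eq N_new by blast
    next
      assume "d1 \<noteq> c" "d2 \<noteq> c"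
      then show ?thesis using 1(3) 2(3) by simp
    qed
    moreover from this have "l1 = l2 \<and> i = i2" using J_eq 1(2) 2(2) by blast
    ultimately have "p2 = p" "i2 = i" using 1(1) 2(1) by auto
    moreover have "x2 = x'" using functionD(4)[OF t' *(1)] i(2) \<open>i2 = i\<close> by blast
    ultimately have "s2 = s'" using th(5)[OF *(2) s(2)] by blast
    then show "p \<epsilon> s'" using *(3) \<open>p2 = p\<close> by simp
  qed
  have inj: "t = t'" if t: "is_function t N C" and t': "is_function t' N C"
    and eq: "squeeze_code C r t = squeeze_code C r t'" for t t'
  proof (rule function_ext[OF t t'])
    fix i x assume ix: "pr i x \<epsilon> t"
    then obtain x' where ix': "pr i x' \<epsilon> t'"
      using functionD(1)[OF t] functionD(3)[OF t'] by blast
    obtain s where s: "pr x s \<epsilon> embed C r" using embed_total functionD(2)[OF t ix] by blast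
    obtain s' where s': "pr x' s' \<epsilon> embed C r" using embed_total functionD(2)[OF t' ix'] by blast
    have "s = s'"
      by (rule sub_antisym) (rule sub[OF t t' eq ix ix' s s'],
          rule sub[OF t' t eq[symmetric] ix' ix s' s])
    then have "x = x'" using th(5)[OF s s'] by blast
    then show "pr i x \<epsilon> t'" using ix' by simp
  qed
  show ?thesis using that total inj by blast
qed

end

lemma tuple_code_total:
  assumes "wo C r" "\<not> wdf C" "is_function t N C"
  shows "\<exists>x. x \<epsilon> C \<and> tuple_code C r t x"
proof (cases "embed_onto C r")
  case True
  then obtain x where "pr x (graph_code C t) \<epsilon> embed C r"
    using graph_code_fins[OF assms(3)] unfolding embed_onto_def by blast
  then show ?thesis using embedD(1)[OF assms(1)] True unfolding tuple_code_def by blast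
next
  case False
  then show ?thesis
    using squeeze_code_props[OF assms(1,2)] assms(3) unfolding tuple_code_def by metis
qed

lemma tuple_code_mem: "wo C r \<Longrightarrow> tuple_code C r t x \<Longrightarrow> x \<epsilon> C"
  unfolding tuple_code_def using embedD(1) by blast

lemma tuple_code_inj:
  assumes "wo C r" "\<not> wdf C" "is_function t N C" "is_function t' N C"
    "tuple_code C r t x" "tuple_code C r t' x"
  shows "t = t'"
proof (cases "embed_onto C r")
  case True
  then have "graph_code C t = graph_code C t'"
    using assms(5,6) embedD(5)[OF assms(1)] unfolding tuple_code_def by blast
  then show ?thesis by (rule graph_code_inj[OF assms(3,4)])
next
  case False
  then have "squeeze_code C r t = squeeze_code C r t'"
    using assms(5,6) embedD(5)[OF assms(1)] unfolding tuple_code_def by blast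
  then show ?thesis using squeeze_code_props[OF assms(1,2) False] assms(3,4) by metis
qed

end

context ZF
begin

section \<open>The transfinite construction\<close>

definition seg :: "'a \<Rightarrow> 'a \<Rightarrow> 'a \<Rightarrow> 'a" where
  "seg C r x = coll (\<lambda>y. y \<epsilon> C \<and> pr y x \<epsilon> r)"

lemma mem_seg: "y \<epsilon> seg C r x \<longleftrightarrow> y \<epsilon> C \<and> pr y x \<epsilon> r"
  unfolding seg_def by (rule mem_coll_sep) (intro definability)

lemma definable_seg [definability]:
  "definable_term s \<Longrightarrow> definable_term t \<Longrightarrow> definable_term u \<Longrightarrow>
    definable_term (\<lambda>e. seg (s e) (t e) (u e))"
  by (rule definable_term_subst3[where F = seg], unfold seg_def,
      intro definability)

text \<open>\<open>G\<close> takes the relation itself as an argument. After trimming, two orders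
  that agree on a segment are the same set, and so \<open>G\<close> yields the same value.\<close>

definition restr :: "'a \<Rightarrow> 'a \<Rightarrow> 'a" where
  "restr r S = coll (\<lambda>p. p \<epsilon> r \<and> p \<epsilon> cart S S)"

lemma mem_restr: "p \<epsilon> restr r S \<longleftrightarrow> p \<epsilon> r \<and> p \<epsilon> cart S S"
  unfolding restr_def by (rule mem_coll_sep) (intro definability)

lemma definable_restr [definability]:
  "definable_term s \<Longrightarrow> definable_term t \<Longrightarrow> definable_term (\<lambda>e. restr (s e) (t e))"
  by (rule definable_term_subst2[where F = restr], unfold restr_def,
      intro definability)

lemma wo_restr:
  assumes r: "wo C r"
  shows "wo C (restr r C)"
  unfolding wo_def
proof (intro conjI allI impI)
  show "\<not> pr x x \<epsilon> restr r C" if "x \<epsilon> C" for x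
    using wo_irrefl[OF r that] by (simp add: mem_restr)
  show "pr x z \<epsilon> restr r C"
    if "x \<epsilon> C \<and> y \<epsilon> C \<and> z \<epsilon> C \<and> pr x y \<epsilon> restr r C \<and> pr y z \<epsilon> restr r C" for x y z
    using that wo_trans[OF r, of x y z] by (simp add: mem_restr)
  fix s assume s: "is_subset s C \<and> s \<noteq> emp"
  then obtain m where m: "m \<epsilon> s" "\<And>y. y \<epsilon> s \<Longrightarrow> y \<noteq> m \<Longrightarrow> pr m y \<epsilon> r"
    using wo_least_set[OF r] ex_mem by metis
  have "x \<epsilon> C" if "x \<epsilon> s" for x using s that by (simp add: is_subset_def)
  then have "\<forall>y. y \<epsilon> s \<and> y \<noteq> m \<longrightarrow> pr m y \<epsilon> restr r C" using m by (simp add: mem_restr)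
  then show "\<exists>m. m \<epsilon> s \<and> (\<forall>y. y \<epsilon> s \<and> y \<noteq> m \<longrightarrow> pr m y \<epsilon> restr r C)" using m(1) by blast
qed

lemma restr_eqI:
  assumes "\<And>a b. a \<epsilon> S \<Longrightarrow> b \<epsilon> S \<Longrightarrow> pr a b \<epsilon> r \<longleftrightarrow> pr a b \<epsilon> r'"
  shows "restr r S = restr r' S"
proof (rule ext_eq)
  fix p
  show "p \<epsilon> restr r S \<longleftrightarrow> p \<epsilon> restr r' S"
    unfolding mem_restr mem_cart using assms by blast
qed

text \<open>
  Zermelo's argument: the well-orders in which every element is the value of \<open>G\<close> at its
  initial segment are linearly ordered by end extension, and \<open>G\<close> would extend their union.
\<close>

lemma no_next_element:
  assumes G: "definable (\<lambda>e. G (e 0) (e (Suc 0)) (e (Suc (Suc 0))))"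
    and ex: "\<And>C r. is_subset C X \<Longrightarrow> wo C r \<Longrightarrow> \<exists>x. x \<epsilon> X \<and> \<not> x \<epsilon> C \<and> G C r x"
    and uniq: "\<And>C r x y. is_subset C X \<Longrightarrow> wo C r \<Longrightarrow> G C r x \<Longrightarrow> G C r y \<Longrightarrow> x = y"
  shows False
proof -
  note [definability] = definable_subst3[OF G]
  define good where "good C r \<longleftrightarrow> is_subset C X \<and> wo C r \<and> is_subset r (cart C C) \<and>
    (\<forall>x. x \<epsilon> C \<longrightarrow> G (seg C r x) (restr r (seg C r x)) x)" for C r
  have [definability]: "definable_term s \<Longrightarrow> definable_term t \<Longrightarrow>
      definable (\<lambda>e. good (s e) (t e))" for s t
    by (rule definable_subst2[where R = good], unfold good_def, intro definability)
  have goodD: "is_subset C X" "wo C r" "\<And>x y. pr x y \<epsilon> r \<Longrightarrow> x \<epsilon> C \<and> y \<epsilon> C"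
    "\<And>p. p \<epsilon> r \<Longrightarrow> p \<epsilon> cart C C"
    "\<And>x. x \<epsilon> C \<Longrightarrow> G (seg C r x) (restr r (seg C r x)) x" if "good C r" for C r
  proof -
    have *: "is_subset C X" "wo C r" "is_subset r (cart C C)"
      "\<forall>x. x \<epsilon> C \<longrightarrow> G (seg C r x) (restr r (seg C r x)) x"
      using that unfolding good_def by blast+
    show "is_subset C X" "wo C r" by fact+
    show "\<And>x. x \<epsilon> C \<Longrightarrow> G (seg C r x) (restr r (seg C r x)) x" using *(4) by blast
    show "\<And>p. p \<epsilon> r \<Longrightarrow> p \<epsilon> cart C C" using *(3) by (auto simp: is_subset_def)
    then show "\<And>x y. pr x y \<epsilon> r \<Longrightarrow> x \<epsilon> C \<and> y \<epsilon> C" using pr_mem_cart by blast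
  qed
  have coherent: "(\<forall>x. x \<epsilon> C \<longrightarrow> x \<epsilon> C' \<and> seg C r x = seg C' r' x \<and>
        restr r (seg C r x) = restr r' (seg C' r' x)) \<or>
      (\<forall>x. x \<epsilon> C' \<longrightarrow> x \<epsilon> C \<and> seg C r x = seg C' r' x \<and>
        restr r (seg C r x) = restr r' (seg C' r' x))"
    if g: "good C r" and g': "good C' r'" for C r C' r'
  proof (rule ccontr)
    assume neither: "\<not> ?thesis"
    \<comment> \<open>\<open>I\<close> is the common initial part. If it is proper on both sides,
      the first elements missing from it are both the value of \<open>G\<close> at \<open>I\<close>,
      so they coincide and belong to \<open>I\<close>.\<close>
    obtain I where I: "\<And>x. x \<epsilon> I \<longleftrightarrow> x \<epsilon> C \<and> (x \<epsilon> C' \<and> seg C r x = seg C' r' x \<and>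
        restr r (seg C r x) = restr r' (seg C' r' x))"
      by (atomize_elim, rule separation_definable) (intro definability)
    have order: "pr y z \<epsilon> r \<longleftrightarrow> pr y z \<epsilon> r'" if "x \<epsilon> I" "y \<epsilon> seg C r x" "z \<epsilon> seg C r x" for x y z
    proof -
      have "pr y z \<epsilon> restr r (seg C r x) \<longleftrightarrow> pr y z \<epsilon> restr r' (seg C r x)" using that I by metis
      then show ?thesis using that by (simp add: mem_restr)
    qed
    have down: "y \<epsilon> I" if x: "x \<epsilon> I" and y: "y \<epsilon> seg C r x" for x y
    proof -
      have yC: "y \<epsilon> C" "y \<epsilon> C'" "pr y x \<epsilon> r" "pr y x \<epsilon> r'" "x \<epsilon> C" "x \<epsilon> C'"
        using x y unfolding I mem_seg by (metis mem_seg)+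
      have sub: "z \<epsilon> seg C r x" if "z \<epsilon> seg C r y" for z
        using that wo_trans[OF goodD(2)[OF g] _ yC(1,5) _ yC(3)] unfolding mem_seg by blast
      have sub': "z \<epsilon> seg C r x" if "z \<epsilon> seg C' r' y" for z
      proof -
        have "z \<epsilon> seg C' r' x"
          using that wo_trans[OF goodD(2)[OF g'] _ yC(2,6) _ yC(4)] unfolding mem_seg by blast
        then show ?thesis using x I by simp
      qed
      have mem: "z \<epsilon> seg C r y \<longleftrightarrow> z \<epsilon> seg C' r' y" if "z \<epsilon> seg C r x" for z
        using order[OF x that y] that goodD(3)[OF g] goodD(3)[OF g'] unfolding mem_seg by blast
      have eq: "seg C r y = seg C' r' y"
        by (rule ext_eq) (use sub sub' mem in blast)
      have "restr r (seg C r y) = restr r' (seg C r y)"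
        by (rule restr_eqI) (use order[OF x] sub in blast)
      then show ?thesis using yC eq unfolding I by simp
    qed
    have seg_I: "\<exists>x. x \<epsilon> D \<and> \<not> x \<epsilon> I \<and> seg D s x = I"
      if s: "good D s" and IC: "\<And>x. x \<epsilon> I \<Longrightarrow> x \<epsilon> D"
        and dn: "\<And>x y. x \<epsilon> I \<Longrightarrow> y \<epsilon> seg D s x \<Longrightarrow> y \<epsilon> I"
        and new: "\<exists>x. x \<epsilon> D \<and> \<not> x \<epsilon> I" for D s
    proof -
      have D: "wo D s" using goodD(2)[OF s] .
      have "definable (\<lambda>e. \<not> e 0 \<epsilon> I)" by (intro definability)
      then obtain x where x: "x \<epsilon> D" "\<not> x \<epsilon> I"
        and least: "\<And>y. y \<epsilon> D \<Longrightarrow> \<not> y \<epsilon> I \<Longrightarrow> y \<noteq> x \<Longrightarrow> pr x y \<epsilon> s"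
        using wo_least[OF D, of "\<lambda>x. \<not> x \<epsilon> I"] new by blast
      have "seg D s x = I"
      proof (rule ext_eq)
        fix y
        show "y \<epsilon> seg D s x \<longleftrightarrow> y \<epsilon> I"
        proof
          assume "y \<epsilon> seg D s x"
          then have y: "y \<epsilon> D" "pr y x \<epsilon> s" unfolding mem_seg by blast+
          show "y \<epsilon> I"
          proof (rule ccontr)
            assume "\<not> y \<epsilon> I"
            moreover have "y \<noteq> x" using y wo_irrefl[OF D] by blast
            ultimately show False using least[OF y(1)] wo_asym[OF D y(1) x(1) y(2)] by blast
          qed
        next
          assume y: "y \<epsilon> I"
          have "\<not> pr x y \<epsilon> s" using dn[OF y, of x] x unfolding mem_seg by blast
          moreover have "y \<noteq> x" using y x by blast
          ultimately show "y \<epsilon> seg D s x"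
            using wo_linear[OF D IC[OF y] x(1)] IC[OF y] unfolding mem_seg by blast
        qed
      qed
      then show ?thesis using x by blast
    qed
    have "\<exists>x. x \<epsilon> C \<and> \<not> x \<epsilon> I \<and> seg C r x = I"
      by (rule seg_I[OF g]) (use I down neither in blast)+
    then obtain x where x: "x \<epsilon> C" "\<not> x \<epsilon> I" "seg C r x = I" by blast
    have "\<exists>x. x \<epsilon> C' \<and> \<not> x \<epsilon> I \<and> seg C' r' x = I"
    proof (rule seg_I[OF g'])
      show "y \<epsilon> I" if "x \<epsilon> I" "y \<epsilon> seg C' r' x" for x y
      proof (rule down[OF that(1)])
        have "seg C r x = seg C' r' x" using that(1) unfolding I by blast
        then show "y \<epsilon> seg C r x" using that(2) by simp
      qed
    qed (use I neither in blast)+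
    then obtain x' where x': "x' \<epsilon> C'" "\<not> x' \<epsilon> I" "seg C' r' x' = I" by blast
    have "pr a b \<epsilon> r \<longleftrightarrow> pr a b \<epsilon> r'" if "a \<epsilon> I" "b \<epsilon> I" for a b
      using that I[of b] I[of a] mem_seg[of a] by metis
    then have restr_I: "restr r I = restr r' I" by (rule restr_eqI)
    have "G I (restr r I) x" using goodD(5)[OF g x(1)] x(3) by simp
    moreover have "G I (restr r I) x'" using goodD(5)[OF g' x'(1)] x'(3) restr_I by simp
    moreover have "is_subset I X" using goodD(1)[OF g] I by (auto simp: is_subset_def)
    moreover have "wo I (restr r I)"
      by (rule wo_restr, rule wo_subset[OF goodD(2)[OF g]]) (auto simp: is_subset_def I)
    ultimately have "x = x'" using uniq by blast
    then show False using x x' restr_I I by metis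
  qed
  define U where "U = coll (\<lambda>x. x \<epsilon> X \<and> (\<exists>C r. good C r \<and> x \<epsilon> C))"
  have U: "x \<epsilon> U \<longleftrightarrow> (\<exists>C r. good C r \<and> x \<epsilon> C)" for x
  proof -
    have "x \<epsilon> U \<longleftrightarrow> x \<epsilon> X \<and> (\<exists>C r. good C r \<and> x \<epsilon> C)"
      unfolding U_def by (rule mem_coll_sep) (intro definability)
    then show ?thesis using goodD(1) unfolding is_subset_def by blast
  qed
  define R where "R = coll (\<lambda>p. p \<epsilon> cart U U \<and> (\<exists>C r. good C r \<and> p \<epsilon> r))"
  have R: "pr x y \<epsilon> R \<longleftrightarrow> (\<exists>C r. good C r \<and> pr x y \<epsilon> r)" for x y
  proof -
    have "pr x y \<epsilon> R \<longleftrightarrow> pr x y \<epsilon> cart U U \<and> (\<exists>C r. good C r \<and> pr x y \<epsilon> r)"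
      unfolding R_def by (rule mem_coll_sep) (intro definability)
    then show ?thesis using goodD(3) unfolding pr_mem_cart U by blast
  qed
  have R_sub: "is_subset R (cart U U)"
    unfolding is_subset_def R_def by (subst mem_coll_sep) (intro definability, blast)
  \<comment> \<open>By coherence, a good order that contains \<open>x\<close> already contains all
    predecessors of \<open>x\<close> in the union. This reduces the order \<open>R\<close> to a
    single good order.\<close>
  have R_iff: "pr y x \<epsilon> R \<longleftrightarrow> pr y x \<epsilon> r" if g: "good C r" and x: "x \<epsilon> C" for C r x y
  proof
    assume "pr y x \<epsilon> R"
    then obtain C' r' where g': "good C' r'" "pr y x \<epsilon> r'" unfolding R by blast
    then have "y \<epsilon> C'" "x \<epsilon> C'" using goodD(3) by blast+
    then have "y \<epsilon> seg C' r' x" using g' by (simp add: mem_seg)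
    then have "y \<epsilon> seg C r x" using coherent[OF g g'(1)] x \<open>x \<epsilon> C'\<close> by metis
    then show "pr y x \<epsilon> r" by (simp add: mem_seg)
  qed (use g R in blast)
  have U_sub: "C \<noteq> C' \<Longrightarrow> y \<epsilon> C' \<Longrightarrow> \<not> y \<epsilon> C \<Longrightarrow> x \<epsilon> C \<Longrightarrow> x \<epsilon> C'"
    if "good C r" "good C' r'" for C r C' r' x y
    using coherent[OF that] by blast
  have wo_U: "wo U R"
    unfolding wo_def
  proof (intro conjI allI impI)
    fix x assume "x \<epsilon> U"
    then obtain C r where "good C r" "x \<epsilon> C" unfolding U by blast
    then show "\<not> pr x x \<epsilon> R" using R_iff wo_irrefl goodD(2) by blast
  next
    fix x y z assume *: "x \<epsilon> U \<and> y \<epsilon> U \<and> z \<epsilon> U \<and> pr x y \<epsilon> R \<and> pr y z \<epsilon> R"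
    then obtain C r where g: "good C r" "z \<epsilon> C" unfolding U by blast
    have yz: "pr y z \<epsilon> r" using R_iff[OF g] * by blast
    then have y: "y \<epsilon> C" using goodD(3)[OF g(1)] by blast
    have xy: "pr x y \<epsilon> r" using R_iff[OF g(1) y] * by blast
    then have x: "x \<epsilon> C" using goodD(3)[OF g(1)] by blast
    show "pr x z \<epsilon> R" using wo_trans[OF goodD(2)[OF g(1)] x y g(2) xy yz] R_iff[OF g] by blast
  next
    fix s assume s: "is_subset s U \<and> s \<noteq> emp"
    then obtain a where a: "a \<epsilon> s" using ex_mem by blast
    then obtain C r where g: "good C r" "a \<epsilon> C" using s unfolding is_subset_def U by blast
    have "definable (\<lambda>e. e 0 \<epsilon> s)" by (intro definability)
    then obtain m where m: "m \<epsilon> C" "m \<epsilon> s"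
      and least: "\<And>y. y \<epsilon> C \<Longrightarrow> y \<epsilon> s \<Longrightarrow> y \<noteq> m \<Longrightarrow> pr m y \<epsilon> r"
      using wo_least[OF goodD(2)[OF g(1)], of "\<lambda>x. x \<epsilon> s"] g(2) a by blast
    have "pr m y \<epsilon> R" if y: "y \<epsilon> s" "y \<noteq> m" for y
    proof (cases "y \<epsilon> C")
      case True
      then show ?thesis using least y R_iff[OF g(1)] by blast
    next
      case False
      obtain C' r' where g': "good C' r'" "y \<epsilon> C'" using y s unfolding is_subset_def U by blast
      have m': "m \<epsilon> C'" using U_sub[OF g(1) g'(1)] g'(2) False m(1) by blast
      have "\<not> pr y m \<epsilon> r'"
        using R_iff[OF g'(1) m'] R_iff[OF g(1) m(1)] goodD(3)[OF g(1)] False by blast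
      then have "pr m y \<epsilon> r'" using wo_linear[OF goodD(2)[OF g'(1)] m' g'(2)] y(2) by blast
      then show ?thesis using R_iff[OF g'] by blast
    qed
    then show "\<exists>m. m \<epsilon> s \<and> (\<forall>y. y \<epsilon> s \<and> y \<noteq> m \<longrightarrow> pr m y \<epsilon> R)" using m(2) by blast
  qed
  have UX: "is_subset U X" using goodD(1) unfolding is_subset_def U by blast
  have GU: "G (seg U R x) (restr R (seg U R x)) x" if xU: "x \<epsilon> U" for x
  proof -
    obtain C r where g: "good C r" "x \<epsilon> C" using xU unfolding U by blast
    have seg_eq: "seg U R x = seg C r x"
    proof (rule ext_eq)
      show "y \<epsilon> seg U R x \<longleftrightarrow> y \<epsilon> seg C r x" for y
        unfolding mem_seg R_iff[OF g] using goodD(3)[OF g(1)] U g(1) by blast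
    qed
    have "restr R (seg C r x) = restr r (seg C r x)"
      by (rule restr_eqI) (use R_iff[OF g(1)] in \<open>auto simp: mem_seg\<close>)
    then show ?thesis using goodD(5)[OF g] seg_eq by simp
  qed
  obtain x where x: "x \<epsilon> X" "\<not> x \<epsilon> U" "G U R x" using ex[OF UX wo_U] by blast
  \<comment> \<open>The new element \<open>x\<close> is placed above all of
    \<open>U\<close>.\<close>
  define R' where "R' = coll (\<lambda>p.
    p \<epsilon> cart (ins x U) (ins x U) \<and> (p \<epsilon> R \<or> (\<exists>y. y \<epsilon> U \<and> p = pr y x)))"
  have R'_mem: "p \<epsilon> R' \<longleftrightarrow> p \<epsilon> cart (ins x U) (ins x U) \<and> (p \<epsilon> R \<or> (\<exists>y. y \<epsilon> U \<and> p = pr y x))" for p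
    unfolding R'_def by (rule mem_coll_sep) (intro definability)
  have RU: "y \<epsilon> U" "z \<epsilon> U" if "pr y z \<epsilon> R" for y z
    using that R_sub unfolding is_subset_def by (metis pr_mem_cart)+
  have R': "pr y z \<epsilon> R' \<longleftrightarrow> pr y z \<epsilon> R \<or> y \<epsilon> U \<and> z = x" for y z
    unfolding R'_mem using RU by auto
  have "wo (ins x U) R'"
    unfolding wo_def mem_ins R'
  proof (intro conjI allI impI)
    fix y assume "y = x \<or> y \<epsilon> U"
    then show "\<not> (pr y y \<epsilon> R \<or> y \<epsilon> U \<and> y = x)" using x(2) RU wo_irrefl[OF wo_U] by blast
  next
    fix a b c
    assume "(a = x \<or> a \<epsilon> U) \<and> (b = x \<or> b \<epsilon> U) \<and> (c = x \<or> c \<epsilon> U) \<and>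
      (pr a b \<epsilon> R \<or> a \<epsilon> U \<and> b = x) \<and> (pr b c \<epsilon> R \<or> b \<epsilon> U \<and> c = x)"
    then show "pr a c \<epsilon> R \<or> a \<epsilon> U \<and> c = x"
      using RU x(2) wo_trans[OF wo_U, of a b c] by blast
  next
    fix s assume s: "is_subset s (ins x U) \<and> s \<noteq> emp"
    show "\<exists>m. m \<epsilon> s \<and> (\<forall>y. y \<epsilon> s \<and> y \<noteq> m \<longrightarrow> pr m y \<epsilon> R \<or> m \<epsilon> U \<and> y = x)"
    proof (cases "\<exists>y. y \<epsilon> s \<and> y \<epsilon> U")
      case True
      have "definable (\<lambda>e. e 0 \<epsilon> s)" by (intro definability)
      then obtain m where "m \<epsilon> U" "m \<epsilon> s"
        "\<And>y. y \<epsilon> U \<Longrightarrow> y \<epsilon> s \<Longrightarrow> y \<noteq> m \<Longrightarrow> pr m y \<epsilon> R"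
        using wo_least[OF wo_U, of "\<lambda>x. x \<epsilon> s"] True by blast
      then show ?thesis using s unfolding is_subset_def mem_ins by blast
    next
      case False
      then have "y = x" if "y \<epsilon> s" for y using s that unfolding is_subset_def mem_ins by blast
      then show ?thesis using s ex_mem by metis
    qed
  qed
  moreover have "is_subset (ins x U) X" using UX x(1) by (auto simp: is_subset_def)
  moreover have "is_subset R' (cart (ins x U) (ins x U))"
    unfolding is_subset_def R'_mem by blast
  moreover have "G (seg (ins x U) R' y) (restr R' (seg (ins x U) R' y)) y" if "y \<epsilon> ins x U" for y
  proof (cases "y = x")
    case True
    have seg_eq: "seg (ins x U) R' x = U"
      by (rule ext_eq) (use RU x(2) in \<open>auto simp: mem_seg R'\<close>)
    have "restr R' U = R"
    proof (rule ext_eq)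
      show "p \<epsilon> restr R' U \<longleftrightarrow> p \<epsilon> R" for p
        using R_sub x(2) unfolding mem_restr R'_mem mem_cart is_subset_def by auto
    qed
    then show ?thesis using x(3) seg_eq True by simp
  next
    case False
    then have y: "y \<epsilon> U" using that by simp
    have seg_eq: "seg (ins x U) R' y = seg U R y"
      by (rule ext_eq) (use RU False in \<open>auto simp: mem_seg R'\<close>)
    have "restr R' (seg U R y) = restr R (seg U R y)"
      by (rule restr_eqI) (use x(2) in \<open>auto simp: mem_seg R'\<close>)
    then show ?thesis using GU[OF y] seg_eq by simp
  qed
  ultimately have "good (ins x U) R'" unfolding good_def by blast
  then have "x \<epsilon> U" unfolding U using mem_ins by blast
  then show False using x(2) by blast
qed

end

section \<open>Maps from a power set to tuples, with weakly Dedekind finite fibres\<close>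

locale ZF_power_map = ZF +
  fixes X n g
  assumes X_inf: "\<not> is_finite X"
    and n: "n \<epsilon> om"
    and g: "is_function g (pow X) (funs n X)"
    and fibre: "u \<epsilon> funs n X \<Longrightarrow> wdf (coll (\<lambda>Z. Z \<epsilon> pow X \<and> pr Z u \<epsilon> g))"
begin

lemma mem_fibre: "Z \<epsilon> coll (\<lambda>Z. Z \<epsilon> pow X \<and> pr Z u \<epsilon> g) \<longleftrightarrow> Z \<epsilon> pow X \<and> pr Z u \<epsilon> g"
  by (rule mem_coll_sep) (intro definability)

lemma function_mono: "is_function u n C \<Longrightarrow> is_subset C X \<Longrightarrow> is_function u n X"
  unfolding is_function_iff is_subset_def by blast

text \<open>The values run through \<open>C^n\<close>, which is weakly Dedekind finite together with
  \<open>C\<close>, and so are the fibres of \<open>g\<close>.\<close>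

lemma wdf_preimage:
  assumes C: "is_subset C X" "wdf C"
    and P: "\<And>Z. Z \<epsilon> P \<Longrightarrow> Z \<epsilon> pow X \<and> (\<exists>u. pr Z u \<epsilon> g \<and> is_function u n C)"
  shows "wdf P"
proof (rule wdf_fibres[OF wdf_funs[OF n C(2)], where R = "\<lambda>u Z. pr Z u \<epsilon> g"])
  show "definable (\<lambda>e. pr (e (Suc 0)) (e 0) \<epsilon> g)" by (intro definability)
  show "\<exists>F. wdf F \<and> (\<forall>Z. Z \<epsilon> P \<and> pr Z u \<epsilon> g \<longrightarrow> Z \<epsilon> F)" if "u \<epsilon> funs n C" for u
    using fibre[of u] mem_fibre[of _ u] P that function_mono[OF _ C(1)] unfolding mem_funs by blast
  show "\<exists>u. u \<epsilon> funs n C \<and> pr Z u \<epsilon> g" if "Z \<epsilon> P" for Z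
    using P[OF that] unfolding mem_funs by blast
qed

lemma not_wdf_X: "\<not> wdf X"
proof
  assume X: "wdf X"
  have "wdf (pow X)"
  proof (rule wdf_preimage[OF _ X])
    show "is_subset X X" by (simp add: is_subset_def)
    show "Z \<epsilon> pow X \<and> (\<exists>u. pr Z u \<epsilon> g \<and> is_function u n X)" if "Z \<epsilon> pow X" for Z
      using that functionD(2,3)[OF g] unfolding mem_funs by blast
  qed
  then show False using not_wdf_pow_infinite X_inf by blast
qed

end

text \<open>The coded tuples have length \<open>n + 1\<close>: a value \<open>u\<close> of
  \<open>g\<close> followed by an element of \<open>C\<close> that indexes the block of
  \<open>u\<close>. The relation \<open>S\<close> is an unbounded sequence of sublevel sets, a
  witness that \<open>X\<close> is not weakly Dedekind finite.\<close>

locale ZF_diagonal = ZF_power_map mem X n g + ZF_coding mem "ZF.ins mem n n" J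
  for mem :: "'a \<Rightarrow> 'a \<Rightarrow> bool" (infix "\<epsilon>" 50) and X n g J +
  fixes S
  assumes S_cover: "x \<epsilon> X \<Longrightarrow> \<exists>m. m \<epsilon> om \<and> pr m x \<epsilon> S"
    and S_mono: "m \<epsilon> m' \<Longrightarrow> m' \<epsilon> om \<Longrightarrow> x \<epsilon> X \<Longrightarrow> pr m x \<epsilon> S \<Longrightarrow> pr m' x \<epsilon> S"
    and S_proper: "m \<epsilon> om \<Longrightarrow> \<exists>x. x \<epsilon> X \<and> \<not> pr m x \<epsilon> S"
begin

definition tail :: "'a \<Rightarrow> 'a" where
  "tail m = coll (\<lambda>x. x \<epsilon> X \<and> \<not> pr m x \<epsilon> S)"

lemma mem_tail: "x \<epsilon> tail m \<longleftrightarrow> x \<epsilon> X \<and> \<not> pr m x \<epsilon> S"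
  unfolding tail_def by (rule mem_coll_sep) (intro definability)

lemma definable_tail [definability]:
  "definable_term s \<Longrightarrow> definable_term (\<lambda>e. tail (s e))"
  by (rule definable_term_subst1[where F = tail], unfold tail_def,
      intro definability)

lemma tail_pow: "tail m \<epsilon> pow X"
  by (simp add: is_subset_def mem_tail)

lemma g_value: "Z \<epsilon> pow X \<Longrightarrow> \<exists>u. pr Z u \<epsilon> g"
  using functionD(3)[OF g] by blast

lemma g_fun: "pr Z u \<epsilon> g \<Longrightarrow> pr Z u' \<epsilon> g \<Longrightarrow> u = u'"
  using functionD(4)[OF g] by blast

lemma g_range: "pr Z u \<epsilon> g \<Longrightarrow> is_function u n X"
  using functionD(2)[OF g] unfolding mem_funs by blast

text \<open>The sets with values in \<open>C^n\<close> form a weakly Dedekind finite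
  \<open>P\<close>. Sending a nonempty \<open>Z\<close> to the first \<open>m\<close> with
  \<open>Z\<close> not inside \<open>tail m\<close> would be unbounded on \<open>P\<close> if all
  tails were in \<open>P\<close>.\<close>

lemma tail_escapes:
  assumes C: "is_subset C X" "wdf C"
  shows "\<exists>m. m \<epsilon> om \<and> (\<exists>u. pr (tail m) u \<epsilon> g \<and> \<not> is_function u n C)"
proof (rule ccontr)
  assume stay: "\<not> ?thesis"
  obtain P where P: "\<And>Z. Z \<epsilon> P \<longleftrightarrow> Z \<epsilon> pow X \<and> (\<exists>u. pr Z u \<epsilon> g \<and> is_function u n C)"
    by (atomize_elim, rule separation_definable) (intro definability)
  have "wdf P" by (rule wdf_preimage[OF C]) (use P in blast)
  then have "\<exists>m. m \<epsilon> om \<and> (\<forall>Z. Z \<epsilon> P \<longrightarrow> Z = emp \<or> \<not> is_subset Z (tail m))"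
  proof (rule wdfD[where R = "\<lambda>m Z. Z = emp \<or> \<not> is_subset Z (tail m)"])
    show "definable (\<lambda>e. e (Suc 0) = emp \<or> \<not> is_subset (e (Suc 0)) (tail (e 0)))"
      by (intro definability)
    show "\<exists>m. m \<epsilon> om \<and> (Z = emp \<or> \<not> is_subset Z (tail m))" if "Z \<epsilon> P" for Z
    proof (cases "Z = emp")
      case True
      then show ?thesis using emp_om by blast
    next
      case False
      then obtain x where x: "x \<epsilon> Z" using ex_mem by blast
      then have "x \<epsilon> X" using \<open>Z \<epsilon> P\<close> unfolding P mem_pow is_subset_def by blast
      then obtain m where "m \<epsilon> om" "pr m x \<epsilon> S" using S_cover by blast
      then show ?thesis using x unfolding is_subset_def mem_tail by blast
    qed
    show "Z = emp \<or> \<not> is_subset Z (tail m')"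
      if "m \<epsilon> m'" "m' \<epsilon> om" "Z = emp \<or> \<not> is_subset Z (tail m)" for m m' Z
      using that S_mono[OF that(1,2)] unfolding is_subset_def mem_tail by blast
  qed
  then obtain m where m: "m \<epsilon> om" "\<And>Z. Z \<epsilon> P \<Longrightarrow> Z = emp \<or> \<not> is_subset Z (tail m)" by blast
  have "tail m \<epsilon> P" unfolding P using tail_pow g_value[OF tail_pow] stay m(1) by blast
  moreover have "tail m \<noteq> emp" using S_proper[OF m(1)] mem_tail not_mem_emp by metis
  ultimately show False using m(2) unfolding is_subset_def by blast
qed

text \<open>
  For \<open>u \<in> C\<^sup>n\<close>, the values of \<open>tuple_code C r\<close> at the extensions of \<open>u\<close> by elements of \<open>C\<close> form a
  block of \<open>C\<close>; \<open>avoids C r u y\<close> says that no set with value \<open>u\<close> meets this block exactly in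
  the value at \<open>y\<close>.
\<close>

definition avoids :: "'a \<Rightarrow> 'a \<Rightarrow> 'a \<Rightarrow> 'a \<Rightarrow> bool" where
  "avoids C r u y \<longleftrightarrow> (\<forall>Z. Z \<epsilon> pow X \<and> pr Z u \<epsilon> g \<longrightarrow>
    \<not> (\<forall>c. (\<exists>y'. y' \<epsilon> C \<and> tuple_code C r (ins (pr n y') u) c) \<longrightarrow>
      (c \<epsilon> Z \<longleftrightarrow> tuple_code C r (ins (pr n y) u) c)))"

lemma definable_avoids [definability]:
  "definable_term s \<Longrightarrow> definable_term t \<Longrightarrow> definable_term u \<Longrightarrow> definable_term v \<Longrightarrow>
    definable (\<lambda>e. avoids (s e) (t e) (u e) (v e))"
  by (rule definable_subst4[where R = avoids], unfold avoids_def,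
      intro definability)

text \<open>From the block of each \<open>u\<close> exactly one point is taken, the one given by the
  least \<open>y\<close> that avoids all sets with value \<open>u\<close>.\<close>

definition diag :: "'a \<Rightarrow> 'a \<Rightarrow> 'a" where
  "diag C r = coll (\<lambda>c. c \<epsilon> C \<and> (\<exists>u y. u \<epsilon> funs n C \<and> y \<epsilon> C \<and> tuple_code C r (ins (pr n y) u) c \<and>
    avoids C r u y \<and> (\<forall>y'. y' \<epsilon> C \<and> avoids C r u y' \<and> y' \<noteq> y \<longrightarrow> pr y y' \<epsilon> r)))"

lemma definable_diag [definability]:
  "definable_term s \<Longrightarrow> definable_term t \<Longrightarrow> definable_term (\<lambda>e. diag (s e) (t e))"
  by (rule definable_term_subst2[where F = diag], unfold diag_def,
      intro definability)

lemma mem_diag: "c \<epsilon> diag C r \<longleftrightarrow> c \<epsilon> C \<and> (\<exists>u y. u \<epsilon> funs n C \<and> y \<epsilon> C \<and>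
    tuple_code C r (ins (pr n y) u) c \<and> avoids C r u y \<and>
    (\<forall>y'. y' \<epsilon> C \<and> avoids C r u y' \<and> y' \<noteq> y \<longrightarrow> pr y y' \<epsilon> r))"
  unfolding diag_def by (rule mem_coll_sep) (intro definability)

lemma diag_escapes:
  assumes C: "is_subset C X" "wo C r" "\<not> wdf C" and D: "pr (diag C r) u \<epsilon> g"
  shows "\<not> is_function u n C"
proof
  assume u: "is_function u n C"
  have K_inj: "v = w \<and> y = z" if "is_function v n C" "y \<epsilon> C" "is_function w n C" "z \<epsilon> C"
    "tuple_code C r (ins (pr n y) v) c" "tuple_code C r (ins (pr n z) w) c" for v w y z c
    using tuple_code_inj[OF C(2,3) function_suc[OF that(1,2)] function_suc[OF that(3,4)] that(5,6)]
      function_suc_inj[OF that(1,3)] by blast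
  have K_ex: "\<exists>c. tuple_code C r (ins (pr n y) u) c" if "y \<epsilon> C" for y
    using tuple_code_total[OF C(2,3) function_suc[OF u that]] by blast
  \<comment> \<open>A set with value \<open>u\<close> meets the block in a single prescribed point
    for at most one \<open>y\<close>. If no \<open>y\<close> avoided all these sets,
    \<open>C\<close> would be an image of part of the fibre over \<open>u\<close>.\<close>
  have ex: "\<exists>y. y \<epsilon> C \<and> avoids C r u y"
  proof (rule ccontr)
    assume none: "\<not> ?thesis"
    let ?R = "\<lambda>Z y. \<forall>c. (\<exists>y'. y' \<epsilon> C \<and> tuple_code C r (ins (pr n y') u) c) \<longrightarrow>
      (c \<epsilon> Z \<longleftrightarrow> tuple_code C r (ins (pr n y) u) c)"
    have "u \<epsilon> funs n X" using function_mono[OF u C(1)] by simp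
    from fibre[OF this] have "wdf C"
    proof (rule wdf_image[where R = ?R])
      show "definable (\<lambda>e. ?R (e 0) (e (Suc 0)))" by (intro definability)
      show "\<exists>Z. Z \<epsilon> coll (\<lambda>Z. Z \<epsilon> pow X \<and> pr Z u \<epsilon> g) \<and> ?R Z y" if "y \<epsilon> C" for y
        using none that unfolding mem_fibre avoids_def by blast
      show "y = y'" if y: "y \<epsilon> C" "y' \<epsilon> C" and R: "?R Z y" "?R Z y'" for Z y y'
      proof -
        obtain c where c: "tuple_code C r (ins (pr n y) u) c" using K_ex[OF y(1)] by blast
        then have "tuple_code C r (ins (pr n y') u) c" using R y(1) by blast
        then show ?thesis using K_inj[OF u y(1) u y(2) c] by blast
      qed
    qed
    then show False using C(3) by blast
  qed
  have "definable (\<lambda>e. avoids C r u (e 0))" by (intro definability)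
  then obtain y where y: "y \<epsilon> C" "avoids C r u y"
    and least: "\<And>y'. y' \<epsilon> C \<Longrightarrow> avoids C r u y' \<Longrightarrow> y' \<noteq> y \<Longrightarrow> pr y y' \<epsilon> r"
    using wo_least[OF C(2), of "avoids C r u"] ex by blast
  have "diag C r \<epsilon> pow X" using C(1) by (simp add: is_subset_def mem_diag)
  moreover have "c \<epsilon> diag C r \<longleftrightarrow> tuple_code C r (ins (pr n y) u) c"
    if c: "y' \<epsilon> C" "tuple_code C r (ins (pr n y') u) c" for c y'
  proof
    assume "tuple_code C r (ins (pr n y) u) c"
    then show "c \<epsilon> diag C r"
      unfolding mem_diag mem_funs using tuple_code_mem[OF C(2)] u y least by blast
  next
    assume "c \<epsilon> diag C r"
    then obtain v z where v: "is_function v n C" "z \<epsilon> C" "tuple_code C r (ins (pr n z) v) c"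
      "avoids C r v z" "\<And>y'. y' \<epsilon> C \<Longrightarrow> avoids C r v y' \<Longrightarrow> y' \<noteq> z \<Longrightarrow> pr z y' \<epsilon> r"
      unfolding mem_diag mem_funs by blast
    \<comment> \<open>Blocks of different tuples are disjoint, so nothing that \<open>diag\<close>
      takes for another tuple falls into the block of \<open>u\<close>.\<close>
    have "v = u" using K_inj[OF v(1,2) u c(1) v(3) c(2)] by blast
    then have "z = y" using v(2,4,5) y least wo_asym[OF C(2) v(2) y(1)] by blast
    then show "tuple_code C r (ins (pr n y) u) c" using v(3) \<open>v = u\<close> by simp
  qed
  ultimately show False using y(2) D unfolding avoids_def by blast
qed

text \<open>Taking the least index of an escaping tail makes the set unique, as the recursion
  requires.\<close>

definition test_set :: "'a \<Rightarrow> 'a \<Rightarrow> 'a \<Rightarrow> bool" where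
  "test_set C r Z \<longleftrightarrow> (wdf C \<and> (\<exists>m. m \<epsilon> om \<and> Z = tail m \<and> (\<exists>u. pr Z u \<epsilon> g \<and> \<not> is_function u n C) \<and>
      (\<forall>k. k \<epsilon> m \<longrightarrow> \<not> (\<exists>u. pr (tail k) u \<epsilon> g \<and> \<not> is_function u n C)))) \<or>
    (\<not> wdf C \<and> Z = diag C r)"

lemma definable_test_set [definability]:
  "definable_term s \<Longrightarrow> definable_term t \<Longrightarrow> definable_term u \<Longrightarrow>
    definable (\<lambda>e. test_set (s e) (t e) (u e))"
  by (rule definable_subst3[where R = test_set], unfold test_set_def, intro definability)

lemma test_set_ex:
  assumes C: "is_subset C X" "wo C r"
  shows "\<exists>Z u. test_set C r Z \<and> pr Z u \<epsilon> g \<and> \<not> is_function u n C"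
proof (cases "wdf C")
  case True
  define Q where "Q m \<longleftrightarrow> (\<exists>u. pr (tail m) u \<epsilon> g \<and> \<not> is_function u n C)" for m
  have "definable (\<lambda>e. Q (e 0))" unfolding Q_def by (intro definability)
  moreover obtain m where "m \<epsilon> om" "Q m" using tail_escapes[OF C(1) True] unfolding Q_def by blast
  ultimately obtain m where "m \<epsilon> om" "Q m" "\<And>k. k \<epsilon> m \<Longrightarrow> \<not> Q k"
    using om_least[of Q] by blast
  then have "test_set C r (tail m)" "Q m" unfolding test_set_def Q_def using True by blast+
  then show ?thesis unfolding Q_def by blast
next
  case False
  have "diag C r \<epsilon> pow X" using C(1) by (simp add: is_subset_def mem_diag)
  then obtain u where "pr (diag C r) u \<epsilon> g" using g_value by blast
  then show ?thesis using diag_escapes[OF C False] False unfolding test_set_def by blast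
qed

lemma test_set_unique:
  assumes "test_set C r Z" "test_set C r Z'"
  shows "Z = Z'"
proof (cases "wdf C")
  case True
  define Q where "Q m \<longleftrightarrow> (\<exists>u. pr (tail m) u \<epsilon> g \<and> \<not> is_function u n C)" for m
  obtain m where m: "m \<epsilon> om" "Z = tail m" "Q m" "\<And>k. k \<epsilon> m \<Longrightarrow> \<not> Q k"
    using assms(1) True unfolding test_set_def Q_def by blast
  obtain m' where m': "m' \<epsilon> om" "Z' = tail m'" "Q m'" "\<And>k. k \<epsilon> m' \<Longrightarrow> \<not> Q k"
    using assms(2) True unfolding test_set_def Q_def by blast
  have "m = m'" using om_linear[OF m(1) m'(1)] m(3,4) m'(3,4) by blast
  then show ?thesis using m(2) m'(2) by simp
qed (use assms in \<open>simp add: test_set_def\<close>)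

text \<open>The coordinate outside \<open>C\<close> with the least index: the natural numbers supply
  the selection that \<open>X\<close> cannot.\<close>

definition next_elem :: "'a \<Rightarrow> 'a \<Rightarrow> 'a \<Rightarrow> bool" where
  "next_elem C r x \<longleftrightarrow> (\<exists>Z u i. test_set C r Z \<and> pr Z u \<epsilon> g \<and> pr i x \<epsilon> u \<and> \<not> x \<epsilon> C \<and>
    (\<forall>j y. j \<epsilon> i \<and> pr j y \<epsilon> u \<longrightarrow> y \<epsilon> C))"

lemma next_elem_ex:
  assumes C: "is_subset C X" "wo C r"
  shows "\<exists>x. x \<epsilon> X \<and> \<not> x \<epsilon> C \<and> next_elem C r x"
proof -
  obtain Z u where Z: "test_set C r Z" "pr Z u \<epsilon> g" "\<not> is_function u n C"
    using test_set_ex[OF C] by blast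
  note u = functionD[OF g_range[OF Z(2)]]
  define Q where "Q i \<longleftrightarrow> (\<exists>x. pr i x \<epsilon> u \<and> \<not> x \<epsilon> C)" for i
  have "\<exists>i. i \<epsilon> n \<and> Q i"
  proof (rule ccontr)
    assume "\<not> ?thesis"
    then have "x \<epsilon> C" if "pr i x \<epsilon> u" for i x using u(1) that unfolding Q_def by blast
    then have "is_function u n C" unfolding is_function_iff using u(3-5) by blast
    then show False using Z(3) by blast
  qed
  then obtain i where "i \<epsilon> om" "Q i" using om_mem[OF n] by blast
  moreover have "definable (\<lambda>e. Q (e 0))" unfolding Q_def by (intro definability)
  ultimately obtain i where i: "i \<epsilon> om" "Q i" "\<And>k. k \<epsilon> i \<Longrightarrow> \<not> Q k"
    using om_least[of Q] by blast
  then obtain x where x: "pr i x \<epsilon> u" "\<not> x \<epsilon> C" unfolding Q_def by blast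
  then have "next_elem C r x" unfolding next_elem_def using Z(1,2) i(3) unfolding Q_def by blast
  then show ?thesis using x u(2) by blast
qed

lemma next_elem_unique:
  assumes "next_elem C r x" "next_elem C r y"
  shows "x = y"
proof -
  obtain Z u i where 1: "test_set C r Z" "pr Z u \<epsilon> g" "pr i x \<epsilon> u" "\<not> x \<epsilon> C"
    "\<And>j y. j \<epsilon> i \<Longrightarrow> pr j y \<epsilon> u \<Longrightarrow> y \<epsilon> C"
    using assms(1) unfolding next_elem_def by blast
  obtain Z' u' i' where 2: "test_set C r Z'" "pr Z' u' \<epsilon> g" "pr i' y \<epsilon> u'" "\<not> y \<epsilon> C"
    "\<And>j y. j \<epsilon> i' \<Longrightarrow> pr j y \<epsilon> u' \<Longrightarrow> y \<epsilon> C"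
    using assms(2) unfolding next_elem_def by blast
  have "u' = u" using test_set_unique[OF 1(1) 2(1)] g_fun 1(2) 2(2) by blast
  note u = functionD[OF g_range[OF 1(2)]]
  have "i \<epsilon> om" "i' \<epsilon> om" using u(1) 1(3) 2(3) \<open>u' = u\<close> om_mem[OF n] by blast+
  then have "i = i'" using om_linear 1(3-5) 2(3-5) \<open>u' = u\<close> by blast
  then show ?thesis using u(4) 1(3) 2(3) \<open>u' = u\<close> by blast
qed

lemma contradiction: False
proof (rule no_next_element[where G = next_elem and X = X])
  show "definable (\<lambda>e. next_elem (e 0) (e (Suc 0)) (e (Suc (Suc 0))))"
    unfolding next_elem_def by (intro definability)
qed (use next_elem_ex next_elem_unique in blast)+

end

context ZF_power_map
begin

lemma contradiction: False
proof -
  obtain S where S: "\<forall>x. x \<epsilon> X \<longrightarrow> (\<exists>m. m \<epsilon> om \<and> pr m x \<epsilon> S)"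
    "\<forall>m m' x. m \<epsilon> m' \<and> m' \<epsilon> om \<and> x \<epsilon> X \<and> pr m x \<epsilon> S \<longrightarrow> pr m' x \<epsilon> S"
    "\<not> (\<exists>m. m \<epsilon> om \<and> (\<forall>x. x \<epsilon> X \<longrightarrow> pr m x \<epsilon> S))"
    using not_wdf_X unfolding wdf_def by blast
  \<comment> \<open>Tuples have \<open>n + 1\<close> entries and one further mark is needed, so
    \<open>J\<close> has to accept \<open>n + 2\<close> second arguments.\<close>
  have N: "ins (ins n n) (ins n n) \<epsilon> om" using n by simp
  obtain J where J: "\<forall>k i. k \<epsilon> om \<and> i \<epsilon> ins (ins n n) (ins n n) \<longrightarrow>
      (\<exists>j. j \<epsilon> om \<and> pr (pr k i) j \<epsilon> J)"
    "\<forall>p q j. pr p j \<epsilon> J \<and> pr q j \<epsilon> J \<longrightarrow> p = q"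
    "\<forall>p j j'. pr p j \<epsilon> J \<and> pr p j' \<epsilon> J \<longrightarrow> j = j'"
    using ex_pairing[OF N] by blast
  interpret ZF_diagonal mem X n g J S
  proof unfold_locales
    show "ins n n \<epsilon> om" using n by simp
  qed (use S J in blast)+
  show False by (rule contradiction)
qed

end

context ZF
begin

section \<open>Finitary partitions\<close>

lemma is_partition_iff:
  "is_partition P A \<longleftrightarrow> A = big_union P \<and> \<not> emp \<epsilon> P \<and>
    (\<forall>b c x. b \<epsilon> P \<and> c \<epsilon> P \<and> x \<epsilon> b \<and> x \<epsilon> c \<longrightarrow> b = c)"
proof -
  have "is_union A P \<longleftrightarrow> A = big_union P"
    unfolding is_union_def by (auto intro: ext_eq)
  then show ?thesis unfolding is_partition_def is_empty_iff by blast
qed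

lemma is_singleton_iff: "is_singleton s \<longleftrightarrow> (\<exists>x. s = ins x emp)"
proof -
  have "upair x x = ins x emp" for x by (rule ext_eq) auto
  then show ?thesis by (simp add: is_singleton_def is_upair_iff)
qed

text \<open>The blocks in \<open>Z\<close> are broken into singletons, the others are kept. The
  bound \<open>pow (big_union P)\<close> makes the class a set.\<close>

definition split_blocks :: "'a \<Rightarrow> 'a \<Rightarrow> 'a" where
  "split_blocks P Z = coll (\<lambda>b. b \<epsilon> pow (big_union P) \<and>
    (b \<epsilon> P \<and> \<not> b \<epsilon> Z \<or> (\<exists>a c. c \<epsilon> Z \<and> a \<epsilon> c \<and> b = ins a emp)))"

lemma definable_split_blocks [definability]:
  "definable_term s \<Longrightarrow> definable_term t \<Longrightarrow> definable_term (\<lambda>e. split_blocks (s e) (t e))"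
  by (rule definable_term_subst2[where F = split_blocks], unfold split_blocks_def,
      intro definability)

lemma mem_split_blocks:
  assumes "Z \<epsilon> pow P"
  shows "b \<epsilon> split_blocks P Z \<longleftrightarrow> b \<epsilon> P \<and> \<not> b \<epsilon> Z \<or> (\<exists>a c. c \<epsilon> Z \<and> a \<epsilon> c \<and> b = ins a emp)"
proof -
  have "b \<epsilon> split_blocks P Z \<longleftrightarrow> b \<epsilon> pow (big_union P) \<and>
    (b \<epsilon> P \<and> \<not> b \<epsilon> Z \<or> (\<exists>a c. c \<epsilon> Z \<and> a \<epsilon> c \<and> b = ins a emp))"
    unfolding split_blocks_def by (rule mem_coll_sep) (intro definability)
  moreover have "b \<epsilon> pow (big_union P)" if "b \<epsilon> P" using that by (auto simp: is_subset_def)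
  moreover have "ins a emp \<epsilon> pow (big_union P)" if "c \<epsilon> Z" "a \<epsilon> c" for a c
    using that assms by (auto simp: is_subset_def)
  ultimately show ?thesis by blast
qed

lemma split_blocks_finitary:
  assumes P: "is_finitary_partition P A" and Z: "Z \<epsilon> pow P"
  shows "is_finitary_partition (split_blocks P Z) A"
proof -
  note mem = mem_split_blocks[OF Z]
  have A: "A = big_union P" and ne: "\<not> emp \<epsilon> P"
    and disj: "\<And>b c x. b \<epsilon> P \<Longrightarrow> c \<epsilon> P \<Longrightarrow> x \<epsilon> b \<Longrightarrow> x \<epsilon> c \<Longrightarrow> b = c"
    and fin: "\<And>b. b \<epsilon> P \<Longrightarrow> is_finite b"
    using P unfolding is_finitary_partition_def is_partition_iff by blast+
  have ZP: "c \<epsilon> P" if "c \<epsilon> Z" for c using Z that by (auto simp: is_subset_def)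
  have "A = big_union (split_blocks P Z)"
  proof (rule ext_eq)
    fix x
    show "x \<epsilon> A \<longleftrightarrow> x \<epsilon> big_union (split_blocks P Z)"
    proof
      assume "x \<epsilon> A"
      then obtain c where c: "c \<epsilon> P" "x \<epsilon> c" unfolding A by auto
      show "x \<epsilon> big_union (split_blocks P Z)"
      proof (cases "c \<epsilon> Z")
        case True
        then have "ins x emp \<epsilon> split_blocks P Z" using c unfolding mem by blast
        then show ?thesis by (auto intro!: exI[of _ "ins x emp"])
      next
        case False
        then have "c \<epsilon> split_blocks P Z" using c unfolding mem by blast
        then show ?thesis using c by auto
      qed
    next
      assume "x \<epsilon> big_union (split_blocks P Z)"
      then obtain b where "b \<epsilon> split_blocks P Z" "x \<epsilon> b" by auto
      then show "x \<epsilon> A" unfolding mem A mem_big_union using ZP by (metis mem_ins not_mem_emp)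
    qed
  qed
  moreover have "\<not> emp \<epsilon> split_blocks P Z" unfolding mem using ne mem_ins not_mem_emp by metis
  moreover have "b = c" if "b \<epsilon> split_blocks P Z" "c \<epsilon> split_blocks P Z" "x \<epsilon> b" "x \<epsilon> c" for b c x
  proof -
    have cases: "b \<epsilon> P \<and> \<not> b \<epsilon> Z \<or> (\<exists>d. d \<epsilon> Z \<and> x \<epsilon> d \<and> b = ins x emp)"
      if "b \<epsilon> split_blocks P Z" "x \<epsilon> b" for b
      using that unfolding mem by auto
    show ?thesis using cases[OF that(1,3)] cases[OF that(2,4)] disj ZP that(3,4) by metis
  qed
  moreover have "is_finite b" if "b \<epsilon> split_blocks P Z" for b
    using that fin finite_sing unfolding mem by blast
  ultimately show ?thesis unfolding is_finitary_partition_def is_partition_iff by blast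
qed

text \<open>\<open>Z\<close> is recovered as the set of blocks of \<open>P\<close> that are missing
  after the splitting. A singleton block would survive its own splitting, which is why such blocks
  are excluded.\<close>

lemma split_blocks_inj:
  assumes sing: "\<And>b. b \<epsilon> P \<Longrightarrow> \<not> is_singleton b"
    and Z: "Z \<epsilon> pow P" "Z' \<epsilon> pow P" "split_blocks P Z = split_blocks P Z'"
  shows "Z = Z'"
proof (rule ext_eq)
  have "b \<epsilon> Z \<longleftrightarrow> b \<epsilon> P \<and> \<not> b \<epsilon> split_blocks P Z" if Z: "Z \<epsilon> pow P" for b Z
    using sing Z unfolding mem_split_blocks[OF Z] is_singleton_iff mem_pow is_subset_def by blast
  then show "b \<epsilon> Z \<longleftrightarrow> b \<epsilon> Z'" for b using Z by metis
qed

lemma no_finite_to_one: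
  assumes A: "is_infinite A" and P: "is_finitary_partition P A"
    and sing: "\<And>b. b \<epsilon> P \<Longrightarrow> \<not> is_singleton b"
    and n: "in_omega n" and B: "is_finitary_partitions B A" and Y: "is_function_space Y n A"
    and f: "is_function f B Y" and fto: "is_finite_to_one f"
  shows False
proof -
  have AP: "A = big_union P"
    and disj: "\<And>b c x. b \<epsilon> P \<Longrightarrow> c \<epsilon> P \<Longrightarrow> x \<epsilon> b \<Longrightarrow> x \<epsilon> c \<Longrightarrow> b = c"
    and fin: "\<And>b. b \<epsilon> P \<Longrightarrow> is_finite b"
    using P unfolding is_finitary_partition_def is_partition_iff by blast+
  have n: "n \<epsilon> om" using n mem_om by blast
  \<comment> \<open>A finite union of finite blocks would be finite.\<close>
  have P_inf: "\<not> is_finite P"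
  proof
    assume "is_finite P"
    then have "is_finite A"
    proof (rule finite_fibres[where R = "\<lambda>b x. x \<epsilon> b"])
      show "definable (\<lambda>e. e (Suc 0) \<epsilon> e 0)" by (intro definability)
    qed (use fin AP in auto)
    then show False using A by (simp add: is_infinite_def)
  qed
  \<comment> \<open>\<open>v\<close> is the tuple of blocks containing the entries of the value
    \<open>u\<close> of \<open>f\<close> at the split partition.\<close>
  define h where "h Z v \<longleftrightarrow> (\<exists>u. pr (split_blocks P Z) u \<epsilon> f \<and>
      (\<forall>i b. pr i b \<epsilon> v \<longrightarrow> (\<exists>a. pr i a \<epsilon> u \<and> a \<epsilon> b)))" for Z v
  define g where "g = coll (\<lambda>p. p \<epsilon> cart (pow P) (funs n P) \<and> (\<exists>Z v. p = pr Z v \<and> h Z v))"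
  have h_def': "definable (\<lambda>e. h (e 0) (e (Suc 0)))" unfolding h_def by (intro definability)
  have "p \<epsilon> g \<longleftrightarrow> p \<epsilon> cart (pow P) (funs n P) \<and> (\<exists>Z v. p = pr Z v \<and> h Z v)" for p
    unfolding g_def by (rule mem_coll_sep) (intro definability definable_subst2[OF h_def'])
  then have g: "pr Z v \<epsilon> g \<longleftrightarrow> Z \<epsilon> pow P \<and> is_function v n P \<and> h Z v"
    and g_pair: "p \<epsilon> g \<Longrightarrow> \<exists>Z v. p = pr Z v \<and> Z \<epsilon> pow P \<and> v \<epsilon> funs n P" for Z v p
    unfolding mem_cart by auto
  have f_ex: "\<exists>u. pr (split_blocks P Z) u \<epsilon> f" if "Z \<epsilon> pow P" for Z
    using functionD(3)[OF f] split_blocks_finitary[OF P that] B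
    unfolding is_finitary_partitions_def by blast
  have f_fun: "is_function u n A" if "pr Q u \<epsilon> f" for Q u
    using functionD(2)[OF f that] Y unfolding is_function_space_def by blast
  have g_function: "is_function g (pow P) (funs n P)"
    unfolding is_function_iff
  proof (intro conjI allI impI)
    fix p assume "p \<epsilon> g"
    then show "\<exists>Z v. Z \<epsilon> pow P \<and> v \<epsilon> funs n P \<and> p = pr Z v" using g_pair by blast
  next
    fix Z assume Z: "Z \<epsilon> pow P"
    obtain u where u: "pr (split_blocks P Z) u \<epsilon> f" using f_ex[OF Z] by blast
    note uA = functionD[OF f_fun[OF u]]
    obtain v where v: "\<And>p. p \<epsilon> v \<longleftrightarrow> p \<epsilon> cart n P \<and> (\<exists>i a b. pr i a \<epsilon> u \<and> a \<epsilon> b \<and> p = pr i b)"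
      by (atomize_elim, rule separation_definable) (intro definability)
    have v_pr: "pr i b \<epsilon> v \<longleftrightarrow> b \<epsilon> P \<and> (\<exists>a. pr i a \<epsilon> u \<and> a \<epsilon> b)" for i b
      unfolding v using uA(1) by auto
    have "is_function v n P"
      unfolding is_function_iff
    proof (intro conjI allI impI)
      fix p assume "p \<epsilon> v"
      then show "\<exists>i b. i \<epsilon> n \<and> b \<epsilon> P \<and> p = pr i b" unfolding v mem_cart by blast
    next
      fix i assume "i \<epsilon> n"
      then obtain a where a: "pr i a \<epsilon> u" using uA(3) by blast
      then obtain b where "b \<epsilon> P" "a \<epsilon> b" using uA(2)[OF a] AP by auto
      then show "\<exists>b. pr i b \<epsilon> v" unfolding v_pr using a by blast
    next
      fix i b b' assume "pr i b \<epsilon> v \<and> pr i b' \<epsilon> v"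
      then show "b = b'" unfolding v_pr using uA(4) disj by metis
    qed
    moreover have "h Z v" unfolding h_def using u v_pr by blast
    ultimately show "\<exists>v. pr Z v \<epsilon> g" unfolding g using Z by blast
  next
    fix Z v v' assume "pr Z v \<epsilon> g \<and> pr Z v' \<epsilon> g"
    then have v: "is_function v n P" "h Z v" and v': "is_function v' n P" "h Z v'"
      unfolding g by blast+
    obtain u where u: "pr (split_blocks P Z) u \<epsilon> f"
      "\<And>i b. pr i b \<epsilon> v \<Longrightarrow> \<exists>a. pr i a \<epsilon> u \<and> a \<epsilon> b"
      using v(2) unfolding h_def by blast
    obtain u' where u': "pr (split_blocks P Z) u' \<epsilon> f"
      "\<And>i b. pr i b \<epsilon> v' \<Longrightarrow> \<exists>a. pr i a \<epsilon> u' \<and> a \<epsilon> b"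
      using v'(2) unfolding h_def by blast
    have "u' = u" using functionD(4)[OF f u'(1) u(1)] .
    show "v = v'"
    proof (rule function_ext[OF v(1) v'(1)])
      fix i b assume b: "pr i b \<epsilon> v"
      then obtain b' where b': "pr i b' \<epsilon> v'"
        using functionD(1)[OF v(1)] functionD(3)[OF v'(1)] by blast
      obtain a where "pr i a \<epsilon> u" "a \<epsilon> b" using u(2)[OF b] by blast
      moreover obtain a' where "pr i a' \<epsilon> u" "a' \<epsilon> b'" using u'(2)[OF b'] \<open>u' = u\<close> by blast
      moreover have "b \<epsilon> P" "b' \<epsilon> P" using functionD(2)[OF v(1) b] functionD(2)[OF v'(1) b'] .
      ultimately have "b = b'" using disj functionD(4)[OF f_fun[OF u(1)]] by metis
      then show "pr i b \<epsilon> v'" using b' by simp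
    qed
  qed
  have fibre: "wdf (coll (\<lambda>Z. Z \<epsilon> pow P \<and> pr Z v \<epsilon> g))" if v: "v \<epsilon> funs n P" for v
  proof -
    have v: "is_function v n P" using that by simp
    define F where "F = coll (\<lambda>Z. Z \<epsilon> pow P \<and> pr Z v \<epsilon> g)"
    have F: "Z \<epsilon> F \<longleftrightarrow> Z \<epsilon> pow P \<and> pr Z v \<epsilon> g" for Z
      unfolding F_def by (rule mem_coll_sep) (intro definability)
    \<comment> \<open>The tuples that pick one point from each block \<open>v i\<close>: a product
      of finite sets, through which the fibre over \<open>v\<close> is mapped by
      \<open>f\<close>.\<close>
    define T where "T = coll (\<lambda>u. u \<epsilon> funs n A \<and> (\<forall>i a. pr i a \<epsilon> u \<longrightarrow> (\<exists>b. pr i b \<epsilon> v \<and> a \<epsilon> b)))"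
    have T: "u \<epsilon> T \<longleftrightarrow> u \<epsilon> funs n A \<and> (\<forall>i a. pr i a \<epsilon> u \<longrightarrow> (\<exists>b. pr i b \<epsilon> v \<and> a \<epsilon> b))" for u
      unfolding T_def by (rule mem_coll_sep) (intro definability)
    have "wdf T"
      unfolding T_def
    proof (rule wdf_prod[OF n])
      show "definable (\<lambda>e. \<exists>b. pr (e 0) b \<epsilon> v \<and> e (Suc 0) \<epsilon> b)" by (intro definability)
      fix i assume "i \<epsilon> n"
      then obtain b where b: "pr i b \<epsilon> v" using functionD(3)[OF v] by blast
      then have "wdf b" using finite_wdf fin functionD(2)[OF v] by blast
      then show "\<exists>F. wdf F \<and> (\<forall>a. a \<epsilon> A \<and> (\<exists>b. pr i b \<epsilon> v \<and> a \<epsilon> b) \<longrightarrow> a \<epsilon> F)"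
        using functionD(4)[OF v b] by blast
    qed
    then have "wdf F"
    proof (rule wdf_fibres[where R = "\<lambda>u Z. pr (split_blocks P Z) u \<epsilon> f"])
      show "definable (\<lambda>e. pr (split_blocks P (e (Suc 0))) (e 0) \<epsilon> f)" by (intro definability)
      fix Z assume "Z \<epsilon> F"
      then obtain u where u: "pr (split_blocks P Z) u \<epsilon> f"
        "\<And>i b. pr i b \<epsilon> v \<Longrightarrow> \<exists>a. pr i a \<epsilon> u \<and> a \<epsilon> b"
        unfolding F g h_def by blast
      note uA = functionD[OF f_fun[OF u(1)]]
      have "\<exists>b. pr i b \<epsilon> v \<and> a \<epsilon> b" if "pr i a \<epsilon> u" for i a
        using uA(1)[OF that] functionD(3)[OF v] u(2) uA(4)[OF that] by blast
      then have "u \<epsilon> T" unfolding T mem_funs using f_fun[OF u(1)] by blast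
      then show "\<exists>u. u \<epsilon> T \<and> pr (split_blocks P Z) u \<epsilon> f" using u(1) by blast
    next
      fix u
      show "\<exists>G. wdf G \<and> (\<forall>Z. Z \<epsilon> F \<and> pr (split_blocks P Z) u \<epsilon> f \<longrightarrow> Z \<epsilon> G)"
      proof (cases "\<exists>Q. pr Q u \<epsilon> f")
        case False
        then show ?thesis using finite_wdf[OF finite_emp] by blast
      next
        case True
        then obtain S where S: "\<And>Q. Q \<epsilon> S \<longleftrightarrow> pr Q u \<epsilon> f" "is_finite S"
          using fto unfolding is_finite_to_one_def is_preimage_of_point_def maps_to_iff by blast
        obtain G where G: "\<And>Z. Z \<epsilon> G \<longleftrightarrow> Z \<epsilon> pow P \<and> pr (split_blocks P Z) u \<epsilon> f"
          by (atomize_elim, rule separation_definable) (intro definability)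
        \<comment> \<open>The partitions with value \<open>u\<close> form the finite set
          \<open>S\<close>, and each of them comes from at most one \<open>Z\<close>.\<close>
        have "wdf G"
        proof (rule wdf_image[OF finite_wdf[OF S(2)], where R = "\<lambda>Q Z. Q = split_blocks P Z"])
          show "definable (\<lambda>e. e 0 = split_blocks P (e (Suc 0)))" by (intro definability)
          show "Z = Z'" if "Z \<epsilon> G" "Z' \<epsilon> G" "Q = split_blocks P Z" "Q = split_blocks P Z'"
            for Q Z Z'
            by (rule split_blocks_inj[OF sing]) (use that in \<open>auto simp: G\<close>)
          show "\<exists>Q. Q \<epsilon> S \<and> Q = split_blocks P Z" if "Z \<epsilon> G" for Z
            using that unfolding G S(1) by blast
        qed
        then show ?thesis using G F by blast
      qed
    qed
    then show ?thesis unfolding F_def .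
  qed
  interpret ZF_power_map mem P n g
    by unfold_locales (use P_inf n g_function fibre in blast)+
  show False by (rule contradiction)
qed

end

theorem theorem4p22:
  fixes mem :: "'v \<Rightarrow> 'v \<Rightarrow> bool"
  assumes "ZF mem"
  shows "\<forall>A. mem_structure.is_infinite mem A \<longrightarrow>
           (\<exists>P. mem_structure.is_finitary_partition mem P A \<and>
                (\<forall>b. mem b P \<longrightarrow> \<not> mem_structure.is_singleton mem b)) \<longrightarrow>
           (\<forall>n. mem_structure.in_omega mem n \<longrightarrow>
             (\<forall>B Y. mem_structure.is_finitary_partitions mem B A \<longrightarrow>
                    mem_structure.is_function_space mem Y n A \<longrightarrow>
                    \<not> (\<exists>f. mem_structure.is_function mem f B Y \<and>
                           mem_structure.is_finite_to_one mem f)))"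
proof -
  interpret ZF mem by (rule assms)
  show ?thesis using no_finite_to_one by blast
qed

end
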